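(* Let $G$ be a graph of maximum degree $\Delta$ whose vertex set is partitioned into blocks of size $b$. If $$b\ \ge\ \frac{\Delta}{s}\Bigl(1+c\sqrt{\frac{\log s}{s}}\Bigr)$$ for some constant $c$, then $G$ has a transversal which does not contain any $s$-stars, and which can be found in randomized polynomial time.
   Context: Graphs are finite and undirected. Here $s$ is a positive integer and $c$ is a universal constant (independent of $G$, $\Delta$, $b$ and $s$). A transversal is a set of vertices containing exactly one vertex from each block. An $s$-star is a star with $s$ edges, i.e. a central vertex together with $s$ other vertices (peripheral vertices) adjacent to it. A transversal $A$ contains no $s$-star if the subgraph of $G$ induced on $A$ has no $s$-star as a (not necessarily induced) subgraph.
   Formalization: The formal theorem assumes s ≥ 2: for s = 1 we have log s = 0, so the condition reads b ≥ Δ for every c, and a single edge with two blocks of size 1 (Δ = b = 1) has no transversal without a 1-star. *)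

theory Defs
  imports
    "HOL-Probability.Probability"
    "HOL-Library.Disjoint_Sets"
    "HOL-Computational_Algebra.Polynomial"
begin

section \<open>Graphs, transversals and stars\<close>

definition simple_graph :: "'a set \<Rightarrow> ('a \<times> 'a) set \<Rightarrow> bool" where
  "simple_graph V E \<longleftrightarrow> finite V \<and> E \<subseteq> V \<times> V \<and> sym E \<and> irrefl E"

definition degree_in :: "('a \<times> 'a) set \<Rightarrow> 'a \<Rightarrow> nat" where
  "degree_in E v = card {u. (v, u) \<in> E}"

text \<open>The inserted 0 only matters for the graph without vertices.\<close>

definition max_degree :: "'a set \<Rightarrow> ('a \<times> 'a) set \<Rightarrow> nat" where
  "max_degree V E = Max (insert 0 (degree_in E ` V))"

definition transversal :: "'a set set \<Rightarrow> 'a set \<Rightarrow> bool" where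
  "transversal P A \<longleftrightarrow> A \<subseteq> \<Union>P \<and> (\<forall>B\<in>P. \<exists>!v. v \<in> A \<inter> B)"

text \<open>The subgraph induced on \<open>A\<close> contains a star with centre \<open>v\<close> and set \<open>S\<close> of
  \<open>s\<close> peripheral vertices; further edges inside \<open>S\<close> are allowed.\<close>

definition contains_star :: "('a \<times> 'a) set \<Rightarrow> 'a set \<Rightarrow> nat \<Rightarrow> bool" where
  "contains_star E A s \<longleftrightarrow>
     (\<exists>v\<in>A. \<exists>S. S \<subseteq> A - {v} \<and> finite S \<and> card S = s \<and> (\<forall>u\<in>S. (v, u) \<in> E))"


section \<open>Randomized algorithms\<close>

text \<open>Algorithms are programs of a deeply embedded probabilistic while-language. The memory
  consists of the finitely many arrays named in the program, each of unbounded length, with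
  entries in \<open>nat\<close>; a scalar variable is an array used at index 0 only. The only
  arithmetic operations are addition and truncated subtraction, so that the bit length of
  every stored number grows at most linearly with the number of executed commands. Hence unit
  cost per command is polynomially equivalent to the cost of a probabilistic Turing machine.
  The only source of randomness is the fair coin.\<close>

datatype aexp =
    Const nat
  | Read string aexp
  | Plus aexp aexp
  | Minus aexp aexp

datatype bexp =
    Less aexp aexp
  | Not bexp
  | And bexp bexp

datatype com =
    Skip
  | Write string aexp aexp
  | Coin string aexp
  | Seq com com
  | If bexp com com
  | While bexp com

type_synonym state = "string \<Rightarrow> nat \<Rightarrow> nat"

primrec aval :: "aexp \<Rightarrow> state \<Rightarrow> nat" where
  "aval (Const k) \<sigma> = k"
| "aval (Read a e) \<sigma> = \<sigma> a (aval e \<sigma>)"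
| "aval (Plus e f) \<sigma> = aval e \<sigma> + aval f \<sigma>"
| "aval (Minus e f) \<sigma> = aval e \<sigma> - aval f \<sigma>"

primrec bval :: "bexp \<Rightarrow> state \<Rightarrow> bool" where
  "bval (Less e f) \<sigma> \<longleftrightarrow> aval e \<sigma> < aval f \<sigma>"
| "bval (Not b) \<sigma> \<longleftrightarrow> \<not> bval b \<sigma>"
| "bval (And b c) \<sigma> \<longleftrightarrow> bval b \<sigma> \<and> bval c \<sigma>"

definition update :: "string \<Rightarrow> nat \<Rightarrow> nat \<Rightarrow> state \<Rightarrow> state" where
  "update a i k \<sigma> = \<sigma>(a := (\<sigma> a)(i := k))"

partial_function (spmf) while_spmf ::
    "('x \<Rightarrow> bool) \<Rightarrow> ('x \<Rightarrow> 'x spmf) \<Rightarrow> 'x \<Rightarrow> 'x spmf" where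
  "while_spmf g f x = (if g x then bind_spmf (f x) (\<lambda>y. while_spmf g f y) else return_spmf x)"

text \<open>A configuration is a memory state together with the number of steps executed so far.
  Every command and every evaluation of a branching or loop condition is one step. The
  missing mass of the resulting subprobability distribution is the probability of
  nontermination.\<close>

type_synonym config = "state \<times> nat"

definition tick :: "config \<Rightarrow> config" where
  "tick x = (fst x, Suc (snd x))"

primrec run :: "com \<Rightarrow> config \<Rightarrow> config spmf" where
  "run Skip = (\<lambda>x. return_spmf (tick x))"
| "run (Write a e f) = (\<lambda>x. return_spmf
     (tick (update a (aval e (fst x)) (aval f (fst x)) (fst x), snd x)))"
| "run (Coin a e) = (\<lambda>x. map_spmf
     (\<lambda>h. tick (update a (aval e (fst x)) (of_bool h) (fst x), snd x)) coin_spmf)"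
| "run (Seq c d) = (\<lambda>x. bind_spmf (run c x) (run d))"
| "run (If b c d) = (\<lambda>x. if bval b (fst x) then run c (tick x) else run d (tick x))"
| "run (While b c) = (\<lambda>x. map_spmf tick
     (while_spmf (\<lambda>y. bval b (fst y)) (\<lambda>y. run c (tick y)) x))"

definition expected_time :: "com \<Rightarrow> state \<Rightarrow> ennreal" where
  "expected_time prog \<sigma> =
     (\<integral>\<^sup>+ x. of_nat (snd x) \<partial>measure_spmf (run prog (\<sigma>, 0)))"

text \<open>Las Vegas semantics: almost sure termination, correctness of every possible result,
  and a bound on the expected number of steps.\<close>

definition las_vegas :: "com \<Rightarrow> state \<Rightarrow> (state \<Rightarrow> bool) \<Rightarrow> ennreal \<Rightarrow> bool" where
  "las_vegas prog \<sigma> good T \<longleftrightarrow>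
     lossless_spmf (run prog (\<sigma>, 0)) \<and>
     (\<forall>x\<in>set_spmf (run prog (\<sigma>, 0)). good (fst x)) \<and>
     expected_time prog \<sigma> \<le> T"

text \<open>A graph on \<open>{..<n}\<close> is given by its row-major adjacency matrix, a partition by
  mapping each vertex to the least vertex of its block. All other entries are 0. The vertex
  set returned is the one whose characteristic vector is in the array \<open>out\<close>.\<close>

definition encoding :: "nat \<Rightarrow> (nat \<times> nat) set \<Rightarrow> nat set set \<Rightarrow> nat \<Rightarrow> state" where
  "encoding n E P s = (\<lambda>a i. 0)
     (''n'' := (\<lambda>i. if i = 0 then n else 0),
      ''s'' := (\<lambda>i. if i = 0 then s else 0),
      ''adj'' := (\<lambda>i. if i < n * n then of_bool ((i div n, i mod n) \<in> E) else 0),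
      ''block'' := (\<lambda>i. if i < n then (LEAST u. \<exists>B\<in>P. i \<in> B \<and> u \<in> B) else 0))"

definition result_of :: "nat \<Rightarrow> state \<Rightarrow> nat set" where
  "result_of n \<sigma> = {v. v < n \<and> \<sigma> ''out'' v = 1}"


section \<open>The degenerate case \<open>s = 1\<close>\<close>

text \<open>For \<open>s = 1\<close> the term \<open>log s\<close> vanishes, and no constant makes the condition
  \<open>b \<ge> \<Delta>\<close> sufficient: take a single edge and blocks of size 1. So \<open>s \<ge> 2\<close> is
  required whenever \<open>log s\<close> is read literally.\<close>

lemma no_transversal_for_one_star:
  fixes c :: real
  defines "E \<equiv> {(0, 1), (1, 0)} :: (nat \<times> nat) set" and "P \<equiv> {{0}, {1}} :: nat set set"
  shows "simple_graph {..<2} E" "partition_on {..<2} P" "\<forall>B\<in>P. card B = 1"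
    and "real 1 \<ge> real (max_degree {..<2} E) / real 1 * (1 + c * sqrt (ln (real 1) / real 1))"
    and "transversal P A \<Longrightarrow> contains_star E A 1"
proof -
  have two: "{..<2} = {0, 1 :: nat}" by auto
  show "simple_graph {..<2} E"
    by (auto simp: simple_graph_def E_def sym_def irrefl_def)
  show "partition_on {..<2} P"
    by (auto simp: partition_on_def P_def disjoint_def two)
  show "\<forall>B\<in>P. card B = 1" by (auto simp: P_def)
  have "{u. (0, u) \<in> E} = {1}" "{u. (1, u) \<in> E} = {0}" by (auto simp: E_def)
  then have "max_degree {..<2} E = 1" by (simp add: max_degree_def degree_in_def two)
  then show "real 1 \<ge> real (max_degree {..<2} E) / real 1 * (1 + c * sqrt (ln (real 1) / real 1))"
    by simp
  assume "transversal P A"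
  then have "0 \<in> A" "1 \<in> A" by (auto simp: transversal_def P_def)
  then show "contains_star E A 1"
    unfolding contains_star_def E_def
    by (intro bexI[of _ 0] exI[of _ "{1}"]) auto
qed

end

theory Submission
  imports Defs
begin

text \<open>
  Build the transversal one vertex at a time. Put a random vertex \<open>w\<close> into a block that is not
  yet met; if this creates an \<open>s\<close>-star with centre \<open>x\<close>, delete \<open>w\<close>, \<open>x\<close> and \<open>e\<close> random
  neighbours of \<open>x\<close>, where \<open>e\<close> is about \<open>sqrt (s * ln s)\<close>. A step with a deletion can be undone
  if \<open>x\<close>, \<open>w\<close> and the deleted vertices are known. Hence the sum of the failure probabilities
  over all transversals \<open>A\<close> of a set \<open>U\<close> of blocks, each weighted with \<open>b powr - card U\<close>,
  satisfies a recursion in which a deletion has weight at most \<open>(s + 1) * l ^ e\<close> up to constants,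
  where \<open>l = \<Delta> / (b * (s - e))\<close>: of the \<open>\<Delta>\<close> possible neighbours one was chosen among at least
  \<open>s - e\<close> present ones, and its block was set to this vertex with probability \<open>1 / b\<close>. Since
  \<open>l ^ e\<close> is at most a large negative power of \<open>s\<close>, the deletions are too rare to stop the progress,
  and polynomially many steps suffice with probability at least \<open>1 / 2\<close>. There is no dependence
  on \<open>\<Delta>\<close> because only the deleted vertices, not the whole star, are charged.

  The algorithm does not compute \<open>e\<close> but guesses it in every trial.
\<close>

section \<open>A branching process on partial transversals\<close>

text \<open>For one particular \<open>A\<close> the next vertex may be very likely to create a star,
  so no useful bound on failure holds uniformly in \<open>A\<close>; only the sum over all
  transversals of \<open>U\<close> is controlled, and nothing has to be known about the distribution
  of the current \<open>A\<close>. The start is covered because \<open>U = {}\<close> has exactly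
  one transversal. Progress is measured by the potential \<open>z ^ j\<close>, where
  \<open>j\<close> counts the unmet blocks and \<open>z = 1 + 1 / (e + 1)\<close>. A step without
  deletion divides it by \<open>z\<close>, a gain of \<open>1 / (e + 2)\<close>; a deletion raises
  \<open>j\<close> by at most \<open>e + 1\<close> and so multiplies the potential by at most 3. It
  is therefore enough that the deletions have weight of order \<open>1 / e\<close>. Fair coins give
  exactly uniform numbers in bounded time only below powers of two. Hence every choice carries a
  factor \<open>1 + \<eta>\<close>, and \<eta> must be small against the gain of a step, which leads
  to \<open>1 / (16 * n)\<close>.\<close>

locale blocked_graph =
  fixes n :: nat and E :: "(nat \<times> nat) set" and P :: "nat set set" and b s :: nat
  assumes graph: "simple_graph {..<n} E"
    and partition: "partition_on {..<n} P"
    and card_block: "\<And>B. B \<in> P \<Longrightarrow> card B = b"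
begin

definition nb :: "nat \<Rightarrow> nat set" where "nb v = {u. (v, u) \<in> E}"

text \<open>Written with the very set whose least element \<open>encoding\<close> stores for
  \<open>v\<close>, so that the input array can later be identified with \<open>rep\<close> by
  unfolding.\<close>

definition bl :: "nat \<Rightarrow> nat set" where "bl v = {u. \<exists>B\<in>P. v \<in> B \<and> u \<in> B}"

definition free :: "nat set \<Rightarrow> nat set" where "free A = {v. v < n \<and> A \<inter> bl v = {}}"

text \<open>The centres of the \<open>s\<close>-stars in the subgraph induced on \<open>A\<close>:
  any \<open>s\<close> neighbours inside \<open>A\<close> can serve as peripheral vertices.\<close>

definition bad :: "nat set \<Rightarrow> nat set" where "bad A = {x\<in>A. s \<le> card (nb x \<inter> A)}"

abbreviation \<Delta> :: nat where "\<Delta> \<equiv> max_degree {..<n} E"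

section \<open>Elementary facts on neighbourhoods and blocks\<close>

lemma edge_lt: "(u, v) \<in> E \<Longrightarrow> u < n \<and> v < n"
  using graph by (auto simp: simple_graph_def)

lemma edge_sym: "(u, v) \<in> E \<Longrightarrow> (v, u) \<in> E"
  using graph unfolding simple_graph_def by (meson symD)

lemma edge_irrefl: "(v, v) \<notin> E"
  using graph unfolding simple_graph_def by (meson irreflD)

lemma nb_subset: "nb v \<subseteq> {..<n}"
  using edge_lt by (auto simp: nb_def)

lemma finite_nb [simp]: "finite (nb v)"
  using nb_subset finite_subset by blast

lemma card_nb_le: "card (nb v) \<le> \<Delta>"
proof (cases "v < n")
  case True
  then show ?thesis unfolding max_degree_def nb_def degree_in_def
    by (intro Max_ge) auto
next
  case False
  then have "nb v = {}" using edge_lt by (auto simp: nb_def)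
  then show ?thesis by simp
qed

lemma finite_P [simp]: "finite P"
  using partition finite_elements by blast

lemma Union_P: "\<Union>P = {..<n}"
  using partition by (simp add: partition_on_def)

lemma block_unique: "B \<in> P \<Longrightarrow> B' \<in> P \<Longrightarrow> v \<in> B \<Longrightarrow> v \<in> B' \<Longrightarrow> B = B'"
  using partition by (auto simp: partition_on_def disjoint_def)

lemma bl_eq: "B \<in> P \<Longrightarrow> v \<in> B \<Longrightarrow> bl v = B"
  using block_unique by (auto simp: bl_def)

lemma bl_in_P: "v < n \<Longrightarrow> bl v \<in> P" and in_bl: "v < n \<Longrightarrow> v \<in> bl v"
proof -
  assume "v < n"
  then obtain B where "B \<in> P" "v \<in> B" using Union_P by blast
  then show "bl v \<in> P" "v \<in> bl v" using bl_eq by auto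
qed

lemma finite_block [simp]: "B \<in> P \<Longrightarrow> finite B"
  using Union_P by (metis Union_upper finite_lessThan finite_subset)

lemma b_pos: "B \<in> P \<Longrightarrow> 0 < b"
  using card_block partition by (metis card_gt_0_iff finite_block partition_on_def)

section \<open>Transversals of a set of blocks under insertion and removal of a vertex\<close>

lemma transversal_subset:
  assumes "U \<subseteq> P" "transversal U A"
  shows "A \<subseteq> {..<n}"
proof -
  have "A \<subseteq> \<Union>U" using assms(2) by (simp add: transversal_def)
  also have "\<Union>U \<subseteq> {..<n}" unfolding Union_P[symmetric] using assms(1) by (rule Union_mono)
  finally show ?thesis .
qed

lemma finite_transversals [simp]: "U \<subseteq> P \<Longrightarrow> finite {A. transversal U A}"
  by (rule finite_subset[of _ "Pow {..<n}"]) (use transversal_subset in auto)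

lemma transversal_empty: "{A. transversal {} A} = {{}}"
  by (auto simp: transversal_def)

lemma transversal_insert:
  assumes "U \<subseteq> P" "B \<in> P" "B \<notin> U" "transversal U A" "w \<in> B"
  shows "transversal (insert B U) (insert w A)" "w \<notin> A" "A \<inter> B = {}"
proof -
  show 1: "A \<inter> B = {}"
    using assms block_unique unfolding transversal_def by blast
  then show "w \<notin> A" using assms by auto
  have 2: "insert w A \<inter> B = {w}" using 1 assms by auto
  have 3: "insert w A \<inter> B' = A \<inter> B'" if "B' \<in> U" for B'
    using that assms block_unique by blast
  have "\<exists>!v. v \<in> insert w A \<inter> B'" if "B' \<in> insert B U" for B'
  proof (cases "B' = B")
    case True
    then show ?thesis using 2 by simp
  next
    case False
    then have "B' \<in> U" using that by simp
    then show ?thesis using 3 assms(4) unfolding transversal_def by metis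
  qed
  moreover have "A \<subseteq> \<Union>U" using assms(4) by (simp add: transversal_def)
  then have "insert w A \<subseteq> \<Union>(insert B U)" using assms(5) by auto
  ultimately show "transversal (insert B U) (insert w A)"
    unfolding transversal_def by simp
qed

lemma transversal_remove:
  assumes "U \<subseteq> P" "B \<in> P" "y \<in> B" "transversal U A" "y \<in> A"
  shows "B \<in> U" "transversal (U - {B}) (A - {y})"
proof -
  show B: "B \<in> U" using assms block_unique unfolding transversal_def by blast
  have AB: "A \<inter> B = {y}" using B assms unfolding transversal_def by blast
  have "(A - {y}) \<inter> B' = A \<inter> B'" if "B' \<in> U - {B}" for B'
    using that assms block_unique by blast
  then have "\<exists>!v. v \<in> (A - {y}) \<inter> B'" if "B' \<in> U - {B}" for B'
    using that assms(4) unfolding transversal_def by simp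
  moreover have "A - {y} \<subseteq> \<Union>(U - {B})"
    using AB assms unfolding transversal_def by blast
  ultimately show "transversal (U - {B}) (A - {y})"
    unfolding transversal_def by blast
qed

lemma free_transversal:
  assumes "U \<subseteq> P" "transversal U A"
  shows "free A = \<Union>(P - U)"
proof (intro set_eqI iffI)
  fix v assume v: "v \<in> free A"
  then have "bl v \<in> P" "v \<in> bl v" using bl_in_P in_bl by (auto simp: free_def)
  moreover have "bl v \<notin> U" using v assms unfolding transversal_def free_def by blast
  ultimately show "v \<in> \<Union>(P - U)" by auto
next
  fix v assume "v \<in> \<Union>(P - U)"
  then obtain B where B: "B \<in> P" "B \<notin> U" "v \<in> B" by auto
  then show "v \<in> free A"
    using transversal_insert(3)[OF assms(1) B(1,2) assms(2) B(3)] Union_P bl_eq[OF B(1,3)]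
    by (auto simp: free_def)
qed

lemma sum_free:
  assumes "U \<subseteq> P" "transversal U A"
  shows "sum h (free A) = (\<Sum>B\<in>P - U. sum h B)"
  unfolding free_transversal[OF assms]
proof -
  have "B \<inter> B' = {}" if "B \<in> P" "B' \<in> P" "B \<noteq> B'" for B B'
    using that block_unique by blast
  then show "sum h (\<Union>(P - U)) = (\<Sum>B\<in>P - U. sum h B)"
    by (subst sum.Union_disjoint) auto
qed

lemma card_free:
  assumes "U \<subseteq> P" "transversal U A"
  shows "card (free A) = card (P - U) * b"
proof -
  have "card (free A) = (\<Sum>B\<in>P - U. card B)" using sum_free[OF assms, of "\<lambda>_. 1 :: nat"] by simp
  also have "\<dots> = (\<Sum>B\<in>P - U. b)" by (rule sum.cong) (auto simp: card_block)
  finally show ?thesis by simp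
qed

text \<open>The pair \<open>(A, w)\<close> can be recovered from \<open>insert w A\<close>:
  \<open>w\<close> is its only vertex in \<open>B\<close>, and \<open>A\<close> is the rest. So no
  transversal is counted twice.\<close>

lemma sum_transversal_insert:
  fixes f :: "nat set \<Rightarrow> real"
  assumes "U \<subseteq> P" "B \<in> P" "B \<notin> U" "\<And>A. 0 \<le> f A"
  shows "(\<Sum>A | transversal U A. \<Sum>w\<in>B. f (insert w A)) \<le> (\<Sum>A | transversal (insert B U) A. f A)"
proof -
  let ?g = "\<lambda>(A, w). insert w A"
  have inj: "inj_on ?g ({A. transversal U A} \<times> B)"
  proof (rule inj_onI, clarify)
    fix A w A' w'
    assume *: "transversal U A" "w \<in> B" "transversal U A'" "w' \<in> B" "insert w A = insert w' A'"
    have "A \<inter> B = {}" "A' \<inter> B = {}"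
      using transversal_insert(3)[OF assms(1-3)] *(1-4) by auto
    then have "insert w A \<inter> B = {w}" "insert w A - B = A"
      "insert w' A' \<inter> B = {w'}" "insert w' A' - B = A'" using *(2,4) by auto
    then show "A = A' \<and> w = w'" using *(5) by (metis singleton_inject)
  qed
  have "(\<Sum>A | transversal U A. \<Sum>w\<in>B. f (insert w A)) = sum f (?g ` ({A. transversal U A} \<times> B))"
    by (subst sum.reindex[OF inj]) (simp add: sum.cartesian_product split_def o_def)
  also have "\<dots> \<le> (\<Sum>A | transversal (insert B U) A. f A)"
  proof (rule sum_mono2)
    show "finite {A. transversal (insert B U) A}" using assms(1,2) by simp
    show "?g ` ({A. transversal U A} \<times> B) \<subseteq> {A. transversal (insert B U) A}"
      using transversal_insert(1)[OF assms(1-3)] by auto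
  qed (rule assms(4))
  finally show ?thesis .
qed

text \<open>For a fixed \<open>y\<close> the map that deletes \<open>y\<close> is injective on the
  sets containing \<open>y\<close>. The number of blocks drops by one without a sum over
  \<open>B\<close>; relative to the normalisation \<open>b ^ card U\<close> this is the factor
  \<open>1 / b\<close> paid for each deleted vertex.\<close>

lemma sum_transversal_remove:
  fixes f :: "nat set \<Rightarrow> real"
  assumes "U \<subseteq> P" "B \<in> P" "y \<in> B" "\<And>A. 0 \<le> f A"
  shows "(\<Sum>A | transversal U A. of_bool (y \<in> A) * f (A - {y})) \<le>
    of_bool (B \<in> U) * (\<Sum>A | transversal (U - {B}) A. f A)"
proof (cases "B \<in> U")
  case True
  let ?S = "{A. transversal U A \<and> y \<in> A}"
  have inj: "inj_on (\<lambda>A. A - {y}) ?S" by (rule inj_onI) blast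
  have "(\<Sum>A | transversal U A. of_bool (y \<in> A) * f (A - {y})) = (\<Sum>A\<in>?S. f (A - {y}))"
    using assms(1) by (intro sum.mono_neutral_cong_right) auto
  also have "\<dots> = sum f ((\<lambda>A. A - {y}) ` ?S)"
    by (subst sum.reindex[OF inj]) simp
  also have "\<dots> \<le> (\<Sum>A | transversal (U - {B}) A. f A)"
    using assms transversal_remove(2)[OF assms(1-3)] by (intro sum_mono2) (auto intro: finite_transversals)
  finally show ?thesis using True by simp
next
  case False
  then have "\<not> (transversal U A \<and> y \<in> A)" for A
    using transversal_remove(1)[OF assms(1-3)] by blast
  then show ?thesis using False by (intro sum_nonpos[THEN order_trans]) auto
qed

section \<open>The recursion for the failure weights\<close>

text \<open>Bounds the expectation of a nonnegative \<open>h\<close> at a random element of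
  \<open>C\<close> that takes each value with probability at most
  \<open>(1 + \<eta>) / card C\<close>. For empty \<open>C\<close> it is 0 and bounds nothing, so
  that case is split off wherever \<open>avg\<close> is used in a recursion.\<close>

definition avg :: "real \<Rightarrow> nat set \<Rightarrow> (nat \<Rightarrow> real) \<Rightarrow> real" where
  "avg \<eta> C h = (1 + \<eta>) / card C * (\<Sum>y\<in>C. h y)"

text \<open>Deletes \<open>k\<close> random elements of \<open>N\<close> one after the other; a
  round that finds none does nothing, exactly as in the program.\<close>

primrec removal :: "real \<Rightarrow> nat set \<Rightarrow> (nat set \<Rightarrow> real) \<Rightarrow> nat \<Rightarrow> nat set \<Rightarrow> real" where
  "removal \<eta> N f 0 A = f A"
| "removal \<eta> N f (Suc k) A =
     (if N \<inter> A = {} then removal \<eta> N f k A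
      else avg \<eta> (N \<inter> A) (\<lambda>y. removal \<eta> N f k (A - {y})))"

text \<open>\<open>failure \<eta> e N A\<close> bounds the probability that \<open>N\<close> steps starting with \<open>A\<close> do not
  suffice. Random choices are uniform up to a factor \<open>1 + \<eta>\<close>. How the centre \<open>x\<close> is chosen is
  irrelevant: the sum over all candidates is used, and the factor 2 absorbs \<open>1 + \<eta>\<close>.\<close>

definition repair :: "real \<Rightarrow> nat \<Rightarrow> (nat set \<Rightarrow> real) \<Rightarrow> nat \<Rightarrow> nat set \<Rightarrow> real" where
  "repair \<eta> e f w A = (if bad A = {} then f A
     else (\<Sum>x | x \<in> bad A \<and> (x = w \<or> (x, w) \<in> E). 2 * removal \<eta> (nb x) f e (A - {w, x})))"

primrec failure :: "real \<Rightarrow> nat \<Rightarrow> nat \<Rightarrow> nat set \<Rightarrow> real" where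
  "failure \<eta> e 0 A = 1"
| "failure \<eta> e (Suc N) A =
     (if free A = {} then 0
      else avg \<eta> (free A) (\<lambda>w. repair \<eta> e (failure \<eta> e N) w (insert w A)))"

lemma avg_nonneg: "0 \<le> \<eta> \<Longrightarrow> (\<And>y. 0 \<le> h y) \<Longrightarrow> 0 \<le> avg \<eta> C h"
  unfolding avg_def by (intro mult_nonneg_nonneg sum_nonneg divide_nonneg_nonneg) auto

lemma removal_nonneg: "0 \<le> \<eta> \<Longrightarrow> (\<And>A. 0 \<le> f A) \<Longrightarrow> 0 \<le> removal \<eta> N f k A"
  by (induction k arbitrary: A) (auto intro: avg_nonneg)

lemma repair_nonneg: "0 \<le> \<eta> \<Longrightarrow> (\<And>A. 0 \<le> f A) \<Longrightarrow> 0 \<le> repair \<eta> e f w A"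
  unfolding repair_def by (auto intro!: sum_nonneg removal_nonneg)

lemma failure_nonneg: "0 \<le> \<eta> \<Longrightarrow> 0 \<le> failure \<eta> e N A"
  by (induction N arbitrary: A) (auto intro: avg_nonneg repair_nonneg)

section \<open>Averaging over all transversals of a set of blocks\<close>

lemma card_Diff_minus: "U \<subseteq> P \<Longrightarrow> B \<in> U \<Longrightarrow> card (P - (U - {B})) = Suc (card (P - U))"
proof -
  assume *: "U \<subseteq> P" "B \<in> U"
  then have "P - (U - {B}) = insert B (P - U)" by auto
  then show ?thesis using * by simp
qed

text \<open>The guard ensures that at least \<open>h\<close> neighbours are present at each of the
  \<open>k\<close> deletions, so each one is hit with probability at most
  \<open>(1 + \<eta>) / h\<close>. There are at most \<Delta> candidates \<open>y\<close>, and
  fixing \<open>y\<close> costs \<open>1 / b\<close>; the product is the base of the power. The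
  \<open>+ 1\<close> in the guard stands for the vertex \<open>w\<close> added last, which may
  belong to the star but is no longer in \<open>A\<close>.\<close>

lemma sum_removal_le:
  fixes \<eta> :: real and f :: "nat set \<Rightarrow> real" and g :: "nat \<Rightarrow> real"
  assumes \<eta>: "0 \<le> \<eta>" and f: "\<And>A. 0 \<le> f A" and g: "\<And>j. 0 \<le> g j" and h: "0 < h"
    and fg: "\<And>U. U \<subseteq> P \<Longrightarrow> (\<Sum>A | transversal U A. f A) \<le> real b ^ card U * g (card (P - U))"
  shows "U \<subseteq> P \<Longrightarrow>
    (\<Sum>A | transversal U A. of_bool (h + k \<le> card (nb x \<inter> A) + 1) * removal \<eta> (nb x) f k A)
    \<le> real b ^ card U * ((1 + \<eta>) * real \<Delta> / (real b * real h)) ^ k * g (card (P - U) + k)"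
proof (induction k arbitrary: U)
  case 0
  have "(\<Sum>A | transversal U A. of_bool (h + 0 \<le> card (nb x \<inter> A) + 1) * f A) \<le>
      (\<Sum>A | transversal U A. f A)"
    using f by (intro sum_mono) (auto simp: of_bool_def)
  then show ?case using fg[OF 0] by simp
next
  case (Suc k)
  note U = Suc.prems
  let ?c = "\<lambda>k A. of_bool (h + k \<le> card (nb x \<inter> A) + 1) :: real"
  let ?r = "removal \<eta> (nb x) f k"
  let ?l = "(1 + \<eta>) * real \<Delta> / (real b * real h)"
  have r: "0 \<le> ?r A" for A using removal_nonneg[of \<eta> f] \<eta> f by auto
  \<comment> \<open>The sum is extended to all of \<open>nb x\<close>, which does not depend on
    \<open>A\<close>, so that the sums over \<open>y\<close> and \<open>A\<close> can be
    exchanged.\<close>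
  have step: "?c (Suc k) A * removal \<eta> (nb x) f (Suc k) A \<le>
      (1 + \<eta>) / real h * (\<Sum>y\<in>nb x. of_bool (y \<in> A) * (?c k (A - {y}) * ?r (A - {y})))" for A
  proof (cases "h + Suc k \<le> card (nb x \<inter> A) + 1")
    case True
    then have ne: "nb x \<inter> A \<noteq> {}" "h \<le> card (nb x \<inter> A)" using h by auto
    have c: "?c k (A - {y}) = 1" if "y \<in> nb x \<inter> A" for y
    proof -
      have "nb x \<inter> (A - {y}) = nb x \<inter> A - {y}" by auto
      then have "card (nb x \<inter> (A - {y})) = card (nb x \<inter> A) - 1" using that by simp
      then show ?thesis using True ne by auto
    qed
    have "removal \<eta> (nb x) f (Suc k) A = (1 + \<eta>) / real (card (nb x \<inter> A)) * (\<Sum>y\<in>nb x \<inter> A. ?r (A - {y}))"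
      using ne by (simp add: avg_def)
    also have "\<dots> \<le> (1 + \<eta>) / real h * (\<Sum>y\<in>nb x \<inter> A. ?r (A - {y}))"
      using ne h \<eta> r by (intro mult_right_mono divide_left_mono sum_nonneg mult_pos_pos) auto
    also have "(\<Sum>y\<in>nb x \<inter> A. ?r (A - {y})) =
        (\<Sum>y\<in>nb x. of_bool (y \<in> A) * (?c k (A - {y}) * ?r (A - {y})))"
      using c by (intro sum.mono_neutral_cong_left) auto
    finally show ?thesis using True by simp
  next
    case False
    then show ?thesis using \<eta> r by (auto intro!: divide_nonneg_nonneg mult_nonneg_nonneg sum_nonneg)
  qed
  have per: "(\<Sum>A | transversal U A. of_bool (y \<in> A) * (?c k (A - {y}) * ?r (A - {y}))) \<le>
      real b ^ card U / b * ?l ^ k * g (card (P - U) + Suc k)" if y: "y \<in> nb x" for y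
  proof -
    have yn: "y < n" using y nb_subset by auto
    have B: "bl y \<in> P" "y \<in> bl y" using yn bl_in_P in_bl by auto
    have "(\<Sum>A | transversal U A. of_bool (y \<in> A) * (?c k (A - {y}) * ?r (A - {y}))) \<le>
      of_bool (bl y \<in> U) * (\<Sum>A | transversal (U - {bl y}) A. ?c k A * ?r A)"
      by (rule sum_transversal_remove[OF U B, of "\<lambda>A. ?c k A * ?r A"]) (use r in auto)
    also have "\<dots> \<le> real b ^ card U / b * ?l ^ k * g (card (P - U) + Suc k)"
    proof (cases "bl y \<in> U")
      case True
      have "finite U" using U finite_P finite_subset by blast
      then have "real b ^ card U = b * real b ^ card (U - {bl y})"
        using True by (metis card.remove power_Suc of_nat_power)
      then have "real b ^ card (U - {bl y}) = real b ^ card U / b"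
        using b_pos[OF B(1)] by simp
      moreover have "U - {bl y} \<subseteq> P" using U by auto
      ultimately show ?thesis
        using Suc.IH[of "U - {bl y}"] True unfolding card_Diff_minus[OF U True]
        by (simp del: card_Diff_insert card_Diff_singleton)
    next
      case False
      then show ?thesis using g \<eta> by (auto intro!: mult_nonneg_nonneg divide_nonneg_nonneg)
    qed
    finally show ?thesis .
  qed
  have "(\<Sum>A | transversal U A. ?c (Suc k) A * removal \<eta> (nb x) f (Suc k) A) \<le>
    (\<Sum>A | transversal U A. (1 + \<eta>) / real h *
      (\<Sum>y\<in>nb x. of_bool (y \<in> A) * (?c k (A - {y}) * ?r (A - {y}))))"
    by (intro sum_mono step)
  also have "\<dots> = (1 + \<eta>) / real h * (\<Sum>y\<in>nb x. \<Sum>A | transversal U A.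
      of_bool (y \<in> A) * (?c k (A - {y}) * ?r (A - {y})))"
    by (subst sum.swap) (simp add: sum_distrib_left)
  also have "\<dots> \<le> (1 + \<eta>) / real h * (\<Sum>y\<in>nb x. real b ^ card U / b * ?l ^ k * g (card (P - U) + Suc k))"
    using \<eta> by (intro mult_left_mono sum_mono per) auto
  also have "\<dots> \<le> (1 + \<eta>) / real h * (\<Delta> * (real b ^ card U / b * ?l ^ k * g (card (P - U) + Suc k)))"
    unfolding sum_constant using \<eta> g card_nb_le[of x]
    by (intro mult_left_mono mult_right_mono)
      (auto intro!: mult_nonneg_nonneg divide_nonneg_nonneg zero_le_power)
  also have "\<dots> = real b ^ card U * ?l ^ Suc k * g (card (P - U) + Suc k)"
    by (simp add: field_simps)
  finally show ?case .
qed

text \<open>Splits by the centre. If it is \<open>w\<close>, all of \<open>A\<close> survives the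
  first deletions; otherwise it is a neighbour of \<open>w\<close> in \<open>A\<close>, which has at
  least \<open>s - 1\<close> neighbours in \<open>A - {x}\<close>. Since \<open>x\<close> ranges
  over \<open>nb w\<close> only, at most \<Delta> centres are charged and not
  \<open>n\<close>.\<close>

lemma repair_insert_le:
  fixes \<eta> :: real
  assumes \<eta>: "0 \<le> \<eta>" and f: "\<And>A. 0 \<le> f A" and w: "w \<notin> A" and A: "finite A"
  shows "repair \<eta> e f w (insert w A) \<le> f (insert w A) +
    (2 * (of_bool (s \<le> card (nb w \<inter> A) + 1) * removal \<eta> (nb w) f e A) +
     (\<Sum>x\<in>nb w. 2 * (of_bool (x \<in> A) *
        (of_bool (s \<le> card (nb x \<inter> (A - {x})) + 1) * removal \<eta> (nb x) f e (A - {x})))))"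
    (is "_ \<le> _ + (?p + sum ?q _)")
proof (cases "bad (insert w A) = {}")
  case True
  have "0 \<le> ?p + sum ?q (nb w)"
    using removal_nonneg[of \<eta> f] \<eta> f by (intro add_nonneg_nonneg sum_nonneg) auto
  then show ?thesis using True by (simp add: repair_def)
next
  case False
  have ww: "w \<notin> nb w" using edge_irrefl by (simp add: nb_def)
  let ?X = "{x. x \<in> bad (insert w A) \<and> (x = w \<or> (x, w) \<in> E)}"
  let ?t = "\<lambda>x. if x = w then ?p else ?q x"
  have r: "0 \<le> removal \<eta> N f k A'" for N k A' using removal_nonneg[of \<eta> f] \<eta> f by auto
  have "repair \<eta> e f w (insert w A) = (\<Sum>x\<in>?X. 2 * removal \<eta> (nb x) f e (insert w A - {w, x}))"
    using False by (simp add: repair_def)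
  also have "\<dots> \<le> (\<Sum>x\<in>?X. ?t x)"
  proof (rule sum_mono)
    fix x assume x: "x \<in> ?X"
    show "2 * removal \<eta> (nb x) f e (insert w A - {w, x}) \<le> ?t x"
    proof (cases "x = w")
      case True
      have "nb w \<inter> insert w A = nb w \<inter> A" using edge_irrefl by (auto simp: nb_def)
      moreover have "insert w A - {w, x} = A" using w True by auto
      ultimately show ?thesis using x True by (auto simp: bad_def)
    next
      case xw: False
      then have "x \<in> A" "s \<le> card (nb x \<inter> insert w A)" using x by (auto simp: bad_def)
      moreover have "card (nb x \<inter> insert w A) \<le> card (insert w (nb x \<inter> (A - {x})))"
        using edge_irrefl A by (intro card_mono) (auto simp: nb_def)
      moreover have "\<dots> \<le> card (nb x \<inter> (A - {x})) + 1" using A by (simp add: card_insert_if)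
      moreover have "insert w A - {w, x} = A - {x}" using w by auto
      ultimately show ?thesis using xw by auto
    qed
  qed
  also have "\<dots> \<le> (\<Sum>x\<in>insert w (nb w). ?t x)"
  proof (rule sum_mono2)
    show "?X \<subseteq> insert w (nb w)" using edge_sym by (auto simp: nb_def)
  qed (use r in auto)
  also have "\<dots> = ?p + (\<Sum>x\<in>nb w. ?t x)"
    using ww by simp
  also have "(\<Sum>x\<in>nb w. ?t x) = sum ?q (nb w)"
    using ww by (intro sum.cong) auto
  finally show ?thesis using f[of "insert w A"] by linarith
qed

text \<open>For \<open>s > n\<close> no deletion ever happens; this is why the conditions on
  \<open>e\<close> are only required for \<open>s \<le> n\<close>.\<close>

lemma bad_large_empty: "n < s \<Longrightarrow> A \<subseteq> {..<n} \<Longrightarrow> bad A = {}"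
proof -
  assume *: "n < s" "A \<subseteq> {..<n}"
  have "card (nb x \<inter> A) \<le> card {..<n}" for x using * by (intro card_mono) auto
  then have "card (nb x \<inter> A) < s" for x using * by (metis card_lessThan le_less_trans)
  then show ?thesis by (auto simp: bad_def not_le)
qed

text \<open>The contribution of a deletion when \<open>j\<close> blocks are unmet before the step.
  With centre \<open>w\<close> there are \<open>j + e\<close> unmet blocks afterwards. Another
  centre leaves \<open>j + e + 1\<close>: it is one of at most \<Delta> neighbours of
  \<open>w\<close>, and its block was set to it at the price \<open>1 / b\<close>. The 2 comes from
  \<open>repair\<close>.\<close>

definition return_weight :: "real \<Rightarrow> nat \<Rightarrow> (nat \<Rightarrow> real) \<Rightarrow> nat \<Rightarrow> real" where
  "return_weight \<eta> e g j = (if s \<le> n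
     then 2 * ((1 + \<eta>) * real \<Delta> / (real b * real (s - e))) ^ e * (g (j + e) + real \<Delta> / real b * g (j + e + 1)) else 0)"

text \<open>Exchanging the sums puts \<open>w\<close> and \<open>x\<close> outside; for a fixed
  centre the bound for \<open>removal\<close> applies to the sum over \<open>A\<close>. The extra
  factor \<open>b\<close> on the right counts the choices of \<open>w\<close> in
  \<open>B\<close>.\<close>

lemma sum_repair_le:
  fixes \<eta> :: real and f :: "nat set \<Rightarrow> real" and g :: "nat \<Rightarrow> real"
  assumes \<eta>: "0 \<le> \<eta>" and f: "\<And>A. 0 \<le> f A" and g: "\<And>j. 0 \<le> g j" and e: "s \<le> n \<Longrightarrow> e < s"
    and fg: "\<And>U. U \<subseteq> P \<Longrightarrow> (\<Sum>A | transversal U A. f A) \<le> real b ^ card U * g (card (P - U))"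
    and U: "U \<subseteq> P" and B: "B \<in> P" "B \<notin> U"
  shows "(\<Sum>A | transversal U A. \<Sum>w\<in>B. repair \<eta> e f w (insert w A)) \<le>
    real b ^ Suc (card U) * (g (card (P - U) - 1) + return_weight \<eta> e g (card (P - U)))"
proof -
  have fin: "finite A" if "transversal U A" for A
    using transversal_subset[OF U that] finite_subset by blast
  have b: "0 < b" using b_pos[OF B(1)] .
  have finU: "finite U" using U finite_P finite_subset by blast
  let ?j = "card (P - U)"
  have add: "(\<Sum>A | transversal U A. \<Sum>w\<in>B. f (insert w A)) \<le> real b ^ Suc (card U) * g (?j - 1)"
  proof -
    have "P - insert B U = (P - U) - {B}" by auto
    then have "card (P - insert B U) = ?j - 1" using B by simp
    then show ?thesis
      using sum_transversal_insert[of U B f] fg[of "insert B U"] U B f finU by auto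
  qed
  show ?thesis
  proof (cases "s \<le> n")
    case False
    have "repair \<eta> e f w (insert w A) = f (insert w A)" if "transversal U A" "w \<in> B" for w A
    proof -
      have "insert w A \<subseteq> {..<n}" using transversal_subset[OF U that(1)] that(2) B Union_P by auto
      then show ?thesis using bad_large_empty False by (simp add: repair_def)
    qed
    then show ?thesis using add False by (simp add: return_weight_def)
  next
    case True
    let ?l = "(1 + \<eta>) * real \<Delta> / (real b * real (s - e))"
    let ?h = "s - e"
    have es: "e < s" using e True by simp
    let ?c = "\<lambda>x A. of_bool (s \<le> card (nb x \<inter> A) + 1) * removal \<eta> (nb x) f e A"
    have c: "(\<Sum>A | transversal V A. ?c x A) \<le> real b ^ card V * ?l ^ e * g (card (P - V) + e)"
      if "V \<subseteq> P" for V x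
      using sum_removal_le[OF \<eta> f g _ fg that, where h = ?h and k = e and x = x] es
      by (simp add: of_nat_diff)
    have l: "0 \<le> ?l ^ e" using \<eta> es by (intro zero_le_power divide_nonneg_nonneg) auto
    \<comment> \<open>A centre other than \<open>w\<close> is itself deleted, hence one more factor
      \<open>1 / b\<close> and one more unmet block.\<close>
    have c': "(\<Sum>A | transversal U A. of_bool (x \<in> A) * ?c x (A - {x})) \<le>
        real b ^ card U / b * ?l ^ e * g (?j + e + 1)" if "x \<in> nb w" for x w
    proof -
      have xn: "x < n" using that nb_subset by auto
      note Bx = bl_in_P[OF xn] in_bl[OF xn]
      have "(\<Sum>A | transversal U A. of_bool (x \<in> A) * ?c x (A - {x})) \<le>
        of_bool (bl x \<in> U) * (\<Sum>A | transversal (U - {bl x}) A. ?c x A)"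
        by (rule sum_transversal_remove[OF U Bx, of "?c x"]) (use removal_nonneg \<eta> f in auto)
      also have "\<dots> \<le> real b ^ card U / b * ?l ^ e * g (?j + e + 1)"
      proof (cases "bl x \<in> U")
        case True
        have "real b ^ card U = b * real b ^ card (U - {bl x})"
          using True finU by (metis card.remove power_Suc of_nat_power)
        then have "real b ^ card (U - {bl x}) = real b ^ card U / b" using b by simp
        moreover have "U - {bl x} \<subseteq> P" using U by auto
        ultimately show ?thesis
          using c[of "U - {bl x}" x] True unfolding card_Diff_minus[OF U True]
          by (simp del: card_Diff_insert card_Diff_singleton)
      next
        case False
        have "0 \<le> real b ^ card U / b * ?l ^ e * g (?j + e + 1)"
          using g l by (intro mult_nonneg_nonneg) auto
        then show ?thesis using False by simp
      qed
      finally show ?thesis .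
    qed
    have "(\<Sum>A | transversal U A. \<Sum>w\<in>B. repair \<eta> e f w (insert w A)) \<le>
      (\<Sum>A | transversal U A. \<Sum>w\<in>B. f (insert w A) +
        (2 * ?c w A + (\<Sum>x\<in>nb w. 2 * (of_bool (x \<in> A) * ?c x (A - {x})))))"
      using transversal_insert(2)[OF U B] fin
      by (intro sum_mono repair_insert_le \<eta> f) auto
    also have "\<dots> = (\<Sum>A | transversal U A. \<Sum>w\<in>B. f (insert w A)) +
      (2 * (\<Sum>w\<in>B. \<Sum>A | transversal U A. ?c w A) +
       2 * (\<Sum>w\<in>B. \<Sum>x\<in>nb w. \<Sum>A | transversal U A. of_bool (x \<in> A) * ?c x (A - {x})))"
    proof -
      have 1: "(\<Sum>w\<in>B. \<Sum>A | transversal U A. ?c w A) = (\<Sum>A | transversal U A. \<Sum>w\<in>B. ?c w A)"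
        by (rule sum.swap)
      have "(\<Sum>w\<in>B. \<Sum>x\<in>nb w. \<Sum>A | transversal U A. of_bool (x \<in> A) * ?c x (A - {x})) =
          (\<Sum>w\<in>B. \<Sum>A | transversal U A. \<Sum>x\<in>nb w. of_bool (x \<in> A) * ?c x (A - {x}))"
        by (intro sum.cong refl sum.swap)
      also have "\<dots> = (\<Sum>A | transversal U A. \<Sum>w\<in>B. \<Sum>x\<in>nb w. of_bool (x \<in> A) * ?c x (A - {x}))"
        by (rule sum.swap)
      finally show ?thesis unfolding 1 by (simp only: sum.distrib sum_distrib_left)
    qed
    also have "\<dots> \<le> real b ^ Suc (card U) * g (?j - 1) +
      (2 * (\<Sum>w\<in>B. real b ^ card U * ?l ^ e * g (?j + e)) +
       2 * (\<Sum>w\<in>B. \<Sum>x\<in>nb w. real b ^ card U / b * ?l ^ e * g (?j + e + 1)))"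
      using c[OF U] c' by (intro add_mono add mult_left_mono sum_mono) auto
    also have "\<dots> \<le> real b ^ Suc (card U) * g (?j - 1) +
      (2 * (\<Sum>w\<in>B. real b ^ card U * ?l ^ e * g (?j + e)) +
       2 * (\<Sum>w\<in>B. \<Delta> * (real b ^ card U / b * ?l ^ e * g (?j + e + 1))))"
    proof (intro add_left_mono mult_left_mono sum_mono)
      fix w
      show "(\<Sum>x\<in>nb w. real b ^ card U / b * ?l ^ e * g (?j + e + 1)) \<le>
        \<Delta> * (real b ^ card U / b * ?l ^ e * g (?j + e + 1))"
        unfolding sum_constant using g l card_nb_le[of w]
        by (intro mult_right_mono mult_nonneg_nonneg) auto
    qed simp
    also have "\<dots> = real b ^ Suc (card U) * (g (?j - 1) + return_weight \<eta> e g ?j)"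
      using True b card_block[OF B(1)] es
      by (simp add: return_weight_def of_nat_diff algebra_simps)
    finally show ?thesis .
  qed
qed

text \<open>Hypothesis \<open>zr\<close> says that one step contracts the potential
  \<open>z ^ j\<close> on average by \<open>r\<close>. It is only required for at least one unmet
  block, since otherwise \<open>failure\<close> is already 0.\<close>

lemma sum_failure_le:
  fixes \<eta> z r :: real
  assumes \<eta>: "0 \<le> \<eta>" and e: "s \<le> n \<Longrightarrow> e < s" and z: "1 \<le> z" and r: "0 \<le> r"
    and zr: "\<And>j. (1 + \<eta>) * (z ^ j + return_weight \<eta> e (\<lambda>i. z ^ i) (Suc j)) \<le> r * z ^ Suc j"
  shows "U \<subseteq> P \<Longrightarrow>
    (\<Sum>A | transversal U A. failure \<eta> e N A) \<le> real b ^ card U * (r ^ N * z ^ card (P - U))"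
proof (induction N arbitrary: U)
  case 0
  have "finite U" using 0 finite_P finite_subset by blast
  \<comment> \<open>Without steps the failure weight is 1, so the claim reduces to counting: there
    are at most \<open>b ^ card U\<close> transversals of \<open>U\<close>.\<close>
  then have "(\<Sum>A | transversal U A. 1 :: real) \<le> real b ^ card U"
    using 0
  proof (induction U)
    case empty
    then show ?case by (simp add: transversal_empty)
  next
    case (insert B U)
    let ?g = "\<lambda>(A, w). insert w A :: nat set"
    have "{A. transversal (insert B U) A} \<subseteq> ?g ` ({A. transversal U A} \<times> B)"
    proof clarify
      fix A assume A: "transversal (insert B U) A"
      then have "\<exists>!w. w \<in> A \<inter> B" by (simp add: transversal_def)
      then obtain w where w: "w \<in> A" "w \<in> B" by blast
      have "transversal U (A - {w})"
        using transversal_remove(2)[OF insert.prems _ w(2) A w(1)] insert by simp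
      then show "A \<in> ?g ` ({A. transversal U A} \<times> B)"
        using w by (intro image_eqI[of _ _ "(A - {w}, w)"]) auto
    qed
    then have "card {A. transversal (insert B U) A} \<le> card (?g ` ({A. transversal U A} \<times> B))"
      using insert by (intro card_mono finite_imageI finite_cartesian_product) auto
    also have "\<dots> \<le> card ({A. transversal U A} \<times> B)"
      using insert by (intro card_image_le finite_cartesian_product) auto
    also have "\<dots> = card {A. transversal U A} * b"
      using insert card_block by (simp add: card_cartesian_product)
    finally have "real (card {A. transversal (insert B U) A}) \<le> card {A. transversal U A} * real b"
      by (metis of_nat_mono of_nat_mult)
    also have "\<dots> \<le> real b ^ card U * real b"
      using insert by (intro mult_right_mono) auto
    finally show ?case using insert by (simp add: mult.commute)
  qed
  also have "\<dots> \<le> real b ^ card U * (r ^ 0 * z ^ card (P - U))"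
    using z by (simp add: mult_le_cancel_left1)
  finally show ?case by simp
next
  case (Suc N)
  note U = Suc.prems
  let ?f = "failure \<eta> e N" and ?g = "\<lambda>j. r ^ N * z ^ j" and ?j = "card (P - U)"
  have f: "0 \<le> ?f A" for A using failure_nonneg \<eta> by blast
  have g: "0 \<le> ?g j" for j using z r by simp
  show ?case
  proof (cases "U = P")
    case True
    have "failure \<eta> e (Suc N) A = 0" if "transversal U A" for A
      using free_transversal[OF U that] True by simp
    then show ?thesis using g[of ?j] r z by simp
  next
    case False
    then have "?j \<noteq> 0" using U by auto
    then obtain i where i: "?j = Suc i" by (cases ?j) auto
    have ne: "P - U \<noteq> {}" using False U by auto
    have b: "0 < b" using ne b_pos by auto
    have "failure \<eta> e (Suc N) A = (1 + \<eta>) / (real ?j * real b) *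
        (\<Sum>B\<in>P - U. \<Sum>w\<in>B. repair \<eta> e ?f w (insert w A))" if "transversal U A" for A
    proof -
      have c: "card (free A) = ?j * b" using card_free[OF U that] .
      then have "free A \<noteq> {}" using b i by (metis card.empty less_irrefl mult_is_0 nat.distinct(1))
      then show ?thesis
        by (simp only: failure.simps avg_def c sum_free[OF U that] if_False of_nat_mult)
    qed
    then have "(\<Sum>A | transversal U A. failure \<eta> e (Suc N) A) =
      (\<Sum>A | transversal U A. (1 + \<eta>) / (real ?j * real b) *
         (\<Sum>B\<in>P - U. \<Sum>w\<in>B. repair \<eta> e ?f w (insert w A)))"
      by (intro sum.cong) auto
    also have "\<dots> = (1 + \<eta>) / (real ?j * real b) *
        (\<Sum>B\<in>P - U. \<Sum>A | transversal U A. \<Sum>w\<in>B. repair \<eta> e ?f w (insert w A))"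
      by (subst sum.swap) (simp add: sum_distrib_left)
    also have "\<dots> \<le> (1 + \<eta>) / (real ?j * real b) *
        (\<Sum>B\<in>P - U. real b ^ Suc (card U) * (?g (?j - 1) + return_weight \<eta> e ?g ?j))"
      using \<eta> Suc.IH U f g e
      by (intro mult_left_mono sum_mono sum_repair_le) auto
    \<comment> \<open>\<open>return_weight\<close> is linear in its function argument, so the common
      factor \<open>r ^ N\<close> can be taken out.\<close>
    also have "\<dots> = real b ^ card U * r ^ N * ((1 + \<eta>) * (z ^ i + return_weight \<eta> e (\<lambda>i. z ^ i) (Suc i)))"
      using b i by (simp add: return_weight_def field_simps del: of_nat_Suc)
    also have "\<dots> \<le> real b ^ card U * r ^ N * (r * z ^ Suc i)"
      using r by (intro mult_left_mono zr) auto
    finally show ?thesis using i by (simp add: mult_ac)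
  qed
qed

corollary failure_empty_le:
  assumes "0 \<le> \<eta>" "s \<le> n \<Longrightarrow> e < s" "1 \<le> z" "0 \<le> r"
    and "\<And>j. (1 + \<eta>) * (z ^ j + return_weight \<eta> e (\<lambda>i. z ^ i) (Suc j)) \<le> r * z ^ Suc j"
  shows "failure \<eta> e N {} \<le> r ^ N * z ^ card P"
  using sum_failure_le[OF assms, of "{}" N] by (simp add: transversal_empty)

end

section \<open>Numerical estimates and the choice of \<open>e\<close>\<close>

text \<open>\<open>(1 + 3 * x) * (1 - x)\<close> exceeds 1 by \<open>x * (2 - 3 * x)\<close>, which
  is where the limit \<open>2 / 3\<close> comes from.\<close>

lemma exp_ge_1_minus_inverse: "0 \<le> x \<Longrightarrow> x \<le> 2 / 3 \<Longrightarrow> 1 \<le> exp (3 * x) * (1 - x)" for x :: real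
proof -
  assume x: "0 \<le> x" "x \<le> 2 / 3"
  have "1 \<le> 1 + x * (2 - 3 * x)" using x by simp
  also have "\<dots> = (1 + 3 * x) * (1 - x)" by (simp add: algebra_simps)
  also have "\<dots> \<le> exp (3 * x) * (1 - x)"
    using x exp_ge_add_one_self[of "3 * x"] by (intro mult_right_mono) auto
  finally show ?thesis .
qed

text \<open>The source of the constant \<open>24 * exp 24\<close>: it makes \<open>1 + c * x\<close>
  dominate \<open>exp (24 * x)\<close> on the unit interval.\<close>

lemma exp_le_linear: "exp (24 * x) \<le> 1 + 24 * exp 24 * x" if "0 \<le> x" "x \<le> 1" for x :: real
proof -
  have "1 - 24 * x \<le> exp (- (24 * x))" using exp_ge_add_one_self[of "- (24 * x)"] by simp
  then have "exp (24 * x) * (1 - 24 * x) \<le> 1"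
    by (metis exp_ge_zero exp_minus_inverse mult_left_mono)
  then have "exp (24 * x) \<le> 1 + 24 * x * exp (24 * x)" by (simp add: algebra_simps)
  also have "\<dots> \<le> 1 + 24 * x * exp 24" using that by (intro add_left_mono mult_left_mono) auto
  finally show ?thesis by (simp add: mult_ac)
qed

lemma exp_1_le_3: "exp (1 :: real) \<le> 3"
  using exp_le by simp

text \<open>Rounding down is harmless because \<open>x * s\<close> is at least 1, so at most half is
  lost; \<open>x \<le> 2 / 3\<close> keeps \<open>e\<close> a constant factor below
  \<open>s\<close>.\<close>

lemma star_size_estimates:
  fixes s e :: nat and x :: real
  assumes s: "2 \<le> s"
  defines "x \<equiv> sqrt (ln (real s) / real s)"
  defines "e \<equiv> nat \<lfloor>x * s\<rfloor>"
  shows "0 < x" "x \<le> 2 / 3" "1 / s \<le> x" "real e \<le> x * s" "x * s / 2 \<le> real e" "e < s"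
    "x * x * s = ln s"
proof -
  have ln_pos: "0 < ln s" using s by simp
  have ln2: "1 / 2 \<le> ln (2 :: real)" using ln2_ge_two_thirds by linarith
  have lns: "ln 2 \<le> ln (real s)" using s by simp
  show x0: "0 < x" unfolding x_def using ln_pos s by simp
  have xx: "x * x = ln s / s" unfolding x_def using ln_pos s by simp
  then show xxs: "x * x * s = ln s" using s by simp
  \<comment> \<open>The bound on \<open>x\<close> amounts to \<open>ln s \<le> 4 * s / 9\<close>.
    Splitting off \<open>ln (9 / 4) \<le> 1\<close> cancels the \<open>- 1\<close> in
    \<open>ln y \<le> y - 1\<close>.\<close>
  have "exp (1 :: real) \<ge> 9 / 4" using exp_lower_Taylor_quadratic[of 1] by simp
  then have "ln (9 / 4 :: real) \<le> 1" by (metis exp_gt_zero ln_exp ln_le_cancel_iff zero_less_divide_iff zero_less_numeral)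
  moreover have "ln s = ln (4 * s / 9) + ln (9 / 4 :: real)"
    using s by (subst ln_mult_pos[symmetric]) auto
  moreover have "ln (4 * s / 9) \<le> 4 * s / 9 - 1" using s ln_le_minus_one by simp
  ultimately have "ln s \<le> 4 * s / 9" by linarith
  then have "x \<le> sqrt (4 / 9)" unfolding x_def using s by (intro real_sqrt_le_mono) (simp add: field_simps)
  also have "sqrt (4 / 9) = 2 / (3 :: real)" by (simp add: real_sqrt_divide)
  finally show x1: "x \<le> 2 / 3" .
  \<comment> \<open>\<open>ln s * s\<close> is the square of \<open>x * s\<close>.\<close>
  have "1 \<le> ln s * s" using mult_mono[of "1/2" "ln s" 2 "real s"] ln2 lns s by auto
  then have "1 \<le> (x * s) * (x * s)" using xxs by (metis mult.assoc mult.commute)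
  then have xs: "1 \<le> x * s" using x0 s
    by (metis less_eq_real_def linorder_not_le mult_le_one mult_less_cancel_left1 mult_nonneg_nonneg of_nat_0_le_iff order_less_le_trans zero_less_one mult_less_cancel_right2 mult_strict_mono)
  then show "1 / s \<le> x" using s by (simp add: field_simps)
  show ex: "real e \<le> x * s" unfolding e_def using xs by simp
  have "x * s < real e + 1" "1 \<le> real e"
  proof -
    have "1 \<le> \<lfloor>x * s\<rfloor>" using xs by simp
    then have "real e = \<lfloor>x * s\<rfloor>" "1 \<le> real e" unfolding e_def by linarith+
    then show "x * s < real e + 1" "1 \<le> real e" by linarith+
  qed
  then show "x * s / 2 \<le> real e" by linarith
  have "x * s \<le> 2 / 3 * s" using x1 by (intro mult_right_mono) auto
  then have "real e < s" using ex s by linarith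
  then show "e < s" by simp
qed

context blocked_graph
begin

lemma card_P_le: "card P \<le> n"
proof (cases "P = {}")
  case False
  then have "0 < b" using b_pos by auto
  moreover have "n = card P * b"
  proof -
    have "n = card (\<Union>P)" using Union_P by simp
    also have "\<dots> = (\<Sum>B\<in>P. card B)"
      using partition by (intro card_Union_disjoint) (auto simp: partition_on_def)
    also have "\<dots> = (\<Sum>B\<in>P. b)" by (rule sum.cong) (auto simp: card_block)
    finally show ?thesis by simp
  qed
  ultimately show ?thesis by simp
qed simp

text \<open>The purpose of \<open>z = 1 + 1 / (e + 1)\<close>: being set back by
  \<open>e + 1\<close> blocks costs only a constant factor.\<close>

lemma one_plus_inverse_power_le: "(1 + 1 / (real e + 1)) ^ (e + 1) \<le> 3"
proof -
  have "(1 + 1 / (real e + 1)) ^ (e + 1) \<le> exp (1 / (real e + 1)) ^ (e + 1)"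
    by (intro power_mono) (auto intro: add_nonneg_nonneg)
  also have "\<dots> = exp 1" by (simp flip: exp_of_nat_mult del: power_Suc)
  finally show ?thesis using exp_1_le_3 by linarith
qed

text \<open>With \<open>1 + \<eta> \<le> exp x\<close>, \<open>1 - x \<ge> exp (- 3 * x)\<close> and \<open>1 + c * x \<ge> exp (24 * x)\<close> the base is at
  most \<open>exp (- 20 * x)\<close>, and \<open>e \<ge> x * s / 2\<close> where \<open>x * x * s = ln s\<close>.\<close>

lemma return_probability_le:
  fixes c \<eta> x :: real and e :: nat
  assumes s: "2 \<le> s" and sn: "s \<le> n" and \<eta>: "0 \<le> \<eta>" "\<eta> \<le> 1 / (16 * real n)"
    and c: "c = 24 * exp 24"
    and bc: "real b \<ge> real \<Delta> / real s * (1 + c * sqrt (ln (real s) / real s))"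
    and b: "0 < b"
  defines "x \<equiv> sqrt (ln (real s) / real s)"
  defines "e \<equiv> nat \<lfloor>x * s\<rfloor>"
  shows "((1 + \<eta>) * real \<Delta> / (real b * real (s - e))) ^ e \<le> 1 / real s ^ 10" "real \<Delta> / real b \<le> s"
proof -
  note x = star_size_estimates[OF s, folded x_def, folded e_def]
  have c0: "0 \<le> c * x" using c x(1) by simp
  have "real \<Delta> * (1 + c * x) \<le> real b * s" using bc s by (simp add: x_def[symmetric] field_simps)
  then have D: "real \<Delta> / real b \<le> s / (1 + c * x)" using b c0 by (simp add: field_simps)
  also have "\<dots> \<le> s / 1" using c0 s by (intro divide_left_mono) auto
  finally show "real \<Delta> / real b \<le> s" by simp
  \<comment> \<open>Here \<open>s \<le> n\<close> ties \<eta>, which is measured in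
    \<open>n\<close>, to the scale of \<open>x\<close>.\<close>
  have "\<eta> \<le> 1 / s"
  proof -
    have "1 / (16 * real n) \<le> 1 / s" using s sn by (intro divide_left_mono) auto
    then show ?thesis using \<eta> by linarith
  qed
  then have 1: "1 + \<eta> \<le> exp x" using x(3) exp_ge_add_one_self[of x] by linarith
  have 2: "exp (- (3 * x)) \<le> 1 - x"
    using exp_ge_1_minus_inverse[of x] x(1,2) by (simp add: exp_minus field_simps)
  have 3: "exp (24 * x) \<le> 1 + c * x" using exp_le_linear[of x] x(1,2) c by simp
  have se: "s * (1 - x) \<le> real (s - e)" using x(4,6) by (simp add: of_nat_diff algebra_simps)
  have pos: "0 < s * exp (- (3 * x))" using s by simp
  have se': "s * exp (- (3 * x)) \<le> real (s - e)"
    using mult_left_mono[OF 2, of "real s"] se by simp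
  have "(1 + \<eta>) * real \<Delta> / (real b * real (s - e)) = (1 + \<eta>) * (real \<Delta> / real b) / real (s - e)"
    by simp
  also have "\<dots> \<le> exp x * (s / exp (24 * x)) / (s * exp (- (3 * x)))"
  proof (rule frac_le)
    have "s / (1 + c * x) \<le> s / exp (24 * x)" using 3 by (intro divide_left_mono mult_pos_pos) (auto intro: order_less_le_trans[OF exp_gt_zero])
    then show "(1 + \<eta>) * (real \<Delta> / real b) \<le> exp x * (s / exp (24 * x))"
      using D 1 \<eta> by (intro mult_mono) auto
  qed (use pos se' in auto)
  also have "\<dots> = exp (- (20 * x))"
  proof -
    have "exp x * (s / exp (24 * x)) / (s * exp (- (3 * x))) = exp x * exp (- (24 * x)) * exp (3 * x)"
      using s by (simp add: exp_minus field_simps)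
    also have "\<dots> = exp (x + (- (24 * x)) + 3 * x)" by (simp only: exp_add)
    finally show ?thesis by simp
  qed
  finally have "((1 + \<eta>) * real \<Delta> / (real b * real (s - e))) ^ e \<le> exp (- (20 * x)) ^ e"
    using \<eta> x(6) by (intro power_mono) auto
  also have "\<dots> = exp (- (20 * (x * real e)))" by (simp flip: exp_of_nat_mult add: algebra_simps)
  also have "\<dots> \<le> exp (- (10 * ln s))"
  proof -
    have "x * (x * s / 2) \<le> x * real e" using x(1,5) by (intro mult_left_mono) auto
    then have "ln s \<le> 2 * (x * real e)" using x(7) by (simp add: mult_ac)
    then show ?thesis by simp
  qed
  also have "\<dots> = 1 / real s ^ 10"
  proof -
    have "exp (10 * ln (real s)) = exp (ln s) ^ 10"
      by (metis exp_of_nat_mult of_nat_numeral)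
    then show ?thesis using s by (simp add: exp_minus field_simps)
  qed
  finally show "((1 + \<eta>) * real \<Delta> / (real b * real (s - e))) ^ e \<le> 1 / real s ^ 10" .
qed

text \<open>With \<open>t = 1 / (e + 2)\<close> one has \<open>1 / z = 1 - t\<close>. The gain
  \<open>t\<close> of a step loses \<open>t / 8\<close> to the deletions and at most
  \<open>t / 8\<close> to \<eta>, because \<open>1 / (16 * n) \<le> t / 8\<close>; more than
  \<open>t / 2\<close> remains, and this is at least \<open>1 / (4 * n)\<close>.\<close>

lemma decay_condition:
  fixes \<eta> z :: real
  assumes n: "1 \<le> n" and \<eta>: "0 \<le> \<eta>" "\<eta> \<le> 1 / (16 * real n)" and en: "e + 2 \<le> 2 * n"
    and z: "z = 1 + 1 / (real e + 1)"
    and w: "\<And>j. return_weight \<eta> e (\<lambda>i. z ^ i) (Suc j) \<le> z ^ Suc j / (8 * (real e + 2))"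
  shows "(1 + \<eta>) * (z ^ j + return_weight \<eta> e (\<lambda>i. z ^ i) (Suc j)) \<le> (1 - 1 / (4 * real n)) * z ^ Suc j"
proof -
  define t where "t = 1 / (real e + 2)"
  have z0: "0 < z" unfolding z by (simp add: add_pos_pos)
  have t: "0 < t" "t \<le> 1" unfolding t_def by auto
  have "z = (real e + 2) / (real e + 1)" "1 - t = (real e + 1) / (real e + 2)"
    unfolding z t_def by (simp_all add: field_simps)
  then have iz: "z * (1 - t) = 1" by simp
  have tn: "1 / (2 * real n) \<le> t" unfolding t_def using en n by (intro divide_left_mono) auto
  have et: "\<eta> \<le> t / 8" using \<eta>(2) tn by simp
  have "(1 + \<eta>) * (z ^ j + return_weight \<eta> e (\<lambda>i. z ^ i) (Suc j)) \<le>
      (1 + \<eta>) * (z ^ j + z ^ Suc j / (8 * (real e + 2)))"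
    using w \<eta> by (intro mult_left_mono add_left_mono) auto
  also have "z ^ j + z ^ Suc j / (8 * (real e + 2)) = z ^ Suc j * (1 - t) + z ^ Suc j * (t / 8)"
    using iz by (simp add: mult.commute mult.left_commute t_def)
  also have "(1 + \<eta>) * (z ^ Suc j * (1 - t) + z ^ Suc j * (t / 8)) =
      z ^ Suc j * ((1 + \<eta>) * (1 - 7 / 8 * t))"
    by (simp add: algebra_simps)
  also have "\<dots> \<le> z ^ Suc j * (1 - 1 / (4 * real n))"
  proof (intro mult_left_mono)
    have "(1 + \<eta>) * (1 - 7 / 8 * t) \<le> (1 + t / 8) * (1 - 7 / 8 * t)"
      using et t by (intro mult_right_mono) auto
    also have "\<dots> \<le> 1 - 1 / 2 * t" using t by (simp add: algebra_simps)
    also have "\<dots> \<le> 1 - 1 / (4 * real n)" using tn by simp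
    finally show "(1 + \<eta>) * (1 - 7 / 8 * t) \<le> 1 - 1 / (4 * real n)" .
  qed (use z0 in auto)
  finally show ?thesis by (simp only: mult.commute)
qed

text \<open>The initial potential is at most \<open>exp n\<close>, since \<open>z \<le> 2\<close>
  and there are at most \<open>n\<close> blocks; \<open>8 * n * n\<close> steps contract it by
  \<open>exp (- 2 * n)\<close>. What remains is \<open>exp (- n)\<close>.\<close>

lemma good_parameter_exists:
  fixes c \<eta> :: real
  assumes s: "2 \<le> s" and eps: "\<eta> = 1 / (16 * real n)"
    and c: "c = 24 * exp 24"
    and bc: "real b \<ge> real \<Delta> / real s * (1 + c * sqrt (ln (real s) / real s))"
  shows "\<exists>e\<le>n. failure \<eta> e (8 * (n * n) + 1) {} \<le> 1 / 2"
proof (cases "n = 0")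
  case True
  \<comment> \<open>The only place that needs the summand 1 in the number of steps: with 0 steps
    \<open>failure\<close> would be 1.\<close>
  then have "v \<notin> free {}" for v unfolding free_def by simp
  then have "free {} = {}" by blast
  then show ?thesis by (intro exI[of _ 0]) simp
next
  case False
  then have n: "1 \<le> n" by simp
  have \<eta>: "0 \<le> \<eta>" "\<eta> \<le> 1 / (16 * real n)" using eps by auto
  have b: "0 < b" using n Union_P b_pos by (metis Union_empty all_not_in_conv lessThan_eq_iff lessThan_0 not_one_le_zero)
  obtain e where e: "s \<le> n \<Longrightarrow> e < s" "e \<le> n" "e + 2 \<le> 2 * n" and
    w: "\<And>j. return_weight \<eta> e (\<lambda>i. (1 + 1 / (real e + 1)) ^ i) (Suc j)
       \<le> (1 + 1 / (real e + 1)) ^ Suc j / (8 * (real e + 2))"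
  proof (cases "s \<le> n")
    case False
    then show ?thesis using n by (intro that[of 0]) (auto simp: return_weight_def)
  next
    case True
    define x where "x = sqrt (ln s / s)"
    define e where "e = nat \<lfloor>x * s\<rfloor>"
    note x = star_size_estimates[OF s, folded x_def, folded e_def]
    note q = return_probability_le[OF s True \<eta> c bc b, folded x_def, folded e_def]
    let ?l = "((1 + \<eta>) * real \<Delta> / (real b * real (s - e))) ^ e"
    let ?z = "1 + 1 / (real e + 1)"
    show ?thesis
    proof (rule that[of e])
      show "e < s" "e \<le> n" "e + 2 \<le> 2 * n" using x(6) True s by auto
      fix j
      have z1: "1 \<le> ?z" by simp
      have l0: "0 \<le> ?l" using \<eta> by (intro zero_le_power divide_nonneg_nonneg) auto
      have "return_weight \<eta> e (\<lambda>i. ?z ^ i) (Suc j) =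
          2 * ?l * (?z ^ (Suc j + e) + real \<Delta> / real b * ?z ^ (Suc j + e + 1))"
        using True by (simp add: return_weight_def)
      also have "\<dots> \<le> 2 * ?l * (?z ^ (Suc j + e + 1) + s * ?z ^ (Suc j + e + 1))"
      proof (rule mult_left_mono)
        have "?z ^ (Suc j + e) \<le> ?z ^ (Suc j + e + 1)" using z1 by (intro power_increasing) auto
        moreover have "real \<Delta> / real b * ?z ^ (Suc j + e + 1) \<le> s * ?z ^ (Suc j + e + 1)"
          using q(2) z1 by (intro mult_right_mono) auto
        ultimately show "?z ^ (Suc j + e) + real \<Delta> / real b * ?z ^ (Suc j + e + 1) \<le>
          ?z ^ (Suc j + e + 1) + s * ?z ^ (Suc j + e + 1)" by (rule add_mono)
      qed (use l0 in simp)
      also have "\<dots> = ?z ^ Suc j * (2 * ?l * ((1 + real s) * ?z ^ (e + 1)))"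
      proof -
        have "2 * l * (z ^ (Suc j + e + 1) + s * z ^ (Suc j + e + 1)) =
          z ^ Suc j * (2 * l * ((1 + real s) * z ^ (e + 1)))" for l z :: real
          by (simp add: power_add algebra_simps)
        then show ?thesis .
      qed
      also have "\<dots> \<le> ?z ^ Suc j * (2 * (1 / real s ^ 10) * ((1 + real s) * 3))"
      proof -
        have 1: "(1 + real s) * ?z ^ (e + 1) \<le> (1 + real s) * 3"
          by (intro mult_left_mono one_plus_inverse_power_le) auto
        have 2: "2 * ?l \<le> 2 * (1 / real s ^ 10)" using q(1) by simp
        have "2 * ?l * ((1 + real s) * ?z ^ (e + 1)) \<le> 2 * (1 / real s ^ 10) * ((1 + real s) * 3)"
          by (rule mult_mono[OF 2 1]) (use z1 in simp_all)
        then show ?thesis by (rule mult_left_mono) (use z1 in auto)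
      qed
      also have "\<dots> \<le> ?z ^ Suc j * (1 / (8 * (real e + 2)))"
      proof (intro mult_left_mono)
        \<comment> \<open>The exponent 10 is spent as \<open>6 + 2 + 2\<close>: the constant
          \<open>48 = 2 * 3 * 8\<close> is below \<open>2 ^ 6\<close>, and the factors
          \<open>1 + s\<close> and \<open>e + 2\<close> are each at most
          \<open>s ^ 2\<close>.\<close>
        have "48 * ((1 + s) * (e + 2)) \<le> s ^ 6 * (s ^ 2 * s ^ 2)"
        proof (intro mult_le_mono)
          show "48 \<le> s ^ 6" using power_mono[OF s, of 6] by simp
          show "1 + s \<le> s ^ 2"
            unfolding power2_eq_square using s mult_le_mono1[OF s, of s] by linarith
          then show "e + 2 \<le> s ^ 2" using x(6) by linarith
        qed
        also have "\<dots> = s ^ 10" by (simp flip: power_add)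
        finally have "real (48 * ((1 + s) * (e + 2))) \<le> real (s ^ 10)" by (rule of_nat_mono)
        then show "2 * (1 / real s ^ 10) * ((1 + real s) * 3) \<le> 1 / (8 * (real e + 2))"
          using s by (simp add: field_simps)
      qed (use z1 in auto)
      finally show "return_weight \<eta> e (\<lambda>i. ?z ^ i) (Suc j) \<le> ?z ^ Suc j / (8 * (real e + 2))" by simp
    qed
  qed
  let ?z = "1 + 1 / (real e + 1)" and ?r = "1 - 1 / (4 * real n)"
  have r0: "0 \<le> ?r" using n by simp
  have "failure \<eta> e (8 * (n * n) + 1) {} \<le> ?r ^ (8 * (n * n) + 1) * ?z ^ card P"
    using decay_condition[OF n \<eta> e(3) refl w] e(1) r0 \<eta>
    by (intro failure_empty_le) auto
  also have "\<dots> \<le> ?r ^ (8 * (n * n)) * ?z ^ card P"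
    using r0 by (intro mult_right_mono power_decreasing) auto
  also have "\<dots> \<le> exp (- (1 / (4 * real n))) ^ (8 * (n * n)) * exp 1 ^ n"
  proof (intro mult_mono power_mono)
    show "?r \<le> exp (- (1 / (4 * real n)))" using exp_ge_add_one_self[of "- (1 / (4 * real n))"] by simp
    have "?z \<le> 1 + 1" by (intro add_left_mono) simp
    then have "?z \<le> exp 1" using exp_ge_add_one_self[of 1] by linarith
    then have "?z ^ card P \<le> exp 1 ^ card P" by (intro power_mono) auto
    also have "\<dots> \<le> exp 1 ^ n" using card_P_le by (intro power_increasing) auto
    finally show "?z ^ card P \<le> exp 1 ^ n" .
  qed (use r0 in auto)
  also have "\<dots> = exp (- real n)"
    using n by (simp flip: exp_of_nat_mult exp_add)
  also have "\<dots> \<le> exp (- 1)" using n by simp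
  also have "\<dots> \<le> 1 / 2" using exp_ge_add_one_self[of 1] by (simp add: exp_minus field_simps)
  finally show ?thesis using e(2) by blast
qed

end

section \<open>Reasoning about programs\<close>

lemma nn_integral_bind_spmf:
  "(\<integral>\<^sup>+ y. f y \<partial>measure_spmf (bind_spmf p g)) =
     (\<integral>\<^sup>+ x. (\<integral>\<^sup>+ y. f y \<partial>measure_spmf (g x)) \<partial>measure_spmf p)"
  unfolding measure_spmf_bind
  by (subst nn_integral_bind[where B = "count_space UNIV"])
     (auto simp: o_def space_subprob_algebra intro!: measurable_measure_spmf[THEN measurable_compose])

lemma nn_integral_return_spmf [simp]: "(\<integral>\<^sup>+ y. f y \<partial>measure_spmf (return_spmf x)) = f x"
  by (simp add: measure_spmf_return_spmf nn_integral_return)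

lemma nn_integral_spmf_mono:
  assumes "\<And>y. y \<in> set_spmf p \<Longrightarrow> f y \<le> g y"
  shows "(\<integral>\<^sup>+ y. f y \<partial>measure_spmf p) \<le> (\<integral>\<^sup>+ y. g y \<partial>measure_spmf p)"
  using assms by (intro nn_integral_mono_AE) (auto simp: AE_measure_spmf_iff)

lemma nn_integral_spmf_const_le: "(\<integral>\<^sup>+ y. c \<partial>measure_spmf p) \<le> c"
proof -
  have "emeasure (measure_spmf p) (space (measure_spmf p)) \<le> 1"
    by (rule measure_spmf.emeasure_space_le_1)
  then show ?thesis using mult_left_mono[of _ 1 c] by simp
qed

lemma nn_integral_spmf_le_const:
  assumes "\<And>y. y \<in> set_spmf p \<Longrightarrow> f y \<le> c"
  shows "(\<integral>\<^sup>+ y. f y \<partial>measure_spmf p) \<le> c"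
  using nn_integral_spmf_mono[of p f "\<lambda>_. c"] nn_integral_spmf_const_le[of p c] assms
  by (meson order_trans)

lemma nn_integral_spmf_const:
  assumes "lossless_spmf p"
  shows "(\<integral>\<^sup>+ y. c \<partial>measure_spmf p) = c"
  using assms by (simp add: lossless_spmf_def weight_spmf_def measure_spmf.emeasure_eq_measure)

text \<open>From here on loops are only treated through this unfolding; \<open>while_spmf\<close>
  does not occur again.\<close>

lemma run_While:
  "run (While b c) x =
     (if bval b (fst x) then bind_spmf (run c (tick x)) (run (While b c)) else return_spmf (tick x))"
  by (simp add: while_spmf.simps[of _ _ x] map_spmf_bind_spmf o_def)

declare run.simps(6) [simp del]

subsection \<open>Losslessness, possible results and worst-case time\<close>

definition hoare :: "(state \<Rightarrow> bool) \<Rightarrow> com \<Rightarrow> nat \<Rightarrow> (state \<Rightarrow> bool) \<Rightarrow> bool" where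
  "hoare I c T Q \<longleftrightarrow> (\<forall>\<mu> t. I \<mu> \<longrightarrow> lossless_spmf (run c (\<mu>, t)) \<and>
     (\<forall>y\<in>set_spmf (run c (\<mu>, t)). Q (fst y) \<and> snd y \<le> t + T))"

text \<open>A singleton precondition, which allows the postcondition to refer to the initial
  state.\<close>

abbreviation only :: "state \<Rightarrow> state \<Rightarrow> bool" where
  "only \<mu>0 \<equiv> \<lambda>\<mu>. \<mu> = \<mu>0"

lemma hoareI:
  assumes "\<And>x. I (fst x) \<Longrightarrow> lossless_spmf (run c x)"
    and "\<And>x y. I (fst x) \<Longrightarrow> y \<in> set_spmf (run c x) \<Longrightarrow> Q (fst y) \<and> snd y \<le> snd x + T"
  shows "hoare I c T Q"
  using assms unfolding hoare_def by force

lemma hoareD: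
  assumes "hoare I c T Q" "I (fst x)"
  shows "lossless_spmf (run c x)"
    and "y \<in> set_spmf (run c x) \<Longrightarrow> Q (fst y)"
    and "y \<in> set_spmf (run c x) \<Longrightarrow> snd y \<le> snd x + T"
  using assms unfolding hoare_def by (metis prod.collapse)+

lemma hoare_weaken:
  assumes "hoare I' c T' Q'" "\<And>\<mu>. I \<mu> \<Longrightarrow> I' \<mu>" "\<And>\<mu>. Q' \<mu> \<Longrightarrow> Q \<mu>" "T' \<le> T"
  shows "hoare I c T Q"
  using assms unfolding hoare_def by (meson add_left_mono le_trans)

lemma hoare_Skip: "(\<And>\<mu>. I \<mu> \<Longrightarrow> Q \<mu>) \<Longrightarrow> hoare I Skip 1 Q"
  by (rule hoareI) (auto simp: tick_def)

lemma hoare_Write: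
  "(\<And>\<mu>. I \<mu> \<Longrightarrow> Q (update a (aval e \<mu>) (aval f \<mu>) \<mu>)) \<Longrightarrow> hoare I (Write a e f) 1 Q"
  by (rule hoareI) (auto simp: tick_def)

lemma hoare_Coin:
  "(\<And>\<mu> h. I \<mu> \<Longrightarrow> Q (update a (aval e \<mu>) (of_bool h) \<mu>)) \<Longrightarrow> hoare I (Coin a e) 1 Q"
  by (rule hoareI) (auto simp: tick_def simp del: of_bool_eq)

lemma hoare_Seq:
  assumes c: "hoare I c T1 R" and d: "hoare R d T2 Q"
  shows "hoare I (Seq c d) (T1 + T2) Q"
proof (rule hoareI)
  fix x :: config assume I: "I (fst x)"
  show "lossless_spmf (run (Seq c d) x)"
    using hoareD(1)[OF c I] hoareD(1)[OF d] hoareD(2)[OF c I] by simp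
  fix y assume "y \<in> set_spmf (run (Seq c d) x)"
  then obtain z where z: "z \<in> set_spmf (run c x)" "y \<in> set_spmf (run d z)"
    by (auto simp: set_bind_spmf)
  have "R (fst z)" "snd z \<le> snd x + T1" using hoareD(2,3)[OF c I z(1)] .
  then show "Q (fst y) \<and> snd y \<le> snd x + (T1 + T2)"
    using hoareD(2,3)[OF d _ z(2)] by auto
qed

text \<open>The sum \<open>T + T'\<close> in place of the maximum keeps all time bounds
  polynomials.\<close>

lemma hoare_If:
  assumes "hoare (\<lambda>\<mu>. I \<mu> \<and> bval b \<mu>) c T Q" "hoare (\<lambda>\<mu>. I \<mu> \<and> \<not> bval b \<mu>) d T' Q"
  shows "hoare I (If b c d) (Suc (T + T')) Q"
proof (rule hoareI)
  fix x :: config assume I: "I (fst x)"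
  show "lossless_spmf (run (If b c d) x)"
    using I hoareD(1)[OF assms(1), of "tick x"] hoareD(1)[OF assms(2), of "tick x"] 
    by (simp add: tick_def)
  fix y assume y: "y \<in> set_spmf (run (If b c d) x)"
  show "Q (fst y) \<and> snd y \<le> snd x + Suc (T + T')"
  proof (cases "bval b (fst x)")
    case True
    then show ?thesis
      using I y hoareD(2,3)[OF assms(1), of "tick x" y] by (auto simp: tick_def)
  next
    case False
    then show ?thesis
      using I y hoareD(2,3)[OF assms(2), of "tick x" y] by (auto simp: tick_def)
  qed
qed

text \<open>The variant admits at most \<open>k\<close> rounds, each with one test of the condition;
  the outer \<open>Suc\<close> is the final, failing test.\<close>

lemma hoare_While:
  fixes v :: "state \<Rightarrow> nat"
  assumes body: "\<And>k. hoare (\<lambda>\<mu>. I \<mu> \<and> bval b \<mu> \<and> v \<mu> = k) c T (\<lambda>\<mu>. I \<mu> \<and> v \<mu> < k)"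
  shows "hoare (\<lambda>\<mu>. I \<mu> \<and> v \<mu> \<le> k) (While b c) (Suc (k * Suc T)) (\<lambda>\<mu>. I \<mu> \<and> \<not> bval b \<mu>)"
proof (induction k rule: less_induct)
  case (less k)
  show ?case
  proof (rule hoareI)
    fix x :: config assume I: "I (fst x) \<and> v (fst x) \<le> k"
    have ls: "lossless_spmf (run c (tick x))" if "bval b (fst x)"
      using hoareD(1)[OF body, of "tick x"] that I by (simp add: tick_def)
    have *: "I (fst y)" "v (fst y) < v (fst x)" "snd y \<le> Suc (snd x) + T"
      if "bval b (fst x)" "y \<in> set_spmf (run c (tick x))" for y
      using hoareD(2,3)[OF body, of "tick x" "v (fst x)" y] that I by (auto simp: tick_def)
    have IH: "lossless_spmf (run (While b c) y)"
      "z \<in> set_spmf (run (While b c) y) \<Longrightarrow> I (fst z) \<and> \<not> bval b (fst z)"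
      "z \<in> set_spmf (run (While b c) y) \<Longrightarrow> snd z \<le> snd y + Suc ((k - 1) * Suc T)"
      if "bval b (fst x)" "y \<in> set_spmf (run c (tick x))" for y z
    proof -
      have k: "k - 1 < k" "I (fst y) \<and> v (fst y) \<le> k - 1" using *[OF that] I by auto
      show "lossless_spmf (run (While b c) y)"
        "z \<in> set_spmf (run (While b c) y) \<Longrightarrow> I (fst z) \<and> \<not> bval b (fst z)"
        "z \<in> set_spmf (run (While b c) y) \<Longrightarrow> snd z \<le> snd y + Suc ((k - 1) * Suc T)"
        using hoareD[OF less.IH[OF k(1)], OF k(2)] by auto
    qed
    show "lossless_spmf (run (While b c) x)"
      using ls IH(1) by (subst run_While) auto
    fix y assume y: "y \<in> set_spmf (run (While b c) x)"
    show "(I (fst y) \<and> \<not> bval b (fst y)) \<and> snd y \<le> snd x + Suc (k * Suc T)"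
    proof (cases "bval b (fst x)")
      case True
      then obtain z where z: "z \<in> set_spmf (run c (tick x))" "y \<in> set_spmf (run (While b c) z)"
        using y by (subst (asm) run_While) (auto simp: set_bind_spmf)
      have "k \<noteq> 0" using *(2)[OF True z(1)] I by auto
      then have "Suc T + (k - 1) * Suc T = k * Suc T" by (cases k) auto
      then show ?thesis
        using IH(2,3)[OF True z] *(3)[OF True z(1)] by simp
    next
      case False
      then show ?thesis using y I by (subst (asm) run_While) (auto simp: tick_def)
    qed
  qed
qed

subsection \<open>Upper expectations\<close>

text \<open>An upper version of the weakest preexpectation. Formally the result of
  \<open>run\<close> depends on the initial step counter; the supremum over it avoids a proof that
  the memory does not.\<close>

definition wpu :: "com \<Rightarrow> (state \<Rightarrow> ennreal) \<Rightarrow> state \<Rightarrow> ennreal" where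
  "wpu c F \<mu> = (SUP t. \<integral>\<^sup>+ y. F (fst y) \<partial>measure_spmf (run c (\<mu>, t)))"

lemma wpu_ge: "(\<integral>\<^sup>+ y. F (fst y) \<partial>measure_spmf (run c (\<mu>, t))) \<le> wpu c F \<mu>"
  unfolding wpu_def by (rule SUP_upper) simp

lemma wpu_leI:
  "(\<And>t. (\<integral>\<^sup>+ y. F (fst y) \<partial>measure_spmf (run c (\<mu>, t))) \<le> K) \<Longrightarrow> wpu c F \<mu> \<le> K"
  unfolding wpu_def by (rule SUP_least) auto

lemma wpu_Seq: "wpu (Seq c d) F \<mu> \<le> wpu c (wpu d F) \<mu>"
proof (rule wpu_leI)
  fix t
  have "(\<integral>\<^sup>+ y. F (fst y) \<partial>measure_spmf (run (Seq c d) (\<mu>, t))) \<le>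
    (\<integral>\<^sup>+ x. wpu d F (fst x) \<partial>measure_spmf (run c (\<mu>, t)))"
    using wpu_ge[where c = d and F = F] by (simp add: nn_integral_bind_spmf) (intro nn_integral_mono, metis prod.collapse)
  also have "\<dots> \<le> wpu c (wpu d F) \<mu>" by (rule wpu_ge)
  finally show "(\<integral>\<^sup>+ y. F (fst y) \<partial>measure_spmf (run (Seq c d) (\<mu>, t))) \<le> wpu c (wpu d F) \<mu>" .
qed

lemma wpu_Skip: "wpu Skip F \<mu> = F \<mu>"
  by (simp add: wpu_def tick_def)

lemma wpu_Write: "wpu (Write a e f) F \<mu> = F (update a (aval e \<mu>) (aval f \<mu>) \<mu>)"
  by (simp add: wpu_def tick_def)

lemma wpu_Coin:
  "wpu (Coin a e) F \<mu> = (F (update a (aval e \<mu>) 0 \<mu>) + F (update a (aval e \<mu>) 1 \<mu>)) / 2"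
  by (simp add: wpu_def tick_def nn_integral_spmf_of_set UNIV_bool add.commute)

lemma wpu_If: "wpu (If b c d) F \<mu> \<le> (if bval b \<mu> then wpu c F \<mu> else wpu d F \<mu>)"
  by (rule wpu_leI) (auto simp: tick_def intro: wpu_ge)

lemma wpu_While:
  "wpu (While b c) F \<mu> \<le> (if bval b \<mu> then wpu c (wpu (While b c) F) \<mu> else F \<mu>)"
proof (rule wpu_leI)
  fix t
  show "(\<integral>\<^sup>+ y. F (fst y) \<partial>measure_spmf (run (While b c) (\<mu>, t))) \<le>
    (if bval b \<mu> then wpu c (wpu (While b c) F) \<mu> else F \<mu>)"
  proof (cases "bval b \<mu>")
    case True
    have "(\<integral>\<^sup>+ y. F (fst y) \<partial>measure_spmf (run (While b c) (\<mu>, t))) =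
      (\<integral>\<^sup>+ x. \<integral>\<^sup>+ y. F (fst y) \<partial>measure_spmf (run (While b c) x) \<partial>measure_spmf (run c (\<mu>, Suc t)))"
      using True by (subst run_While) (simp add: nn_integral_bind_spmf tick_def)
    also have "\<dots> \<le> (\<integral>\<^sup>+ x. wpu (While b c) F (fst x) \<partial>measure_spmf (run c (\<mu>, Suc t)))"
      using wpu_ge[where c = "While b c" and F = F] by (intro nn_integral_mono) (metis prod.collapse)
    also have "\<dots> \<le> wpu c (wpu (While b c) F) \<mu>" by (rule wpu_ge)
    finally show ?thesis using True by simp
  next
    case False
    then show ?thesis by (subst run_While) (simp add: tick_def)
  qed
qed

lemma wpu_mono_hoare:
  assumes "hoare (only \<mu>) c T Q" "\<And>\<mu>'. Q \<mu>' \<Longrightarrow> F \<mu>' \<le> G \<mu>'"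
  shows "wpu c F \<mu> \<le> wpu c G \<mu>"
proof (rule wpu_leI)
  fix t
  have "(\<integral>\<^sup>+ y. F (fst y) \<partial>measure_spmf (run c (\<mu>, t))) \<le> (\<integral>\<^sup>+ y. G (fst y) \<partial>measure_spmf (run c (\<mu>, t)))"
    using hoareD(2)[OF assms(1)] assms(2) by (intro nn_integral_spmf_mono) auto
  also have "\<dots> \<le> wpu c G \<mu>" by (rule wpu_ge)
  finally show "(\<integral>\<^sup>+ y. F (fst y) \<partial>measure_spmf (run c (\<mu>, t))) \<le> wpu c G \<mu>" .
qed

lemma wpu_mono: "(\<And>\<mu>'. F \<mu>' \<le> G \<mu>') \<Longrightarrow> wpu c F \<mu> \<le> wpu c G \<mu>"
  unfolding wpu_def by (intro SUP_mono) (auto intro!: nn_integral_mono)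

lemma wpu_le_hoare:
  assumes "hoare (only \<mu>) c T Q" "\<And>\<mu>'. Q \<mu>' \<Longrightarrow> F \<mu>' \<le> K"
  shows "wpu c F \<mu> \<le> K"
  using hoareD(2)[OF assms(1)] assms(2) by (intro wpu_leI nn_integral_spmf_le_const) auto

subsection \<open>A loop whose body succeeds with probability bounded away from zero\<close>

lemma set_spmf_iff_nn_integral:
  "(\<forall>y\<in>set_spmf p. A y) \<longleftrightarrow> (\<integral>\<^sup>+ y. of_bool (\<not> A y) \<partial>measure_spmf p) = 0"
  by (simp add: nn_integral_0_iff_AE AE_measure_spmf_iff)

text \<open>The restart loop of a Las Vegas algorithm: from every admissible state a trial ends the
  loop with probability at least \<delta>, so the number of trials is dominated by a geometric
  one.\<close>

locale succeeding_loop =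
  fixes I :: "state \<Rightarrow> bool" and b :: bexp and c :: com and T :: nat and \<delta> :: real
  assumes body: "hoare (\<lambda>\<mu>. I \<mu> \<and> bval b \<mu>) c T I"
    and \<delta>: "0 < \<delta>" "\<delta> \<le> 1"
    and fail: "\<And>\<mu>. I \<mu> \<Longrightarrow> bval b \<mu> \<Longrightarrow> wpu c (\<lambda>\<mu>'. of_bool (bval b \<mu>')) \<mu> \<le> ennreal (1 - \<delta>)"
begin

text \<open>A bounded function that grows by at most \<open>\<tau>\<close> per iteration is at most
  \<open>\<tau> / \<delta>\<close>: compare its supremum with itself. Boundedness replaces fixed point induction.\<close>

lemma bounded_functional:
  fixes h :: "config \<Rightarrow> ennreal" and B \<tau> :: real
  assumes B: "\<And>x. I (fst x) \<Longrightarrow> h x \<le> ennreal B" and \<tau>: "0 \<le> \<tau>"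
    and stop: "\<And>x. I (fst x) \<Longrightarrow> \<not> bval b (fst x) \<Longrightarrow> h x \<le> ennreal \<tau>"
    and cont: "\<And>x. I (fst x) \<Longrightarrow> bval b (fst x) \<Longrightarrow>
      h x \<le> ennreal \<tau> + (\<integral>\<^sup>+ z. of_bool (bval b (fst z)) * h z \<partial>measure_spmf (run c (tick x)))"
    and x: "I (fst x)"
  shows "h x \<le> ennreal (\<tau> / \<delta>)"
proof -
  define S where "S = (SUP x\<in>{x. I (fst x)}. h x)"
  have "S \<le> ennreal B" unfolding S_def using B by (intro SUP_least) auto
  \<comment> \<open>Finiteness of the supremum, the only use of \<open>B\<close>, is what allows
    \<open>(1 - \<delta>) * s\<close> to be cancelled at the end.\<close>
  then obtain s where s: "S = ennreal s" "0 \<le> s"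
    by (metis ennreal_cases ennreal_less_top leD top.not_eq_extremum)
  have up: "h z \<le> ennreal s" if "I (fst z)" for z
    using that unfolding s(1)[symmetric] S_def by (intro SUP_upper) auto
  have le: "h x \<le> ennreal (\<tau> + (1 - \<delta>) * s)" if I: "I (fst x)" for x
  proof (cases "bval b (fst x)")
    case True
    have "(\<integral>\<^sup>+ z. of_bool (bval b (fst z)) * h z \<partial>measure_spmf (run c (tick x))) \<le>
      (\<integral>\<^sup>+ z. of_bool (bval b (fst z)) * ennreal s \<partial>measure_spmf (run c (tick x)))"
      using hoareD(2)[OF body, of "tick x"] True I up
      by (intro nn_integral_spmf_mono mult_left_mono) (auto simp: tick_def)
    also have "\<dots> = (\<integral>\<^sup>+ z. of_bool (bval b (fst z)) \<partial>measure_spmf (run c (tick x))) * ennreal s"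
      by (subst nn_integral_multc) auto
    also have "\<dots> \<le> ennreal (1 - \<delta>) * ennreal s"
      using fail[OF I True] wpu_ge[where c = c and \<mu> = "fst x" and F = "\<lambda>\<mu>'. of_bool (bval b \<mu>')" and t = "Suc (snd x)"]
      by (intro mult_right_mono) (auto simp: tick_def)
    finally have "h x \<le> ennreal \<tau> + ennreal (1 - \<delta>) * ennreal s"
      using cont[OF I True] by (meson add_left_mono order_trans)
    then show ?thesis using \<delta> \<tau> s(2) by (simp add: ennreal_mult' ennreal_plus)
  next
    case False
    have "0 \<le> (1 - \<delta>) * s" using \<delta> s by simp
    then show ?thesis using stop[OF I False] by (meson ennreal_leI le_add_same_cancel1 order_trans)
  qed
  have nn: "0 \<le> \<tau> + (1 - \<delta>) * s" using \<delta> \<tau> s by simp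
  have "ennreal s \<le> ennreal (\<tau> + (1 - \<delta>) * s)"
    unfolding s(1)[symmetric] S_def using le by (intro SUP_least) auto
  then have "s \<le> \<tau> + (1 - \<delta>) * s" using nn by simp
  then have "s \<le> \<tau> / \<delta>" using \<delta> by (simp add: field_simps)
  then show ?thesis using up[OF x] by (meson ennreal_leI order_trans)
qed

lemma run_loop:
  assumes "bval b (fst x)"
  shows "run (While b c) x = bind_spmf (run c (tick x)) (run (While b c))"
  using assms by (subst run_While) simp

lemma run_loop_stop:
  assumes "\<not> bval b (fst x)"
  shows "run (While b c) x = return_spmf (tick x)"
  using assms by (subst run_While) simp

text \<open>The functional is the probability of nontermination. It is 0 once the loop has stopped
  and, as each trial is lossless, does not grow from one trial to the next; so
  \<open>\<tau> = 0\<close> applies.\<close>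

lemma loop_lossless:
  assumes "I (fst x)"
  shows "lossless_spmf (run (While b c) x)"
proof -
  let ?h = "\<lambda>x. ennreal (pmf (run (While b c) x) None)"
  have "?h x \<le> ennreal (0 / \<delta>)"
  proof (rule bounded_functional[where B = 1])
    fix x :: config assume I: "I (fst x)" and b: "bval b (fst x)"
    have "lossless_spmf (run c (tick x))"
      using hoareD(1)[OF body, of "tick x"] I b by (simp add: tick_def)
    then have "?h x = ennreal (\<integral> z. pmf (run (While b c) z) None \<partial>measure_spmf (run c (tick x)))"
      by (subst run_loop[OF b]) (simp add: pmf_bind_spmf_None lossless_iff_pmf_None)
    also have "\<dots> = (\<integral>\<^sup>+ z. ?h z \<partial>measure_spmf (run c (tick x)))"
      by (intro nn_integral_eq_integral[symmetric] measure_spmf.integrable_const_bound[where B = 1])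
        (auto simp: pmf_le_1)
    also have "\<dots> = (\<integral>\<^sup>+ z. of_bool (bval b (fst z)) * ?h z \<partial>measure_spmf (run c (tick x)))"
      by (intro nn_integral_cong) (auto simp: run_loop_stop)
    finally show "?h x \<le> ennreal 0 + \<dots>" by simp
  qed (auto simp: assms pmf_le_1 run_loop_stop)
  then show ?thesis by (simp add: lossless_iff_pmf_None)
qed

text \<open>The same argument with the probability of a forbidden result, again with
  \<open>\<tau> = 0\<close>.\<close>

lemma loop_post:
  assumes "I (fst x)" "y \<in> set_spmf (run (While b c) x)"
  shows "I (fst y) \<and> \<not> bval b (fst y)"
proof -
  let ?A = "\<lambda>y :: config. I (fst y) \<and> \<not> bval b (fst y)"
  let ?h = "\<lambda>x. \<integral>\<^sup>+ y. of_bool (\<not> ?A y) \<partial>measure_spmf (run (While b c) x)"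
  have "?h x \<le> ennreal (0 / \<delta>)"
  proof (rule bounded_functional[where B = 1])
    fix x :: config assume I: "I (fst x)"
    show "?h x \<le> ennreal 1"
      by (intro nn_integral_spmf_le_const) auto
    {
      assume "\<not> bval b (fst x)"
      then show "?h x \<le> ennreal 0" using I by (simp add: run_loop_stop tick_def)
    next
      assume b: "bval b (fst x)"
      have "?h x = (\<integral>\<^sup>+ z. ?h z \<partial>measure_spmf (run c (tick x)))"
        by (subst run_loop[OF b]) (simp add: nn_integral_bind_spmf)
      also have "\<dots> \<le> (\<integral>\<^sup>+ z. of_bool (bval b (fst z)) * ?h z \<partial>measure_spmf (run c (tick x)))"
        using hoareD(2)[OF body, of "tick x"] I b
        by (intro nn_integral_spmf_mono) (auto simp: run_loop_stop tick_def)
      finally show "?h x \<le> ennreal 0 + \<dots>" by simp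
    }
  qed (auto simp: assms)
  then show ?thesis using assms(2) set_spmf_iff_nn_integral[of "run (While b c) x" ?A] by auto
qed

text \<open>Each trial contributes \<open>T + 2\<close>: its body, the test before it and possibly
  the last test of the loop.\<close>

lemma loop_expected_time:
  assumes I: "I (fst x)"
  shows "(\<integral>\<^sup>+ y. of_nat (snd y) \<partial>measure_spmf (run (While b c) x)) \<le>
    ennreal (real (snd x) + real (T + 2) / \<delta>)"
proof -
  let ?h = "\<lambda>K x. \<integral>\<^sup>+ y. of_nat (min K (snd y - snd x)) \<partial>measure_spmf (run (While b c) x)"
  have *: "?h K x \<le> ennreal (real (T + 2) / \<delta>)" for K :: nat
  proof (rule bounded_functional[where B = K])
    fix x :: config assume I: "I (fst x)"
    show "?h K x \<le> ennreal K"
      by (intro nn_integral_spmf_le_const) (simp add: ennreal_of_nat_eq_real_of_nat)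
    {
      assume b: "\<not> bval b (fst x)"
      have "?h K x \<le> of_nat 1" 
        using b by (simp add: run_loop_stop tick_def del: of_nat_1 of_nat_Suc)
      also have "\<dots> \<le> ennreal (T + 2)" unfolding ennreal_of_nat_eq_real_of_nat by (intro ennreal_leI) auto
      finally show "?h K x \<le> ennreal (T + 2)" .
    } note stop = this
    {
      assume b: "bval b (fst x)"
      have "?h K x = (\<integral>\<^sup>+ z. \<integral>\<^sup>+ y. of_nat (min K (snd y - snd x)) \<partial>measure_spmf (run (While b c) z)
          \<partial>measure_spmf (run c (tick x)))"
        by (subst run_loop[OF b]) (simp add: nn_integral_bind_spmf)
      also have "\<dots> \<le> (\<integral>\<^sup>+ z. of_nat (T + 2) + of_bool (bval b (fst z)) * ?h K z
          \<partial>measure_spmf (run c (tick x)))"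
      proof (rule nn_integral_spmf_mono)
        fix z assume z: "z \<in> set_spmf (run c (tick x))"
        have t: "snd z \<le> Suc (snd x) + T" "I (fst z)"
          using hoareD(2,3)[OF body, of "tick x" z] I b z by (auto simp: tick_def)
        show "(\<integral>\<^sup>+ y. of_nat (min K (snd y - snd x)) \<partial>measure_spmf (run (While b c) z)) \<le>
          of_nat (T + 2) + of_bool (bval b (fst z)) * ?h K z"
        proof (cases "bval b (fst z)")
          case True
          have "(\<integral>\<^sup>+ y. of_nat (min K (snd y - snd x)) \<partial>measure_spmf (run (While b c) z)) \<le>
            (\<integral>\<^sup>+ y. of_nat (T + 2) + of_nat (min K (snd y - snd z)) \<partial>measure_spmf (run (While b c) z))"
            unfolding of_nat_add[symmetric] using t by (intro nn_integral_mono of_nat_mono) linarith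
          also have "\<dots> = (\<integral>\<^sup>+ y. of_nat (T + 2) \<partial>measure_spmf (run (While b c) z)) + ?h K z"
            by (rule nn_integral_add) auto
          also have "\<dots> \<le> of_nat (T + 2) + ?h K z"
            by (intro add_right_mono nn_integral_spmf_const_le)
          finally show ?thesis using True by simp
        next
          case False
          have "(\<integral>\<^sup>+ y. of_nat (min K (snd y - snd x)) \<partial>measure_spmf (run (While b c) z)) \<le> of_nat (T + 2)"
            using t by (simp add: run_loop_stop[OF False] tick_def del: of_nat_add of_nat_Suc) 
          then show ?thesis using False by simp
        qed
      qed
      also have "\<dots> = (\<integral>\<^sup>+ z. of_nat (T + 2) \<partial>measure_spmf (run c (tick x))) +
          (\<integral>\<^sup>+ z. of_bool (bval b (fst z)) * ?h K z \<partial>measure_spmf (run c (tick x)))"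
        by (rule nn_integral_add) auto
      also have "\<dots> \<le> of_nat (T + 2) +
          (\<integral>\<^sup>+ z. of_bool (bval b (fst z)) * ?h K z \<partial>measure_spmf (run c (tick x)))"
        by (intro add_right_mono nn_integral_spmf_const_le)
      finally show "?h K x \<le> ennreal (T + 2) +
          (\<integral>\<^sup>+ z. of_bool (bval b (fst z)) * ?h K z \<partial>measure_spmf (run c (tick x)))"
        by (simp only: ennreal_of_nat_eq_real_of_nat)
    }
  qed (use assms in auto)
  have "(\<integral>\<^sup>+ y. of_nat (snd y - snd x) \<partial>measure_spmf (run (While b c) x)) =
    (\<integral>\<^sup>+ y. (SUP K. of_nat (min K (snd y - snd x))) \<partial>measure_spmf (run (While b c) x))"
  proof (intro nn_integral_cong antisym)
    fix y :: config
    show "of_nat (snd y - snd x) \<le> (SUP K. of_nat (min K (snd y - snd x)) :: ennreal)"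
      by (rule SUP_upper2[of "snd y - snd x"]) auto
    show "(SUP K. of_nat (min K (snd y - snd x)) :: ennreal) \<le> of_nat (snd y - snd x)"
      by (intro SUP_least of_nat_mono) auto
  qed
  also have "\<dots> = (SUP K. ?h K x)"
    by (intro nn_integral_monotone_convergence_SUP) (auto simp: incseq_def le_fun_def intro!: of_nat_mono)
  also have "\<dots> \<le> ennreal (real (T + 2) / \<delta>)"
    using * by (intro SUP_least) auto
  finally have fin: "(\<integral>\<^sup>+ y. of_nat (snd y - snd x) \<partial>measure_spmf (run (While b c) x)) \<le> \<dots>" .
  have "(\<integral>\<^sup>+ y. of_nat (snd y) \<partial>measure_spmf (run (While b c) x)) \<le>
    (\<integral>\<^sup>+ y. of_nat (snd x) + of_nat (snd y - snd x) \<partial>measure_spmf (run (While b c) x))"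
    unfolding of_nat_add[symmetric] by (intro nn_integral_mono of_nat_mono) linarith
  also have "\<dots> = (\<integral>\<^sup>+ y. of_nat (snd x) \<partial>measure_spmf (run (While b c) x)) +
      (\<integral>\<^sup>+ y. of_nat (snd y - snd x) \<partial>measure_spmf (run (While b c) x))"
    by (rule nn_integral_add) auto
  also have "\<dots> \<le> of_nat (snd x) + ennreal (real (T + 2) / \<delta>)"
    by (intro add_mono nn_integral_spmf_const_le fin)
  also have "\<dots> = ennreal (real (snd x) + real (T + 2) / \<delta>)"
    using \<delta> by (simp add: ennreal_of_nat_eq_real_of_nat ennreal_plus)
  finally show ?thesis .
qed

end

section \<open>Building blocks\<close>

abbreviation V :: "string \<Rightarrow> aexp" where "V x \<equiv> Read x (Const 0)"

abbreviation assign :: "string \<Rightarrow> aexp \<Rightarrow> com" where "assign x e \<equiv> Write x (Const 0) e"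

abbreviation incr :: "string \<Rightarrow> com" where "incr x \<equiv> assign x (Plus (V x) (Const 1))"

definition eq :: "aexp \<Rightarrow> aexp \<Rightarrow> bexp" where
  "eq e f = And (Not (Less e f)) (Not (Less f e))"

lemma bval_eq [simp]: "bval (eq e f) \<mu> \<longleftrightarrow> aval e \<mu> = aval f \<mu>"
  by (auto simp: eq_def)

lemma update_same [simp]: "update a i k \<mu> a = (\<mu> a)(i := k)"
  by (simp add: update_def)

lemma update_other [simp]: "c \<noteq> a \<Longrightarrow> update a i k \<mu> c = \<mu> c"
  by (simp add: update_def)

text \<open>A frame condition: \<open>X\<close> collects the arrays that may have been
  modified.\<close>

definition agree :: "string set \<Rightarrow> state \<Rightarrow> state \<Rightarrow> bool" where
  "agree X \<mu> \<mu>' \<longleftrightarrow> (\<forall>a. a \<notin> X \<longrightarrow> \<mu>' a = \<mu> a)"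

lemma agree_refl [simp]: "agree X \<mu> \<mu>"
  by (simp add: agree_def)

lemma agree_trans: "agree X \<mu> \<mu>' \<Longrightarrow> agree X \<mu>' \<mu>'' \<Longrightarrow> agree X \<mu> \<mu>''"
  by (simp add: agree_def)

lemma agree_mono: "agree X \<mu> \<mu>' \<Longrightarrow> X \<subseteq> Y \<Longrightarrow> agree Y \<mu> \<mu>'"
  by (auto simp: agree_def)

lemma agree_compose:
  "agree X \<mu> \<mu>' \<Longrightarrow> agree Y \<mu>' \<mu>'' \<Longrightarrow> X \<subseteq> Z \<Longrightarrow> Y \<subseteq> Z \<Longrightarrow> agree Z \<mu> \<mu>''"
  by (meson agree_mono agree_trans)

lemma agree_update: "agree X \<mu> \<mu>' \<Longrightarrow> a \<in> X \<Longrightarrow> agree X \<mu> (update a i k \<mu>')"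
  by (auto simp: agree_def update_def)

lemma agreeD: "agree X \<mu> \<mu>' \<Longrightarrow> a \<notin> X \<Longrightarrow> \<mu>' a = \<mu> a"
  by (simp add: agree_def)

lemma hoare_pointwise:
  "(\<And>\<mu>0. I \<mu>0 \<Longrightarrow> hoare (only \<mu>0) c T Q) \<Longrightarrow> hoare I c T Q"
  unfolding hoare_def by blast

lemma hoare_Write_Seq:
  assumes "hoare R c T Q" "\<And>\<mu>. I \<mu> \<Longrightarrow> R (update a (aval e \<mu>) (aval f \<mu>) \<mu>)"
  shows "hoare I (Seq (Write a e f) c) (Suc T) Q"
proof -
  have "hoare I (Write a e f) 1 R" by (rule hoare_Write) (rule assms(2))
  from hoare_Seq[OF this assms(1)] show ?thesis by simp
qed

definition For :: "string \<Rightarrow> com \<Rightarrow> com" where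
  "For x c = Seq (assign x (Const 0))
     (While (Less (V x) (V ''n'')) (Seq c (incr x)))"

text \<open>\<open>stable\<close> makes the invariant blind to the counter, so its progress is
  carried by the index \<open>k\<close> and survives the increment.\<close>

lemma hoare_For:
  assumes init: "\<And>\<mu>. I \<mu> \<Longrightarrow> J 0 \<mu>"
    and body: "\<And>k. k < n \<Longrightarrow> hoare (\<lambda>\<mu>. J k \<mu> \<and> \<mu> x 0 = k) c T (\<lambda>\<mu>. J (Suc k) \<mu> \<and> \<mu> x 0 = k)"
    and stable: "\<And>k v \<mu>. J k \<mu> \<Longrightarrow> J k (update x 0 v \<mu>)"
    and len: "\<And>k \<mu>. J k \<mu> \<Longrightarrow> \<mu> ''n'' 0 = n"
  shows "hoare I (For x c) (2 + n * (T + 2)) (J n)"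
proof -
  let ?I = "\<lambda>\<mu>. J (\<mu> x 0) \<mu> \<and> \<mu> x 0 \<le> n"
  let ?b = "Less (V x) (V ''n'')" and ?c = "Seq c (incr x)"
  have "hoare (\<lambda>\<mu>. ?I \<mu> \<and> bval ?b \<mu> \<and> n - \<mu> x 0 = k) ?c (T + 1) (\<lambda>\<mu>. ?I \<mu> \<and> n - \<mu> x 0 < k)" for k
  proof (cases "k \<le> n \<and> k \<noteq> 0")
    case True
    let ?k = "n - k"
    have k: "?k < n" using True by auto
    show ?thesis
    proof (rule hoare_Seq[OF hoare_weaken[OF body[OF k]] hoare_Write])
      fix \<mu> assume "?I \<mu> \<and> bval ?b \<mu> \<and> n - \<mu> x 0 = k"
      then show "J ?k \<mu> \<and> \<mu> x 0 = ?k" by auto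
    next
      fix \<mu> assume "J (Suc ?k) \<mu> \<and> \<mu> x 0 = ?k"
      then show "?I (update x (aval (Const 0) \<mu>) (aval (Plus (V x) (Const 1)) \<mu>) \<mu>) \<and>
         n - update x (aval (Const 0) \<mu>) (aval (Plus (V x) (Const 1)) \<mu>) \<mu> x 0 < k"
        using stable[of "Suc ?k" \<mu> "Suc ?k"] k True by auto
    qed auto
  next
    case False
    \<comment> \<open>The precondition is contradictory here: inside the loop the variant lies
      between 1 and \<open>n\<close>.\<close>
    then show ?thesis using len by (auto simp: hoare_def)
  qed
  note loop = hoare_While[where v = "\<lambda>\<mu>. n - \<mu> x 0", OF this, of n]
  have "hoare I (For x c) (Suc (Suc (n * Suc (T + 1)))) (\<lambda>\<mu>. ?I \<mu> \<and> \<not> bval ?b \<mu>)"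
    unfolding For_def
  proof (rule hoare_Write_Seq[OF loop])
    fix \<mu> assume "I \<mu>"
    then show "?I (update x (aval (Const 0) \<mu>) (aval (Const 0) \<mu>) \<mu>) \<and>
      n - update x (aval (Const 0) \<mu>) (aval (Const 0) \<mu>) \<mu> x 0 \<le> n"
      using init stable by simp
  qed
  then show ?thesis
  proof (rule hoare_weaken)
    fix \<mu> assume "?I \<mu> \<and> \<not> bval ?b \<mu>"
    then show "J n \<mu>" using len[of "\<mu> x 0" \<mu>] by (auto dest: le_antisym)
  qed auto
qed

lemma sum_lessThan_add:
  fixes g :: "nat \<Rightarrow> real"
  shows "(\<Sum>j<k + l. g j) = (\<Sum>j<k. g j) + (\<Sum>j<l. g (k + j))"
  by (induction l) auto

subsection \<open>Random numbers\<close>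

abbreviation sample_vars :: "string set" where
  "sample_vars \<equiv> {''r'', ''q'', ''z''}"

abbreviation small :: bexp where "small \<equiv> Less (V ''q'') (V ''M'')"

definition double :: com where
  "double = Seq (Coin ''z'' (Const 0))
     (Seq (assign ''r'' (Plus (Plus (V ''r'') (V ''r'')) (V ''z'')))
       (assign ''q'' (Plus (V ''q'') (V ''q''))))"

text \<open>Shifts random bits into \<open>r\<close> until \<open>q\<close>, the size of its range,
  reaches \<open>M\<close>; doubling by addition is all the arithmetic needed.\<close>

definition sample :: com where
  "sample = Seq (assign ''r'' (Const 0)) (Seq (assign ''q'' (Const 1))
     (While small double))"

text \<open>Linear in \<open>M\<close> although the number of rounds is logarithmic, since the
  variant used is \<open>M - q\<close>.\<close>

definition T_sample :: "nat \<Rightarrow> nat" where "T_sample M = Suc (Suc (Suc (M * 4)))"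

lemma hoare_sample:
  assumes M: "\<mu>0 ''M'' 0 = M"
  shows "hoare (only \<mu>0) sample (T_sample M)
    (\<lambda>\<mu>. agree sample_vars \<mu>0 \<mu> \<and> \<mu> ''r'' 0 \<le> 2 * M)"
proof -
  let ?X = "sample_vars"
  \<comment> \<open>The \<open>+ 1\<close> matters for \<open>M = 0\<close>, where \<open>q\<close>
    already starts at 1.\<close>
  let ?I = "\<lambda>\<mu>. agree ?X \<mu>0 \<mu> \<and> \<mu> ''r'' 0 < \<mu> ''q'' 0 \<and> \<mu> ''q'' 0 \<le> 2 * M + 1"
  have M': "\<mu> ''M'' 0 = M" if "agree ?X \<mu>0 \<mu>" for \<mu> using agreeD[OF that, of "''M''"] M by simp
  have "hoare (\<lambda>\<mu>. ?I \<mu> \<and> bval small \<mu> \<and> M - \<mu> ''q'' 0 = k)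
     double 3 (\<lambda>\<mu>. ?I \<mu> \<and> M - \<mu> ''q'' 0 < k)" for k
  proof -
    let ?Q = "\<lambda>\<mu>. agree ?X \<mu>0 \<mu> \<and> \<mu> ''r'' 0 < \<mu> ''q'' 0 \<and> \<mu> ''q'' 0 < M \<and> M - \<mu> ''q'' 0 = k \<and> \<mu> ''z'' 0 \<le> 1"
    let ?R = "\<lambda>\<mu>. agree ?X \<mu>0 \<mu> \<and> \<mu> ''r'' 0 < 2 * \<mu> ''q'' 0 \<and> \<mu> ''q'' 0 < M \<and> 0 < \<mu> ''q'' 0 \<and> M - \<mu> ''q'' 0 = k"
    have "hoare (\<lambda>\<mu>. ?I \<mu> \<and> bval small \<mu> \<and> M - \<mu> ''q'' 0 = k)
      (Coin ''z'' (Const 0)) 1 ?Q"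
      using M' by (intro hoare_Coin) (auto intro!: agree_update)
    moreover have "hoare ?Q (assign ''r'' (Plus (Plus (V ''r'') (V ''r'')) (V ''z''))) 1 ?R"
      by (intro hoare_Write) (auto intro!: agree_update)
    moreover have "hoare ?R (assign ''q'' (Plus (V ''q'') (V ''q''))) 1 (\<lambda>\<mu>. ?I \<mu> \<and> M - \<mu> ''q'' 0 < k)"
      by (intro hoare_Write) (auto intro!: agree_update)
    ultimately have "hoare (\<lambda>\<mu>. ?I \<mu> \<and> bval small \<mu> \<and> M - \<mu> ''q'' 0 = k)
     double (1 + (1 + 1)) (\<lambda>\<mu>. ?I \<mu> \<and> M - \<mu> ''q'' 0 < k)" unfolding double_def by (intro hoare_Seq)
    then show ?thesis by (simp add: numeral_3_eq_3)
  qed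
  note loop = hoare_While[where v = "\<lambda>\<mu>. M - \<mu> ''q'' 0", OF this, of M]
  have loop': "hoare ?I (While small double) (Suc (M * Suc 3))
       (\<lambda>\<mu>. agree ?X \<mu>0 \<mu> \<and> \<mu> ''r'' 0 \<le> 2 * M)"
    by (rule hoare_weaken[OF loop]) auto
  have "hoare (only \<mu>0) sample (Suc (Suc (Suc (M * Suc 3))))
     (\<lambda>\<mu>. agree ?X \<mu>0 \<mu> \<and> \<mu> ''r'' 0 \<le> 2 * M)"
    unfolding sample_def
    by (rule hoare_Write_Seq[where R = "\<lambda>\<mu>. agree ?X \<mu>0 \<mu> \<and> \<mu> ''r'' 0 = 0"],
        rule hoare_Write_Seq[OF loop']) (auto intro!: agree_update)
  then show ?thesis by (simp add: T_sample_def)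
qed

text \<open>The number of coins that \<open>sample\<close> tosses.\<close>

definition bits :: "nat \<Rightarrow> nat" where "bits M = (LEAST k. M \<le> 2 ^ k)"

lemma bits_ge: "M \<le> 2 ^ bits M"
  unfolding bits_def by (rule LeastI[of _ M]) simp

lemma less_bits: "i < bits M \<Longrightarrow> 2 ^ i < M"
  unfolding bits_def using not_less_Least by (metis linorder_not_le)

lemma bits_le: "2 ^ bits M \<le> 2 * M + 1"
proof (cases "bits M")
  case (Suc k)
  then have "2 ^ k < M" using less_bits[of k M] by simp
  then show ?thesis using Suc by simp
qed simp

lemma wpu_sample:
  fixes h :: "nat \<Rightarrow> real"
  assumes M: "\<mu>0 ''M'' 0 = M" and h: "\<And>j. 0 \<le> h j"
    and F: "\<And>\<mu>. agree sample_vars \<mu>0 \<mu> \<Longrightarrow> F \<mu> \<le> ennreal (h (\<mu> ''r'' 0))"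
  shows "wpu sample F \<mu>0 \<le> ennreal ((\<Sum>j<2 ^ bits M. h j) / 2 ^ bits M)"
proof -
  let ?X = "sample_vars" and ?k = "bits M"
  let ?W = "While small double"
  have M': "\<mu> ''M'' 0 = M" if "agree ?X \<mu>0 \<mu>" for \<mu> using agreeD[OF that, of "''M''"] M by simp
  \<comment> \<open>With \<open>i\<close> tosses to come, \<open>r\<close> is the prefix read so
    far, and the average runs over all its completions.\<close>
  have loop: "wpu ?W F \<mu> \<le> ennreal ((\<Sum>j<2 ^ i. h (\<mu> ''r'' 0 * 2 ^ i + j)) / 2 ^ i)"
    if "i \<le> ?k" "agree ?X \<mu>0 \<mu>" "\<mu> ''q'' 0 = 2 ^ (?k - i)" for i \<mu>
    using that
  proof (induction i arbitrary: \<mu>)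
    case 0
    then have "\<not> bval small \<mu>" using M' bits_ge[of M] by simp
    then have "wpu ?W F \<mu> \<le> F \<mu>" using wpu_While[of "small" double F \<mu>] by simp
    then show ?case using F[OF 0(2)] by simp
  next
    case (Suc i)
    let ?a = "\<mu> ''r'' 0"
    let ?u = "\<lambda>v. update ''q'' 0 (2 ^ (?k - i)) (update ''r'' 0 (2 * ?a + v) (update ''z'' 0 v \<mu>))"
    let ?S = "\<lambda>b. \<Sum>j<2 ^ i. h (b * 2 ^ i + j)"
    have q: "2 ^ (?k - Suc i) + 2 ^ (?k - Suc i) = (2 :: nat) ^ (?k - i)"
      using Suc.prems(1) by (simp flip: mult_2 power_Suc add: Suc_diff_Suc)
    have "bval small \<mu>"
      using Suc.prems M' less_bits[of "?k - Suc i" M] by simp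
    then have "wpu ?W F \<mu> \<le> wpu double (wpu ?W F) \<mu>"
      using wpu_While[of "small" double F \<mu>] by simp
    also have "\<dots> \<le> wpu (Coin ''z'' (Const 0)) (wpu (Seq (assign ''r'' (Plus (Plus (V ''r'') (V ''r'')) (V ''z'')))
         (assign ''q'' (Plus (V ''q'') (V ''q'')))) (wpu ?W F)) \<mu>"
      unfolding double_def by (rule wpu_Seq)
    also have "\<dots> \<le> wpu (Coin ''z'' (Const 0)) (wpu (assign ''r'' (Plus (Plus (V ''r'') (V ''r'')) (V ''z'')))
         (wpu (assign ''q'' (Plus (V ''q'') (V ''q''))) (wpu ?W F))) \<mu>"
      by (intro wpu_mono wpu_Seq)
    also have "\<dots> = (wpu ?W F (?u 0) + wpu ?W F (?u 1)) / 2"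
      using Suc.prems(3) q by (simp add: wpu_Coin wpu_Write mult_2)
    also have "\<dots> \<le> (ennreal (?S (2 * ?a) / 2 ^ i) + ennreal (?S (2 * ?a + 1) / 2 ^ i)) / 2"
    proof (intro divide_right_mono_ennreal add_mono)
      have *: "wpu ?W F (?u v) \<le> ennreal (?S (2 * ?a + v) / 2 ^ i)" for v
        using Suc.IH[of "?u v"] Suc.prems by (simp add: agree_update)
      show "wpu ?W F (?u 0) \<le> ennreal (?S (2 * ?a) / 2 ^ i)" using *[of 0] by simp
      show "wpu ?W F (?u 1) \<le> ennreal (?S (2 * ?a + 1) / 2 ^ i)" using *[of 1] by simp
    qed
    also have "\<dots> = ennreal ((?S (2 * ?a) / 2 ^ i + ?S (2 * ?a + 1) / 2 ^ i) / 2)"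
      using h by (simp add: sum_nonneg ennreal_plus[symmetric] ennreal_divide_numeral del: ennreal_plus)
    also have "(?S (2 * ?a) / 2 ^ i + ?S (2 * ?a + 1) / 2 ^ i) / 2 =
        (\<Sum>j<2 ^ Suc i. h (?a * 2 ^ Suc i + j)) / 2 ^ Suc i"
    proof -
      have "(\<Sum>j<2 ^ Suc i. h (?a * 2 ^ Suc i + j)) =
          (\<Sum>j<2 ^ i. h (?a * 2 ^ Suc i + j)) + (\<Sum>j<2 ^ i. h (?a * 2 ^ Suc i + (2 ^ i + j)))"
        using sum_lessThan_add[of "\<lambda>j. h (?a * 2 ^ Suc i + j)" "2 ^ i" "2 ^ i"]
        by (simp add: mult_2 add.commute)
      then show ?thesis by (simp add: field_simps)
    qed
    finally show ?case .
  qed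
  have "wpu sample F \<mu>0 \<le> wpu (assign ''r'' (Const 0)) (wpu (Seq (assign ''q'' (Const 1)) ?W) F) \<mu>0"
    unfolding sample_def by (rule wpu_Seq)
  also have "\<dots> \<le> wpu (assign ''r'' (Const 0)) (wpu (assign ''q'' (Const 1)) (wpu ?W F)) \<mu>0"
    by (intro wpu_mono wpu_Seq)
  also have "\<dots> = wpu ?W F (update ''q'' 0 1 (update ''r'' 0 0 \<mu>0))"
    by (simp add: wpu_Write)
  also have "\<dots> \<le> ennreal ((\<Sum>j<2 ^ ?k. h j) / 2 ^ ?k)"
    using loop[of ?k "update ''q'' 0 1 (update ''r'' 0 0 \<mu>0)"] by (simp add: agree_update)
  finally show ?thesis .
qed

subsection \<open>Random elements of a decidable set\<close>

abbreviation scan_vars :: "string set" where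
  "scan_vars \<equiv> {''m'', ''i'', ''lst''}"

abbreviation found :: bexp where "found \<equiv> Less (Const 0) (V ''m'')"

definition scan :: "bexp \<Rightarrow> com" where
  "scan cond = For ''i'' (If cond
     (Seq (Write ''lst'' (V ''m'') (V ''i'')) (incr ''m'')) Skip)"

text \<open>Reduces \<open>r\<close> modulo \<open>m\<close> by repeated subtraction, as there is no
  division. The conjunct \<open>found\<close> prevents an endless loop when the list is
  empty.\<close>

definition select :: com where
  "select = Seq
     (While (And found (Not (Less (V ''r'') (V ''m''))))
       (assign ''r'' (Minus (V ''r'') (V ''m''))))
     (assign ''y'' (Read ''lst'' (V ''r'')))"

definition pick :: "bexp \<Rightarrow> com" where
  "pick cond = Seq (assign ''m'' (Const 0)) (Seq (scan cond) (Seq sample select))"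

abbreviation pick_vars :: "string set" where
  "pick_vars \<equiv> {''m'', ''i'', ''lst'', ''r'', ''q'', ''z'', ''y''}"

lemma hoare_scan:
  assumes n: "\<mu>0 ''n'' 0 = n" and m: "\<mu>0 ''m'' 0 = 0"
    and cond: "\<And>\<mu>. agree scan_vars \<mu>0 \<mu> \<Longrightarrow> \<mu> ''i'' 0 < n \<Longrightarrow>
      bval cond \<mu> \<longleftrightarrow> \<mu> ''i'' 0 \<in> C"
  defines "xs \<equiv> filter (\<lambda>v. v \<in> C) [0..<n]"
  shows "hoare (only \<mu>0) (scan cond) (2 + n * 6)
    (\<lambda>\<mu>. agree scan_vars \<mu>0 \<mu> \<and> \<mu> ''m'' 0 = length xs \<and>
       map (\<mu> ''lst'') [0..<length xs] = xs)"
proof -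
  let ?X = "scan_vars"
  let ?xs = "\<lambda>k. filter (\<lambda>v. v \<in> C) [0..<k]"
  let ?J = "\<lambda>k \<mu>. agree ?X \<mu>0 \<mu> \<and> \<mu> ''m'' 0 = length (?xs k) \<and>
    map (\<mu> ''lst'') [0..<length (?xs k)] = ?xs k"
  have "hoare (only \<mu>0) (scan cond) (2 + n * (4 + 2)) (?J n)"
    unfolding scan_def
  proof (rule hoare_For[where J = ?J])
    fix \<mu> assume "\<mu> = \<mu>0"
    then show "?J 0 \<mu>" using m by simp
  next
    fix k assume k: "k < n"
    let ?I = "\<lambda>\<mu>. ?J k \<mu> \<and> \<mu> ''i'' 0 = k"
    let ?R = "\<lambda>\<mu>. agree ?X \<mu>0 \<mu> \<and> \<mu> ''m'' 0 = length (?xs k) \<and> k \<in> C \<and>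
      map (\<mu> ''lst'') [0..<Suc (length (?xs k))] = ?xs (Suc k) \<and> \<mu> ''i'' 0 = k"
    have "hoare (\<lambda>\<mu>. ?I \<mu> \<and> bval cond \<mu>)
      (Seq (Write ''lst'' (V ''m'') (V ''i'')) (incr ''m''))
      (Suc 1) (\<lambda>\<mu>. ?J (Suc k) \<mu> \<and> \<mu> ''i'' 0 = k)"
    proof (rule hoare_Write_Seq[where R = ?R], rule hoare_Write)
      fix \<mu> assume "?R \<mu>"
      then show "?J (Suc k) (update ''m'' (aval (Const 0) \<mu>) (aval (Plus (V ''m'') (Const 1)) \<mu>) \<mu>) \<and>
        update ''m'' (aval (Const 0) \<mu>) (aval (Plus (V ''m'') (Const 1)) \<mu>) \<mu> ''i'' 0 = k"
        by (simp add: agree_update)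
    next
      fix \<mu> assume *: "?I \<mu> \<and> bval cond \<mu>"
      then have "k \<in> C" using cond[of \<mu>] k by auto
      moreover have "map ((\<mu> ''lst'')(length (?xs k) := k)) [0..<length (?xs k)] =
          map (\<mu> ''lst'') [0..<length (?xs k)]" by (rule map_cong) auto
      ultimately show "?R (update ''lst'' (aval (V ''m'') \<mu>) (aval (V ''i'') \<mu>) \<mu>)"
        using * by (simp add: agree_update)
    qed
    moreover have "hoare (\<lambda>\<mu>. ?I \<mu> \<and> \<not> bval cond \<mu>) Skip 1 (\<lambda>\<mu>. ?J (Suc k) \<mu> \<and> \<mu> ''i'' 0 = k)"
    proof (rule hoare_Skip)
      fix \<mu> assume *: "?I \<mu> \<and> \<not> bval cond \<mu>"
      then have "k \<notin> C" using cond[of \<mu>] k by auto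
      then show "?J (Suc k) \<mu> \<and> \<mu> ''i'' 0 = k" using * by simp
    qed
    ultimately have "hoare ?I (If cond (Seq (Write ''lst'' (V ''m'') (V ''i''))
       (incr ''m'')) Skip) (Suc (Suc 1 + 1))
       (\<lambda>\<mu>. ?J (Suc k) \<mu> \<and> \<mu> ''i'' 0 = k)" by (rule hoare_If)
    then show "hoare ?I (If cond (Seq (Write ''lst'' (V ''m'') (V ''i''))
       (incr ''m'')) Skip) 4
       (\<lambda>\<mu>. ?J (Suc k) \<mu> \<and> \<mu> ''i'' 0 = k)" by (rule hoare_weaken) auto
  next
    fix k v \<mu> assume "?J k \<mu>"
    then show "?J k (update ''i'' 0 v \<mu>)" by (simp add: agree_update)
  next
    fix k \<mu> assume "?J k \<mu>"
    then show "\<mu> ''n'' 0 = n" using agreeD[of ?X \<mu>0 \<mu> "''n''"] n by simp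
  qed
  then show ?thesis by (simp add: xs_def)
qed

lemma hoare_select:
  assumes r: "\<mu>0 ''r'' 0 \<le> R" and m: "\<mu>0 ''m'' 0 = length xs"
    and lst: "map (\<mu>0 ''lst'') [0..<length xs] = xs"
  shows "hoare (only \<mu>0) select (2 + R * 2)
    (\<lambda>\<mu>. agree {''r'', ''y''} \<mu>0 \<mu> \<and>
       (xs \<noteq> [] \<longrightarrow> \<mu> ''y'' 0 = xs ! (\<mu>0 ''r'' 0 mod length xs)))"
proof -
  let ?L = "length xs"
  let ?I = "\<lambda>\<mu>. agree {''r''} \<mu>0 \<mu> \<and> \<mu> ''r'' 0 mod ?L = \<mu>0 ''r'' 0 mod ?L"
  let ?b = "And found (Not (Less (V ''r'') (V ''m'')))"
  have m': "\<mu> ''m'' 0 = ?L" if "agree {''r''} \<mu>0 \<mu>" for \<mu> using agreeD[OF that, of "''m''"] m by simp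
  have "hoare (\<lambda>\<mu>. ?I \<mu> \<and> bval ?b \<mu> \<and> \<mu> ''r'' 0 = k) (assign ''r'' (Minus (V ''r'') (V ''m''))) 1
    (\<lambda>\<mu>. ?I \<mu> \<and> \<mu> ''r'' 0 < k)" for k
    using m' by (intro hoare_Write) (auto simp: agree_update le_mod_geq not_less)
  note loop = hoare_While[where v = "\<lambda>\<mu>. \<mu> ''r'' 0", OF this, of R]
  have "hoare (only \<mu>0) select (Suc (R * Suc 1) + 1)
    (\<lambda>\<mu>. agree {''r'', ''y''} \<mu>0 \<mu> \<and>
       (xs \<noteq> [] \<longrightarrow> \<mu> ''y'' 0 = xs ! (\<mu>0 ''r'' 0 mod length xs)))"
    unfolding select_def
  proof (rule hoare_Seq[OF hoare_weaken[OF loop] hoare_Write])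
    fix \<mu> assume "\<mu> = \<mu>0"
    then show "?I \<mu> \<and> \<mu> ''r'' 0 \<le> R" using r by simp
  next
    fix \<mu> assume *: "?I \<mu> \<and> \<not> bval ?b \<mu>"
    have "\<mu> ''y'' = \<mu>0 ''y''" "\<mu> ''lst'' = \<mu>0 ''lst''" using * agreeD[of "{''r''}" \<mu>0 \<mu>] by auto
    moreover have "\<mu>0 ''lst'' (\<mu> ''r'' 0) = xs ! (\<mu>0 ''r'' 0 mod length xs)" if "xs \<noteq> []"
    proof -
      have "\<mu> ''m'' 0 = ?L" using * m'[of \<mu>] by blast
      then have lt: "\<mu> ''r'' 0 < ?L" using * that by simp
      then have "\<mu> ''r'' 0 = \<mu>0 ''r'' 0 mod ?L" using * by simp
      moreover have "map (\<mu>0 ''lst'') [0..<?L] ! (\<mu> ''r'' 0) = \<mu>0 ''lst'' (\<mu> ''r'' 0)"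
        using lt by simp
      ultimately show ?thesis using lst by simp
    qed
    moreover have "agree {''r'', ''y''} \<mu>0 \<mu>" using * agree_mono[of "{''r''}" \<mu>0 \<mu>] by simp
    ultimately show "agree {''r'', ''y''} \<mu>0 (update ''y'' (aval (Const 0) \<mu>) (aval (Read ''lst'' (V ''r'')) \<mu>) \<mu>) \<and>
       (xs \<noteq> [] \<longrightarrow> update ''y'' (aval (Const 0) \<mu>) (aval (Read ''lst'' (V ''r'')) \<mu>) \<mu> ''y'' 0 =
         xs ! (\<mu>0 ''r'' 0 mod length xs))"
      by (simp add: agree_update)
  qed auto
  then show ?thesis by (rule hoare_weaken) auto
qed

definition T_pick :: "nat \<Rightarrow> nat \<Rightarrow> nat" where
  "T_pick n M = 10 + n * 6 + M * 8"

text \<open>\<open>Q div L + 1\<close> full periods cover the range. After division by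
  \<open>Q\<close> the weight of a residue is at most \<open>(1 + L / Q) / L\<close>, so the bias of
  the reduction is \<open>L / Q\<close>.\<close>

lemma sum_mod_le:
  fixes g :: "nat \<Rightarrow> real"
  assumes L: "0 < L" and g: "\<And>j. 0 \<le> g j"
  shows "(\<Sum>j<Q. g (j mod L)) \<le> (real Q / real L + 1) * (\<Sum>j<L. g j)"
proof -
  have blocks: "(\<Sum>j<a * L. g (j mod L)) = real a * (\<Sum>j<L. g j)" for a
  proof (induction a)
    case (Suc a)
    have "(\<Sum>j<Suc a * L. g (j mod L)) = (\<Sum>j<a * L + L. g (j mod L))" by (simp add: add.commute)
    also have "\<dots> = (\<Sum>j<a * L. g (j mod L)) + (\<Sum>j<L. g ((a * L + j) mod L))"
      by (rule sum_lessThan_add)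
    also have "(\<Sum>j<L. g ((a * L + j) mod L)) = (\<Sum>j<L. g j)" by (intro sum.cong) auto
    finally show ?case using Suc by (simp add: algebra_simps)
  qed simp
  have "Q \<le> (Q div L + 1) * L"
    using dividend_less_div_times[OF L, of Q] by simp
  then have "(\<Sum>j<Q. g (j mod L)) \<le> (\<Sum>j<(Q div L + 1) * L. g (j mod L))"
    using g by (intro sum_mono2) auto
  also have "\<dots> = (real (Q div L) + 1) * (\<Sum>j<L. g j)"
    unfolding blocks by simp
  also have "\<dots> \<le> (real Q / real L + 1) * (\<Sum>j<L. g j)"
    using g of_nat_div_le_of_nat[of Q L, where ?'a = real] by (intro mult_right_mono add_mono sum_nonneg) auto
  finally show ?thesis .
qed

context
  fixes \<mu>0 :: state and n M :: nat and cond :: bexp and C :: "nat set"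
  assumes n: "\<mu>0 ''n'' 0 = n" and M: "\<mu>0 ''M'' 0 = M" and C: "C \<subseteq> {..<n}"
    and cond: "\<And>\<mu>. agree scan_vars \<mu>0 \<mu> \<Longrightarrow> \<mu> ''i'' 0 < n \<Longrightarrow>
      bval cond \<mu> \<longleftrightarrow> \<mu> ''i'' 0 \<in> C"
begin

private definition "xs = filter (\<lambda>v. v \<in> C) [0..<n]"

private lemma xs: "set xs = C" "distinct xs" "length xs = card C" "xs = [] \<longleftrightarrow> C = {}"
proof -
  show 1: "set xs = C" "distinct xs" using C by (auto simp: xs_def)
  then show "length xs = card C" using distinct_card by metis
  show "xs = [] \<longleftrightarrow> C = {}" using 1 by auto
qed

private abbreviation "scanned \<mu> \<equiv> agree scan_vars \<mu>0 \<mu> \<and> \<mu> ''m'' 0 = length xs \<and>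
  map (\<mu> ''lst'') [0..<length xs] = xs"

private lemma hoare_scan_part:
  "hoare (only (update ''m'' 0 0 \<mu>0)) (scan cond) (2 + n * 6) scanned"
proof -
  let ?\<mu> = "update ''m'' 0 0 \<mu>0"
  have ag: "agree scan_vars \<mu>0 \<mu>" if "agree scan_vars ?\<mu> \<mu>" for \<mu>
    by (rule agree_trans[OF agree_update[OF agree_refl] that]) simp
  have "hoare (only ?\<mu>) (scan cond) (2 + n * 6)
    (\<lambda>\<mu>. agree scan_vars ?\<mu> \<mu> \<and> \<mu> ''m'' 0 = length xs \<and>
       map (\<mu> ''lst'') [0..<length xs] = xs)"
    unfolding xs_def using ag n cond by (intro hoare_scan) auto
  then show ?thesis by (rule hoare_weaken) (use ag in auto)
qed

private lemma scanned_M: "scanned \<mu> \<Longrightarrow> \<mu> ''M'' 0 = M"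
  using agreeD[of "scan_vars" \<mu>0 \<mu> "''M''"] M by simp

private lemma scanned_agree:
  assumes "scanned \<mu>" "agree sample_vars \<mu> \<mu>'"
  shows "agree pick_vars \<mu>0 \<mu>'" "\<mu>' ''m'' 0 = length xs" "map (\<mu>' ''lst'') [0..<length xs] = xs"
proof -
  show "agree pick_vars \<mu>0 \<mu>'"
    by (rule agree_compose[OF conjunct1[OF assms(1)] assms(2)]) auto
  have "\<mu>' ''m'' = \<mu> ''m''" "\<mu>' ''lst'' = \<mu> ''lst''" using assms(2) agreeD by auto
  then show "\<mu>' ''m'' 0 = length xs" "map (\<mu>' ''lst'') [0..<length xs] = xs" using assms(1) by auto
qed

lemma hoare_pick:
  "hoare (only \<mu>0) (pick cond) (T_pick n M)
    (\<lambda>\<mu>. agree pick_vars \<mu>0 \<mu> \<and> \<mu> ''m'' 0 = card C \<and> (C \<noteq> {} \<longrightarrow> \<mu> ''y'' 0 \<in> C))"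
    (is "hoare _ _ _ ?Q")
proof -
  let ?S = "\<lambda>\<mu>. agree pick_vars \<mu>0 \<mu> \<and> \<mu> ''m'' 0 = length xs \<and> map (\<mu> ''lst'') [0..<length xs] = xs \<and>
     \<mu> ''r'' 0 \<le> 2 * M"
  have sam: "hoare scanned sample (T_sample M) ?S"
  proof (rule hoare_pointwise)
    fix \<mu> assume \<mu>: "scanned \<mu>"
    show "hoare (only \<mu>) sample (T_sample M) ?S"
      using scanned_agree[OF \<mu>] by (intro hoare_weaken[OF hoare_sample[of \<mu> M, OF scanned_M[OF \<mu>]]]) auto
  qed
  have cho: "hoare ?S select (2 + 2 * M * 2) ?Q"
  proof (rule hoare_pointwise)
    fix \<mu> assume \<mu>: "?S \<mu>"
    show "hoare (only \<mu>) select (2 + 2 * M * 2) ?Q"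
    proof (rule hoare_weaken[OF hoare_select])
      show "\<mu> ''r'' 0 \<le> 2 * M" "\<mu> ''m'' 0 = length xs" "map (\<mu> ''lst'') [0..<length xs] = xs"
        using \<mu> by auto
      fix \<mu>' assume *: "agree {''r'', ''y''} \<mu> \<mu>' \<and>
        (xs \<noteq> [] \<longrightarrow> \<mu>' ''y'' 0 = xs ! (\<mu> ''r'' 0 mod length xs))"
      have "agree pick_vars \<mu>0 \<mu>'"
        by (rule agree_compose[OF conjunct1[OF \<mu>] conjunct1[OF *]]) auto
      moreover have "\<mu>' ''m'' 0 = card C" using \<mu> * agreeD[of _ \<mu> \<mu>' "''m''"] xs(3) by auto
      moreover have "\<mu>' ''y'' 0 \<in> C" if "C \<noteq> {}"
      proof -
        have "xs \<noteq> []" using that xs(4) by simp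
        then show ?thesis using * xs(1) by (metis length_greater_0_conv mod_less_divisor nth_mem)
      qed
      ultimately show "?Q \<mu>'" by simp
    qed auto
  qed
  have "hoare (only \<mu>0) (pick cond) (Suc (2 + n * 6 + (T_sample M + (2 + 2 * M * 2)))) ?Q"
    unfolding pick_def
    by (rule hoare_Write_Seq[OF hoare_Seq[OF hoare_scan_part hoare_Seq[OF sam cho]]]) simp
  then show ?thesis by (rule hoare_weaken) (auto simp: T_pick_def T_sample_def)
qed

text \<open>The bias \<open>card C / 2 ^ bits M\<close> is at most \<eta> because
  \<open>2 ^ bits M\<close> is at least \<open>M\<close>.\<close>

lemma wpu_pick:
  fixes h :: "nat \<Rightarrow> real" and \<eta> :: real
  assumes ne: "C \<noteq> {}" and h: "\<And>y. 0 \<le> h y" and \<eta>: "real (card C) \<le> \<eta> * M"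
    and F: "\<And>\<mu>. agree pick_vars \<mu>0 \<mu> \<Longrightarrow> \<mu> ''m'' 0 = card C \<Longrightarrow> \<mu> ''y'' 0 \<in> C \<Longrightarrow>
      F \<mu> \<le> ennreal (h (\<mu> ''y'' 0))"
  shows "wpu (pick cond) F \<mu>0 \<le> ennreal ((1 + \<eta>) / card C * (\<Sum>y\<in>C. h y))"
proof -
  let ?L = "length xs" and ?Q = "2 ^ bits M :: nat"
  have L: "0 < ?L" and xs0: "xs \<noteq> []" using ne xs(4) by auto
  let ?K = "ennreal ((\<Sum>j<?Q. h (xs ! (j mod ?L))) / ?Q)"
  have sampled: "wpu sample (wpu select F) \<mu> \<le> ?K" if \<mu>: "scanned \<mu>" for \<mu>
  proof -
    have "wpu sample (wpu select F) \<mu> \<le> ennreal ((\<Sum>j<2 ^ bits M. h (xs ! (j mod ?L))) / 2 ^ bits M)"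
    proof (rule wpu_sample[of \<mu> M, OF scanned_M[OF \<mu>]])
      fix \<mu>' assume a: "agree sample_vars \<mu> \<mu>'"
      note s = scanned_agree[OF \<mu> a]
      show "wpu select F \<mu>' \<le> ennreal (h (xs ! (\<mu>' ''r'' 0 mod ?L)))"
      proof (rule wpu_le_hoare[OF hoare_select[OF order_refl s(2,3)]])
        fix \<mu>'' assume *: "agree {''r'', ''y''} \<mu>' \<mu>'' \<and>
          (xs \<noteq> [] \<longrightarrow> \<mu>'' ''y'' 0 = xs ! (\<mu>' ''r'' 0 mod ?L))"
        have "agree pick_vars \<mu>0 \<mu>''"
          by (rule agree_compose[OF s(1) conjunct1[OF *]]) auto
        moreover have "\<mu>'' ''m'' 0 = card C" using s(2) * agreeD[of _ \<mu>' \<mu>'' "''m''"] xs(3) by auto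
        moreover have "\<mu>'' ''y'' 0 \<in> C" using * xs0 xs(1) L by (metis mod_less_divisor nth_mem)
        ultimately show "F \<mu>'' \<le> ennreal (h (xs ! (\<mu>' ''r'' 0 mod ?L)))"
          using F[of \<mu>''] * xs0 by simp
      qed
    qed (rule h)
    then show ?thesis by simp
  qed
  have "wpu (pick cond) F \<mu>0 \<le> wpu (assign ''m'' (Const 0)) (wpu (Seq (scan cond) (Seq sample select)) F) \<mu>0"
    unfolding pick_def by (rule wpu_Seq)
  also have "\<dots> = wpu (Seq (scan cond) (Seq sample select)) F (update ''m'' 0 0 \<mu>0)"
    by (simp add: wpu_Write)
  also have "\<dots> \<le> wpu (scan cond) (wpu (Seq sample select) F) (update ''m'' 0 0 \<mu>0)"
    by (rule wpu_Seq)
  also have "\<dots> \<le> ?K"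
    using sampled wpu_Seq[of sample select F] order_trans
    by (intro wpu_le_hoare[OF hoare_scan_part]) blast
  also have "\<dots> \<le> ennreal ((1 + \<eta>) / card C * (\<Sum>y\<in>C. h y))"
  proof (rule ennreal_leI)
    have S: "(\<Sum>j<?L. h (xs ! j)) = (\<Sum>y\<in>C. h y)"
      using sum_list_sum_nth[of "map h xs"] sum_list_distinct_conv_sum_set[OF xs(2), of h] xs(1)
      by (simp add: lessThan_atLeast0)
    have "(\<Sum>j<?Q. h (xs ! (j mod ?L))) / ?Q \<le> (real ?Q / real ?L + 1) * (\<Sum>j<?L. h (xs ! j)) / ?Q"
      using sum_mod_le[OF L, of "\<lambda>j. h (xs ! j)" ?Q] h by (intro divide_right_mono) auto
    also have "\<dots> = (1 + real ?L / ?Q) / ?L * (\<Sum>y\<in>C. h y)"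
      unfolding S using L by (simp add: field_simps)
    also have "\<dots> \<le> (1 + \<eta>) / ?L * (\<Sum>y\<in>C. h y)"
    proof (intro mult_right_mono divide_right_mono add_left_mono sum_nonneg)
      have "real M \<le> real ?Q" using bits_ge[of M] by (metis of_nat_le_iff)
      moreover have "0 < \<eta> * M" using \<eta> L xs(3) by linarith
      then have "0 \<le> \<eta>" by (simp add: zero_less_mult_iff)
      ultimately have "real ?L \<le> \<eta> * real ?Q"
        using \<eta> xs(3) by (metis mult_left_mono order_trans)
      then show "real ?L / real ?Q \<le> \<eta>" by (simp add: field_simps)
    qed (use h in auto)
    finally show "(\<Sum>j<?Q. h (xs ! (j mod ?L))) / ?Q \<le> (1 + \<eta>) / card C * (\<Sum>y\<in>C. h y)"
      using xs(3) by simp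
  qed
  finally show ?thesis .
qed

end

section \<open>The algorithm\<close>

lemma hoare_Seq_pt:
  assumes "hoare (only \<mu>0) c T R" "\<And>\<mu>1. R \<mu>1 \<Longrightarrow> hoare (only \<mu>1) d T' Q"
  shows "hoare (only \<mu>0) (Seq c d) (T + T') Q"
  by (rule hoare_Seq[OF assms(1)]) (rule hoare_pointwise, rule assms(2))

lemma hoare_If_pt:
  assumes "bval b \<mu>0 \<Longrightarrow> hoare (only \<mu>0) c T Q" "\<not> bval b \<mu>0 \<Longrightarrow> hoare (only \<mu>0) d T' Q"
  shows "hoare (only \<mu>0) (If b c d) (Suc (T + T')) Q"
proof (rule hoare_If)
  show "hoare (\<lambda>\<mu>. \<mu> = \<mu>0 \<and> bval b \<mu>) c T Q"
    by (rule hoare_pointwise) (use assms(1) in blast)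
  show "hoare (\<lambda>\<mu>. \<mu> = \<mu>0 \<and> \<not> bval b \<mu>) d T' Q"
    by (rule hoare_pointwise) (use assms(2) in blast)
qed

lemma hoare_Write_pt:
  "Q (update a (aval e \<mu>0) (aval f \<mu>0) \<mu>0) \<Longrightarrow> hoare (only \<mu>0) (Write a e f) 1 Q"
  by (rule hoare_Write) simp

lemma hoare_Write_Seq_pt:
  "hoare (only (update a (aval e \<mu>0) (aval f \<mu>0) \<mu>0)) c T Q \<Longrightarrow>
    hoare (only \<mu>0) (Seq (Write a e f) c) (Suc T) Q"
  by (erule hoare_Write_Seq) simp

lemma hoare_Skip_pt: "Q \<mu>0 \<Longrightarrow> hoare (only \<mu>0) Skip 1 Q"
  by (rule hoare_Skip) simp

lemma wpu_Seq_le: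
  assumes "hoare (only \<mu>) c T R" "\<And>\<mu>1. R \<mu>1 \<Longrightarrow> wpu d F \<mu>1 \<le> K"
  shows "wpu (Seq c d) F \<mu> \<le> K"
  using wpu_Seq[of c d F \<mu>] wpu_le_hoare[OF assms] by (rule order_trans)

lemma wpu_Write_Seq:
  "wpu c F (update a (aval e \<mu>) (aval f \<mu>) \<mu>) \<le> K \<Longrightarrow> wpu (Seq (Write a e f) c) F \<mu> \<le> K"
  using wpu_Seq[of "Write a e f" c F \<mu>] by (simp add: wpu_Write)

lemma wpu_If_le:
  "(bval b \<mu> \<Longrightarrow> wpu c F \<mu> \<le> K) \<Longrightarrow> (\<not> bval b \<mu> \<Longrightarrow> wpu d F \<mu> \<le> K) \<Longrightarrow> wpu (If b c d) F \<mu> \<le> K"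
  by (rule order_trans[OF wpu_If]) simp

text \<open>\<open>out\<close> is the characteristic function of the current partial transversal, \<open>occ\<close> marks
  the blocks that it meets at their least vertices, \<open>mul\<close> is the table of multiples of \<open>n\<close>
  used to address \<open>adj\<close>.\<close>

definition cond_free :: bexp where
  "cond_free = eq (Read ''occ'' (Read ''block'' (V ''i''))) (Const 0)"

definition cond_bad :: bexp where
  "cond_bad = And (eq (Read ''out'' (V ''i'')) (Const 1)) (Not (Less (Read ''deg'' (V ''i'')) (V ''s'')))"

definition cond_edge :: "string \<Rightarrow> string \<Rightarrow> bexp" where
  "cond_edge u v = And (eq (Read ''adj'' (Plus (Read ''mul'' (V u)) (V v))) (Const 1))
     (eq (Read ''out'' (V v)) (Const 1))"

definition remove :: "string \<Rightarrow> com" where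
  "remove v = Seq (Write ''out'' (V v) (Const 0)) (Write ''occ'' (Read ''block'' (V v)) (Const 0))"

definition degrees :: com where
  "degrees = For ''i'' (Seq (Write ''deg'' (V ''i'') (Const 0))
     (For ''j'' (If (cond_edge ''i'' ''j'')
        (Write ''deg'' (V ''i'') (Plus (Read ''deg'' (V ''i'')) (Const 1))) Skip)))"

definition thin_body :: com where
  "thin_body = Seq (pick (cond_edge ''x'' ''i''))
     (Seq (If found (remove ''y'') Skip)
       (incr ''t''))"

definition thin :: com where
  "thin = While (Less (V ''t'') (V ''e'')) thin_body"

definition reset :: com where
  "reset = Seq (remove ''w'') (Seq (remove ''x'') (Seq (assign ''t'' (Const 0)) thin))"

definition redo :: com where
  "redo = If found (Seq (assign ''x'' (V ''y'')) reset) Skip"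

definition mend :: com where
  "mend = Seq degrees (Seq (pick cond_bad) redo)"

definition extend :: com where
  "extend = Seq (assign ''w'' (V ''y'')) (Seq (Write ''out'' (V ''w'') (Const 1))
       (Seq (Write ''occ'' (Read ''block'' (V ''w'')) (Const 1)) mend))"

definition step :: com where
  "step = Seq (pick cond_free) (If found
     extend
     (assign ''done'' (Const 1)))"

abbreviation running :: bexp where "running \<equiv> Less (V ''done'') (Const 1)"

definition search_body :: com where
  "search_body = Seq step (incr ''cnt'')"

definition search :: com where
  "search = While (And (Less (V ''cnt'') (V ''N'')) running) search_body"

definition clear :: com where
  "clear = For ''i'' (Seq (Write ''out'' (V ''i'') (Const 0)) (Write ''occ'' (V ''i'') (Const 0)))"

definition attempt :: com where
  "attempt = Seq clear (Seq (assign ''cnt'' (Const 0)) search)"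

text \<open>The guess of \<open>e\<close> reuses the generator of the random choices, so its range
  is of order \<open>n * n\<close> instead of \<open>n\<close>; this only affects the
  polynomial.\<close>

definition trial :: com where
  "trial = Seq sample (Seq (assign ''e'' (V ''r'')) attempt)"

text \<open>Writing at index \<open>i + 1\<close> fills the table up to index \<open>n\<close>
  inclusive; the entry at \<open>n\<close> is the square from which \<open>M\<close> and
  \<open>N\<close> are formed.\<close>

definition multiples :: com where
  "multiples = For ''i'' (Write ''mul'' (Plus (V ''i'') (Const 1)) (Plus (Read ''mul'' (V ''i'')) (V ''n'')))"

definition twice :: "aexp \<Rightarrow> aexp" where "twice e = Plus e e"

text \<open>The summand 1 in the step bound matters for the empty graph only: the search needs one step
  to notice that it is finished.\<close>

definition init :: com where
  "init = Seq multiples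
     (Seq (assign ''M'' (twice (twice (twice (twice (Read ''mul'' (V ''n'')))))))
       (assign ''N'' (Plus (twice (twice (twice (Read ''mul'' (V ''n''))))) (Const 1))))"

definition algorithm :: com where
  "algorithm = Seq init (While running trial)"

section \<open>Frames and worst-case step counts\<close>

abbreviation thin_vars :: "string set" where
  "thin_vars \<equiv> pick_vars \<union> {''out'', ''occ'', ''t''}"

abbreviation mend_vars :: "string set" where
  "mend_vars \<equiv> thin_vars \<union> {''deg'', ''j'', ''x''}"

abbreviation step_vars :: "string set" where
  "step_vars \<equiv> mend_vars \<union> {''w'', ''done''}"

definition T_find :: "nat \<Rightarrow> nat" where
  "T_find n = T_pick n (16 * (n * n))"

text \<open>A wrong guess of \<open>e\<close> can be as large as \<open>2 * 16 * n * n\<close>, the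
  bound on \<open>r\<close> after sampling.\<close>

definition T_thin :: "nat \<Rightarrow> nat" where
  "T_thin n = Suc (32 * (n * n) * Suc (T_find n + 5))"

definition T_degrees :: "nat \<Rightarrow> nat" where
  "T_degrees n = 2 + n * (5 + n * 5)"

definition T_mend :: "nat \<Rightarrow> nat" where
  "T_mend n = T_degrees n + (T_find n + Suc (Suc (5 + T_thin n) + 1))"

definition T_step :: "nat \<Rightarrow> nat" where
  "T_step n = T_find n + Suc (Suc (Suc (Suc (T_mend n))) + 1)"

definition T_search :: "nat \<Rightarrow> nat" where
  "T_search n = Suc ((8 * (n * n) + 1) * Suc (T_step n + 1))"

definition T_trial :: "nat \<Rightarrow> nat" where
  "T_trial n = T_sample (16 * (n * n)) + Suc (2 + n * 4 + Suc (T_search n))"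

definition T_init :: "nat \<Rightarrow> nat" where
  "T_init n = 4 + n * 3"

abbreviation unfinished :: "state \<Rightarrow> ennreal" where
  "unfinished \<mu> \<equiv> of_bool (bval running \<mu>)"

lemma wpu_le_1: "(\<And>\<mu>'. F \<mu>' \<le> 1) \<Longrightarrow> wpu c F \<mu> \<le> 1"
  by (intro wpu_leI nn_integral_spmf_le_const) auto

text \<open>Extracts the existence of a transversal from the termination of the algorithm.\<close>

lemma lossless_set_nonempty:
  assumes "lossless_spmf p"
  shows "set_spmf p \<noteq> {}"
proof
  assume "set_spmf p = {}"
  then have "(\<integral>\<^sup>+ y. 1 \<partial>measure_spmf p) \<le> 0" by (intro nn_integral_spmf_le_const) simp
  then show False unfolding nn_integral_spmf_const[OF assms] by simp
qed

section \<open>Representation of partial transversals in memory\<close>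

context blocked_graph
begin

definition rep :: "nat \<Rightarrow> nat" where "rep v = (LEAST u. u \<in> bl v)"

text \<open>A uniform number below \<open>2 ^ bits M \<ge> 16 * n * n\<close> modulo some \<open>m \<le> n\<close> is uniform up to the
  factor \<open>1 + \<eta>\<close>.\<close>

definition \<eta> :: real where "\<eta> = 1 / (16 * real n)"

lemma \<eta>_nonneg: "0 \<le> \<eta>"
  by (simp add: \<eta>_def)

lemma \<eta>_le_1: "\<eta> \<le> 1"
  unfolding \<eta>_def by (cases n) (simp_all add: field_simps)

lemma card_le_\<eta>: "C \<subseteq> {..<n} \<Longrightarrow> real (card C) \<le> \<eta> * real (16 * (n * n))"
proof -
  assume "C \<subseteq> {..<n}"
  then have "card C \<le> n" using card_mono[of "{..<n}" C] by simp
  then show ?thesis by (simp add: \<eta>_def field_simps)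
qed

lemma rep_in_bl: "v < n \<Longrightarrow> rep v \<in> bl v"
  unfolding rep_def using in_bl by (rule LeastI)

lemma rep_lt: "v < n \<Longrightarrow> rep v < n"
  using rep_in_bl bl_in_P Union_P by blast

lemma in_bl_iff:
  assumes "v < n" "w < n"
  shows "w \<in> bl v \<longleftrightarrow> bl w = bl v"
proof
  show "bl w = bl v" if "w \<in> bl v" using bl_eq[OF bl_in_P[OF assms(1)] that] .
  show "w \<in> bl v" if "bl w = bl v" using in_bl[OF assms(2)] that by simp
qed

lemma rep_eq_iff:
  assumes "v < n" "w < n"
  shows "rep v = rep w \<longleftrightarrow> bl v = bl w"
proof
  assume "rep v = rep w"
  then have "rep v \<in> bl w" using rep_in_bl[OF assms(2)] by simp
  then show "bl v = bl w"
    by (rule block_unique[OF bl_in_P[OF assms(1)] bl_in_P[OF assms(2)] rep_in_bl[OF assms(1)]])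
qed (simp add: rep_def)

definition data :: "state \<Rightarrow> bool" where
  "data \<mu> \<longleftrightarrow> \<mu> ''n'' 0 = n \<and> \<mu> ''s'' 0 = s \<and> \<mu> ''M'' 0 = 16 * (n * n) \<and>
     \<mu> ''N'' 0 = 8 * (n * n) + 1 \<and> (\<forall>i<n. \<mu> ''mul'' i = i * n) \<and>
     (\<forall>i<n. \<forall>j<n. \<mu> ''adj'' (i * n + j) = of_bool ((i, j) \<in> E)) \<and> (\<forall>v<n. \<mu> ''block'' v = rep v)"

text \<open>Injectivity of \<open>bl\<close> expresses that \<open>A\<close> is a partial
  transversal without mentioning the set of blocks that it meets. It also makes one flag per block
  sufficient: deleting the vertex of a block clears the flag.\<close>

definition repr :: "nat set \<Rightarrow> state \<Rightarrow> bool" where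
  "repr A \<mu> \<longleftrightarrow> data \<mu> \<and> A \<subseteq> {..<n} \<and> inj_on bl A \<and> (\<forall>v<n. \<mu> ''out'' v = of_bool (v \<in> A)) \<and>
     (\<forall>v<n. \<mu> ''occ'' (rep v) = of_bool (A \<inter> bl v \<noteq> {}))"

abbreviation data_vars :: "string set" where
  "data_vars \<equiv> {''n'', ''s'', ''M'', ''N'', ''mul'', ''adj'', ''block''}"

lemma data_agree:
  assumes "data \<mu>" "agree X \<mu> \<mu>'" "X \<inter> data_vars = {}"
  shows "data \<mu>'"
proof -
  have "\<mu>' a = \<mu> a" if "a \<in> data_vars" for a using that agreeD[OF assms(2)] assms(3) by blast
  then show ?thesis using assms(1) unfolding data_def by simp
qed

lemma repr_agree:
  assumes "repr A \<mu>" "agree X \<mu> \<mu>'" "X \<inter> (data_vars \<union> {''out'', ''occ''}) = {}"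
  shows "repr A \<mu>'"
proof -
  have "\<mu>' a = \<mu> a" if "a \<in> {''out'', ''occ''}" for a using that agreeD[OF assms(2)] assms(3) by blast
  moreover have "data \<mu>'"
    by (rule data_agree[OF _ assms(2)]) (use assms in \<open>auto simp: repr_def\<close>)
  ultimately show ?thesis using assms(1) unfolding repr_def by simp
qed

lemma reprD:
  assumes "repr A \<mu>"
  shows "\<mu> ''n'' 0 = n" "\<mu> ''M'' 0 = 16 * (n * n)" "\<mu> ''s'' 0 = s" "\<mu> ''N'' 0 = 8 * (n * n) + 1"
    "A \<subseteq> {..<n}" "inj_on bl A" "finite A"
    "\<And>v. v < n \<Longrightarrow> \<mu> ''out'' v = of_bool (v \<in> A)"
    "\<And>v. v < n \<Longrightarrow> \<mu> ''block'' v = rep v"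
    "\<And>v. v < n \<Longrightarrow> \<mu> ''occ'' (rep v) = of_bool (A \<inter> bl v \<noteq> {})"
    "\<And>u v. u < n \<Longrightarrow> v < n \<Longrightarrow> \<mu> ''adj'' (u * n + v) = of_bool ((u, v) \<in> E)"
    "\<And>u. u < n \<Longrightarrow> \<mu> ''mul'' u = u * n"
proof -
  note r = assms[unfolded repr_def data_def]
  show "A \<subseteq> {..<n}" using r by blast
  then show "finite A" by (rule finite_subset) simp
qed (use assms in \<open>simp_all add: repr_def data_def\<close>)

lemma repr_insert:
  assumes A: "repr A \<mu>" and w: "w \<in> free A"
  shows "repr (insert w A) (update ''occ'' (rep w) 1 (update ''out'' w 1 \<mu>))"
proof -
  let ?\<mu> = "update ''occ'' (rep w) 1 (update ''out'' w 1 \<mu>)"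
  have wn: "w < n" "A \<inter> bl w = {}" using w by (auto simp: free_def)
  have "data ?\<mu>" using A by (simp add: repr_def data_def)
  moreover have "inj_on bl (insert w A)"
  proof -
    have "bl w \<noteq> bl u" if "u \<in> A" for u
      using that wn in_bl_iff[of w u] reprD(5)[OF A] by (auto simp: disjoint_iff)
    then show ?thesis using reprD(6)[OF A] by (auto simp: inj_on_def)
  qed
  moreover have "?\<mu> ''occ'' (rep v) = of_bool (insert w A \<inter> bl v \<noteq> {})" if "v < n" for v
    using that wn in_bl_iff[of v w] rep_eq_iff[of v w] reprD(10)[OF A that] by auto
  ultimately show ?thesis
    using reprD(5,8)[OF A] wn unfolding repr_def by simp
qed

text \<open>\<open>y\<close> need not belong to \<open>A\<close>. This covers the second deletion in
  \<open>reset\<close> when the centre \<open>x\<close> is \<open>w\<close> itself.\<close>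

lemma repr_remove:
  assumes A: "repr A \<mu>" and y: "y < n" "A \<inter> bl y \<subseteq> {y}"
  shows "repr (A - {y}) (update ''occ'' (rep y) 0 (update ''out'' y 0 \<mu>))"
proof -
  let ?\<mu> = "update ''occ'' (rep y) 0 (update ''out'' y 0 \<mu>)"
  have "data ?\<mu>" using A by (simp add: repr_def data_def)
  moreover have "inj_on bl (A - {y})" using reprD(6)[OF A] by (rule inj_on_subset) auto
  moreover have "?\<mu> ''occ'' (rep v) = of_bool ((A - {y}) \<inter> bl v \<noteq> {})" if "v < n" for v
  proof (cases "bl v = bl y")
    case True
    then show ?thesis using that y rep_eq_iff[of v y] by auto
  next
    case False
    then have "(A - {y}) \<inter> bl v = A \<inter> bl v" "rep v \<noteq> rep y"
      using that y in_bl_iff[of v y] rep_eq_iff[of v y] by auto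
    then show ?thesis using reprD(10)[OF A that] by simp
  qed
  ultimately show ?thesis
    using reprD(5,8)[OF A] y unfolding repr_def by auto
qed

lemma bl_inter_subset: "repr A \<mu> \<Longrightarrow> y \<in> A \<Longrightarrow> A' \<subseteq> A \<Longrightarrow> A' \<inter> bl y \<subseteq> {y}"
proof
  fix u assume *: "repr A \<mu>" "y \<in> A" "A' \<subseteq> A" "u \<in> A' \<inter> bl y"
  then have "u \<in> A" "u < n" "y < n" using reprD(5)[OF *(1)] by auto
  then have "bl u = bl y" using * in_bl_iff[of y u] by auto
  then show "u \<in> {y}" using reprD(6)[OF *(1)] \<open>u \<in> A\<close> *(2) by (auto dest: inj_onD)
qed

lemma bval_cond_free:
  assumes "repr A \<mu>" "\<mu> ''i'' 0 < n"
  shows "bval cond_free \<mu> \<longleftrightarrow> \<mu> ''i'' 0 \<in> free A"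
proof -
  have "\<mu> ''occ'' (\<mu> ''block'' (\<mu> ''i'' 0)) = of_bool (A \<inter> bl (\<mu> ''i'' 0) \<noteq> {})"
    by (simp only: reprD(9,10)[OF assms])
  then show ?thesis using assms(2) by (simp add: cond_free_def free_def)
qed

lemma bval_cond_edge:
  assumes "repr A \<mu>" "\<mu> u 0 < n" "\<mu> v 0 < n"
  shows "bval (cond_edge u v) \<mu> \<longleftrightarrow> \<mu> v 0 \<in> nb (\<mu> u 0) \<inter> A"
proof -
  have "\<mu> ''adj'' (\<mu> ''mul'' (\<mu> u 0) + \<mu> v 0) = of_bool ((\<mu> u 0, \<mu> v 0) \<in> E)"
    by (simp only: reprD(12)[OF assms(1,2)] reprD(11)[OF assms])
  then show ?thesis by (simp add: cond_edge_def nb_def reprD(8)[OF assms(1,3)])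
qed

lemma bval_cond_bad:
  assumes "repr A \<mu>" "\<mu> ''i'' 0 < n" "\<And>v. v < n \<Longrightarrow> \<mu> ''deg'' v = card (nb v \<inter> A)"
  shows "bval cond_bad \<mu> \<longleftrightarrow> \<mu> ''i'' 0 \<in> bad A"
proof -
  have "\<mu> ''out'' (\<mu> ''i'' 0) = 1 \<longleftrightarrow> \<mu> ''i'' 0 \<in> A"
    unfolding reprD(8)[OF assms(1,2)] by simp
  moreover have "\<not> \<mu> ''deg'' (\<mu> ''i'' 0) < \<mu> ''s'' 0 \<longleftrightarrow> s \<le> card (nb (\<mu> ''i'' 0) \<inter> A)"
    unfolding reprD(3)[OF assms(1)] assms(3)[OF assms(2)] by (rule not_less)
  ultimately show ?thesis unfolding cond_bad_def bad_def by simp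
qed

lemma bad_mono: "A' \<subseteq> A \<Longrightarrow> finite A \<Longrightarrow> bad A = {} \<Longrightarrow> bad A' = {}"
proof -
  assume *: "A' \<subseteq> A" "finite A" "bad A = {}"
  have "card (nb x \<inter> A') \<le> card (nb x \<inter> A)" for x using * by (intro card_mono) auto
  then have "bad A' \<subseteq> bad A" using *(1) unfolding bad_def by (auto intro: le_trans)
  then show ?thesis using * by simp
qed

lemma free_subset: "free A \<subseteq> {..<n}" by (auto simp: free_def)

lemma bad_subset: "bad A \<subseteq> A" by (auto simp: bad_def)

section \<open>Correctness and failure bounds of the subprograms\<close>

lemma hoare_remove:
  assumes A: "repr A \<mu>0" and y: "\<mu>0 v 0 = y" "y < n" "A \<inter> bl y \<subseteq> {y}" and v: "v \<noteq> ''out''"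
  shows "hoare (only \<mu>0) (remove v) 2 (\<lambda>\<mu>. repr (A - {y}) \<mu> \<and> agree {''out'', ''occ''} \<mu>0 \<mu>)"
proof -
  have "hoare (only \<mu>0) (remove v) (Suc 1) (\<lambda>\<mu>. repr (A - {y}) \<mu> \<and> agree {''out'', ''occ''} \<mu>0 \<mu>)"
    unfolding remove_def
    by (rule hoare_Write_Seq_pt, rule hoare_Write_pt)
      (use repr_remove[OF A y(2,3)] y v reprD(9)[OF A] in \<open>simp add: agree_update\<close>)
  then show ?thesis by (rule hoare_weaken) auto
qed

lemma hoare_degrees:
  assumes A: "repr A \<mu>0"
  shows "hoare (only \<mu>0) degrees (T_degrees n)
    (\<lambda>\<mu>. agree {''i'', ''j'', ''deg''} \<mu>0 \<mu> \<and> (\<forall>v<n. \<mu> ''deg'' v = card (nb v \<inter> A)))"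
proof -
  let ?X = "{''i'', ''j'', ''deg''}"
  let ?J = "\<lambda>k \<mu>. agree ?X \<mu>0 \<mu> \<and> (\<forall>v<k. \<mu> ''deg'' v = card (nb v \<inter> A))"
  let ?b = "If (cond_edge ''i'' ''j'')
        (Write ''deg'' (V ''i'') (Plus (Read ''deg'' (V ''i'')) (Const 1))) Skip"
  have A': "repr A \<mu>" if "agree ?X \<mu>0 \<mu>" for \<mu> by (rule repr_agree[OF A that]) simp
  have "hoare (only \<mu>0) degrees (2 + n * (Suc (2 + n * (3 + 2)) + 2)) (?J n)"
    unfolding degrees_def
  proof (rule hoare_For[where J = ?J])
    fix k assume k: "k < n"
    let ?K = "\<lambda>l \<mu>. ?J k \<mu> \<and> \<mu> ''i'' 0 = k \<and> \<mu> ''deg'' k = card (nb k \<inter> A \<inter> {..<l})"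
    have inner: "hoare (\<lambda>\<mu>. ?J k \<mu> \<and> \<mu> ''i'' 0 = k \<and> \<mu> ''deg'' k = 0) (For ''j'' ?b) (2 + n * (3 + 2)) (?K n)"
    proof (rule hoare_For[where J = ?K])
      fix l assume l: "l < n"
      show "hoare (\<lambda>\<mu>. ?K l \<mu> \<and> \<mu> ''j'' 0 = l) ?b 3 (\<lambda>\<mu>. ?K (Suc l) \<mu> \<and> \<mu> ''j'' 0 = l)"
      proof (rule hoare_pointwise)
        fix \<mu> assume *: "?K l \<mu> \<and> \<mu> ''j'' 0 = l"
        have b: "bval (cond_edge ''i'' ''j'') \<mu> \<longleftrightarrow> l \<in> nb k \<inter> A"
          using bval_cond_edge[OF A', of \<mu> "''i''" "''j''"] * k l by simp
        have S: "card (nb k \<inter> A \<inter> {..<Suc l}) = card (nb k \<inter> A \<inter> {..<l}) + of_bool (l \<in> nb k \<inter> A)"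
        proof (cases "l \<in> nb k \<inter> A")
          case True
          then have "nb k \<inter> A \<inter> {..<Suc l} = insert l (nb k \<inter> A \<inter> {..<l})" by (auto simp: less_Suc_eq)
          then show ?thesis using True by simp
        next
          case False
          then have "nb k \<inter> A \<inter> {..<Suc l} = nb k \<inter> A \<inter> {..<l}" by (auto simp: less_Suc_eq)
          then show ?thesis using False by simp
        qed
        have "hoare (only \<mu>) ?b (Suc (1 + 1)) (\<lambda>\<mu>. ?K (Suc l) \<mu> \<and> \<mu> ''j'' 0 = l)"
          by (intro hoare_If_pt hoare_Write_pt hoare_Skip_pt)
            (use * b S in \<open>auto simp: agree_update\<close>)
        then show "hoare (only \<mu>) ?b 3 (\<lambda>\<mu>. ?K (Suc l) \<mu> \<and> \<mu> ''j'' 0 = l)"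
          by (rule hoare_weaken) auto
      qed
    next
      fix l \<mu> assume "?K l \<mu>"
      then show "\<mu> ''n'' 0 = n" using reprD(1)[OF A'] by blast
    qed (auto simp: agree_update)
    have "hoare (\<lambda>\<mu>. ?J k \<mu> \<and> \<mu> ''i'' 0 = k \<and> \<mu> ''deg'' k = 0) (For ''j'' ?b) (2 + n * (3 + 2))
      (\<lambda>\<mu>. ?J (Suc k) \<mu> \<and> \<mu> ''i'' 0 = k)"
    proof (rule hoare_weaken[OF inner])
      fix \<mu> assume *: "?K n \<mu>"
      have "nb k \<inter> A \<inter> {..<n} = nb k \<inter> A" using nb_subset by auto
      then show "?J (Suc k) \<mu> \<and> \<mu> ''i'' 0 = k" using * by (simp add: less_Suc_eq)
    qed auto
    then show "hoare (\<lambda>\<mu>. ?J k \<mu> \<and> \<mu> ''i'' 0 = k) (Seq (Write ''deg'' (V ''i'') (Const 0)) (For ''j'' ?b))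
      (Suc (2 + n * (3 + 2))) (\<lambda>\<mu>. ?J (Suc k) \<mu> \<and> \<mu> ''i'' 0 = k)"
      by (rule hoare_Write_Seq) (simp add: agree_update)
  next
    fix k \<mu> assume "?J k \<mu>"
    then show "\<mu> ''n'' 0 = n" using reprD(1)[OF A'] by blast
  qed (auto simp: agree_update)
  then show ?thesis by (rule hoare_weaken) (auto simp: T_degrees_def algebra_simps)
qed

abbreviation picked :: "nat set \<Rightarrow> state \<Rightarrow> state \<Rightarrow> bool" where
  "picked C \<mu>0 \<mu> \<equiv> agree pick_vars \<mu>0 \<mu> \<and> \<mu> ''m'' 0 = card C \<and> (C \<noteq> {} \<longrightarrow> \<mu> ''y'' 0 \<in> C)"

lemma pick_set:
  assumes A: "repr A \<mu>0" and C: "C \<subseteq> {..<n}"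
    and cond: "\<And>\<mu>. agree scan_vars \<mu>0 \<mu> \<Longrightarrow> repr A \<mu> \<Longrightarrow> \<mu> ''i'' 0 < n \<Longrightarrow>
      bval cond \<mu> \<longleftrightarrow> \<mu> ''i'' 0 \<in> C"
  shows "hoare (only \<mu>0) (pick cond) (T_find n) (picked C \<mu>0)"
    and "\<lbrakk>C \<noteq> {}; \<And>y. 0 \<le> h y; \<And>\<mu>. \<lbrakk>agree pick_vars \<mu>0 \<mu>; \<mu> ''m'' 0 = card C;
        \<mu> ''y'' 0 \<in> C\<rbrakk> \<Longrightarrow> F \<mu> \<le> ennreal (h (\<mu> ''y'' 0))\<rbrakk>
      \<Longrightarrow> wpu (pick cond) F \<mu>0 \<le> ennreal (avg \<eta> C h)"
proof -
  have c: "bval cond \<mu> \<longleftrightarrow> \<mu> ''i'' 0 \<in> C"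
    if "agree scan_vars \<mu>0 \<mu>" "\<mu> ''i'' 0 < n" for \<mu>
    by (rule cond[OF that(1) repr_agree[OF A that(1)] that(2)]) simp
  show "hoare (only \<mu>0) (pick cond) (T_find n) (picked C \<mu>0)"
    unfolding T_find_def by (rule hoare_pick) (use reprD(1,2)[OF A] C c in auto)
  show "\<lbrakk>C \<noteq> {}; \<And>y. 0 \<le> h y; \<And>\<mu>. \<lbrakk>agree pick_vars \<mu>0 \<mu>; \<mu> ''m'' 0 = card C;
        \<mu> ''y'' 0 \<in> C\<rbrakk> \<Longrightarrow> F \<mu> \<le> ennreal (h (\<mu> ''y'' 0))\<rbrakk>
      \<Longrightarrow> wpu (pick cond) F \<mu>0 \<le> ennreal (avg \<eta> C h)"
    unfolding avg_def using reprD(1,2)[OF A] C c card_le_\<eta>[OF C]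
    by (intro wpu_pick[where n = n and M = "16 * (n * n)"]) auto
qed

lemma pick_free:
  assumes A: "repr A \<mu>0"
  shows "hoare (only \<mu>0) (pick cond_free) (T_find n) (picked (free A) \<mu>0)"
    (is ?hoare)
    and "\<lbrakk>free A \<noteq> {}; \<And>y. 0 \<le> h y; \<And>\<mu>. \<lbrakk>agree pick_vars \<mu>0 \<mu>; \<mu> ''m'' 0 = card (free A);
        \<mu> ''y'' 0 \<in> free A\<rbrakk> \<Longrightarrow> F \<mu> \<le> ennreal (h (\<mu> ''y'' 0))\<rbrakk>
      \<Longrightarrow> wpu (pick cond_free) F \<mu>0 \<le> ennreal (avg \<eta> (free A) h)"
    (is "PROP ?wpu")
proof -
  have c: "bval cond_free \<mu> \<longleftrightarrow> \<mu> ''i'' 0 \<in> free A"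
    if "agree scan_vars \<mu>0 \<mu>" "repr A \<mu>" "\<mu> ''i'' 0 < n" for \<mu>
    by (rule bval_cond_free[OF that(2,3)])
  note p = pick_set[OF A free_subset c]
  show ?hoare by (rule p(1))
  show "PROP ?wpu" by (rule p(2))
qed

lemma pick_bad:
  assumes A: "repr A \<mu>0" and deg: "\<And>v. v < n \<Longrightarrow> \<mu>0 ''deg'' v = card (nb v \<inter> A)"
  shows "hoare (only \<mu>0) (pick cond_bad) (T_find n) (picked (bad A) \<mu>0)"
    (is ?hoare)
    and "\<lbrakk>bad A \<noteq> {}; \<And>y. 0 \<le> h y; \<And>\<mu>. \<lbrakk>agree pick_vars \<mu>0 \<mu>; \<mu> ''m'' 0 = card (bad A);
        \<mu> ''y'' 0 \<in> bad A\<rbrakk> \<Longrightarrow> F \<mu> \<le> ennreal (h (\<mu> ''y'' 0))\<rbrakk>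
      \<Longrightarrow> wpu (pick cond_bad) F \<mu>0 \<le> ennreal (avg \<eta> (bad A) h)"
    (is "PROP ?wpu")
proof -
  have s: "bad A \<subseteq> {..<n}" using bad_subset reprD(5)[OF A] by blast
  have c: "bval cond_bad \<mu> \<longleftrightarrow> \<mu> ''i'' 0 \<in> bad A"
    if "agree scan_vars \<mu>0 \<mu>" "repr A \<mu>" "\<mu> ''i'' 0 < n" for \<mu>
    using bval_cond_bad[OF that(2,3)] deg agreeD[OF that(1), of "''deg''"] by simp
  note p = pick_set[OF A s c]
  show ?hoare by (rule p(1))
  show "PROP ?wpu" by (rule p(2))
qed

lemma pick_neighbour:
  assumes A: "repr A \<mu>0" and x: "\<mu>0 ''x'' 0 = x" "x < n"
  defines "C \<equiv> nb x \<inter> A"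
  shows "hoare (only \<mu>0) (pick (cond_edge ''x'' ''i'')) (T_find n) (picked C \<mu>0)"
    (is ?hoare)
    and "\<lbrakk>C \<noteq> {}; \<And>y. 0 \<le> h y; \<And>\<mu>. \<lbrakk>agree pick_vars \<mu>0 \<mu>; \<mu> ''m'' 0 = card C;
        \<mu> ''y'' 0 \<in> C\<rbrakk> \<Longrightarrow> F \<mu> \<le> ennreal (h (\<mu> ''y'' 0))\<rbrakk>
      \<Longrightarrow> wpu (pick (cond_edge ''x'' ''i'')) F \<mu>0 \<le> ennreal (avg \<eta> C h)"
    (is "PROP ?wpu")
proof -
  have s: "C \<subseteq> {..<n}" unfolding C_def using reprD(5)[OF A] by blast
  have c: "bval (cond_edge ''x'' ''i'') \<mu> \<longleftrightarrow> \<mu> ''i'' 0 \<in> C"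
    if "agree scan_vars \<mu>0 \<mu>" "repr A \<mu>" "\<mu> ''i'' 0 < n" for \<mu>
  proof -
    have "\<mu> ''x'' 0 = x" using agreeD[OF that(1), of "''x''"] x by simp
    then show ?thesis
      using bval_cond_edge[OF that(2), of "''x''" "''i''"] that(3) x(2) by (simp add: C_def)
  qed
  note p = pick_set[OF A s c]
  show ?hoare by (rule p(1))
  show "PROP ?wpu" by (rule p(2))
qed

lemma hoare_thin_body:
  assumes A: "repr A \<mu>0" and x: "\<mu>0 ''x'' 0 = x" "x < n"
  shows "hoare (only \<mu>0) thin_body (T_find n + 5)
    (\<lambda>\<mu>. (\<exists>A'\<subseteq>A. repr A' \<mu>) \<and> agree thin_vars \<mu>0 \<mu> \<and> \<mu> ''t'' 0 = Suc (\<mu>0 ''t'' 0))"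
    (is "hoare _ _ _ ?Q")
proof -
  let ?C = "nb x \<inter> A"
  have fin: "finite ?C" by simp
  have "hoare (only \<mu>0) thin_body (T_find n + (Suc (2 + 1) + 1)) ?Q"
    unfolding thin_body_def
  proof (rule hoare_Seq_pt[OF pick_neighbour(1)[OF A x]])
    fix \<mu>1 assume 1: "picked ?C \<mu>0 \<mu>1"
    have A1: "repr A \<mu>1" by (rule repr_agree[OF A conjunct1[OF 1]]) simp
    let ?R = "\<lambda>\<mu>. (\<exists>A'\<subseteq>A. repr A' \<mu>) \<and> agree {''out'', ''occ''} \<mu>1 \<mu>"
    show "hoare (only \<mu>1) (Seq (If found (remove ''y'') Skip)
       (incr ''t'')) (Suc (2 + 1) + 1) ?Q"
    proof (rule hoare_Seq_pt[where R = ?R])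
      show "hoare (only \<mu>1) (If found (remove ''y'') Skip) (Suc (2 + 1)) ?R"
      proof (rule hoare_If_pt)
        assume "bval found \<mu>1"
        then have "?C \<noteq> {}" using 1 by auto
        then have y: "\<mu>1 ''y'' 0 \<in> A" using 1 by auto
        then have "\<mu>1 ''y'' 0 < n" using reprD(5)[OF A1] by auto
        then show "hoare (only \<mu>1) (remove ''y'') 2 ?R"
          using bl_inter_subset[OF A1 y order_refl]
          by (intro hoare_weaken[OF hoare_remove[OF A1 refl]]) auto
      next
        show "hoare (only \<mu>1) Skip 1 ?R" using A1 by (intro hoare_Skip_pt) auto
      qed
    next
      fix \<mu>2 assume 2: "?R \<mu>2"
      have "agree thin_vars \<mu>0 \<mu>2"
        by (rule agree_compose[OF conjunct1[OF 1] conjunct2[OF 2]]) auto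
      moreover have "\<mu>2 ''t'' = \<mu>0 ''t''"
        using agreeD[OF conjunct1[OF 1], of "''t''"] agreeD[OF conjunct2[OF 2], of "''t''"] by simp
      moreover obtain A' where A': "A' \<subseteq> A" "repr A' \<mu>2" using 2 by auto
      moreover have "repr A' (update ''t'' 0 k \<mu>2)" for k
        by (rule repr_agree[OF A'(2) agree_update[OF agree_refl, of "''t''" "{''t''}"]]) auto
      ultimately show "hoare (only \<mu>2) (incr ''t'') 1 ?Q"
        by (intro hoare_Write_pt) (auto simp: agree_update)
    qed
  qed
  then show ?thesis by (rule hoare_weaken) auto
qed

lemma hoare_thin:
  assumes A: "repr A \<mu>0" and x: "\<mu>0 ''x'' 0 = x" "x < n" and e: "\<mu>0 ''e'' 0 \<le> 32 * (n * n)"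
  shows "hoare (only \<mu>0) thin (T_thin n) (\<lambda>\<mu>. (\<exists>A'\<subseteq>A. repr A' \<mu>) \<and> agree thin_vars \<mu>0 \<mu>)"
proof -
  let ?I = "\<lambda>\<mu>. (\<exists>A'\<subseteq>A. repr A' \<mu>) \<and> agree thin_vars \<mu>0 \<mu>"
  let ?b = "Less (V ''t'') (V ''e'')" and ?v = "\<lambda>\<mu> :: state. \<mu>0 ''e'' 0 - \<mu> ''t'' 0"
  have "hoare (\<lambda>\<mu>. ?I \<mu> \<and> bval ?b \<mu> \<and> ?v \<mu> = k) thin_body (T_find n + 5)
    (\<lambda>\<mu>. ?I \<mu> \<and> ?v \<mu> < k)" for k
  proof (rule hoare_pointwise)
    fix \<mu>1 assume 1: "?I \<mu>1 \<and> bval ?b \<mu>1 \<and> ?v \<mu>1 = k"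
    then obtain A' where A': "A' \<subseteq> A" "repr A' \<mu>1" and a: "agree thin_vars \<mu>0 \<mu>1" by auto
    have x1: "\<mu>1 ''x'' 0 = x" "\<mu>1 ''e'' = \<mu>0 ''e''" using agreeD[OF a] x by auto
    show "hoare (only \<mu>1) thin_body (T_find n + 5) (\<lambda>\<mu>. ?I \<mu> \<and> ?v \<mu> < k)"
    proof (rule hoare_weaken[OF hoare_thin_body[OF A'(2) x1(1) x(2)]])
      fix \<mu> assume *: "(\<exists>A''\<subseteq>A'. repr A'' \<mu>) \<and> agree thin_vars \<mu>1 \<mu> \<and> \<mu> ''t'' 0 = Suc (\<mu>1 ''t'' 0)"
      have "agree thin_vars \<mu>0 \<mu>" using agree_trans[OF a] * by blast
      then show "?I \<mu> \<and> ?v \<mu> < k" using * A'(1) 1 x1(2) by auto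
    qed auto
  qed
  note loop = hoare_While[where v = ?v, OF this, of "32 * (n * n)"]
  show ?thesis unfolding thin_def T_thin_def
    by (rule hoare_weaken[OF loop]) (use A e in auto)
qed

text \<open>Here \<open>k\<close> is the number of rounds left, which the program represents as the
  difference of \<open>e\<close> and \<open>t\<close>; each round unfolds \<open>removal\<close>
  once.\<close>

lemma wpu_thin:
  assumes F: "\<And>A' \<mu>. repr A' \<mu> \<Longrightarrow> agree thin_vars \<mu>0 \<mu> \<Longrightarrow> F \<mu> \<le> ennreal (f A')"
    and f: "\<And>A. 0 \<le> f A" and x: "\<mu>0 ''x'' 0 = x" "x < n"
  shows "repr A \<mu> \<Longrightarrow> agree thin_vars \<mu>0 \<mu> \<Longrightarrow> \<mu> ''t'' 0 + k = \<mu>0 ''e'' 0 \<Longrightarrow>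
    wpu thin F \<mu> \<le> ennreal (removal \<eta> (nb x) f k A)"
proof (induction k arbitrary: A \<mu>)
  case 0
  have "\<mu> ''e'' = \<mu>0 ''e''" using agreeD[OF 0(2)] by auto
  then have "\<not> bval (Less (V ''t'') (V ''e'')) \<mu>" using 0(3) by simp
  then have "wpu thin F \<mu> \<le> F \<mu>"
    using wpu_While[of "Less (V ''t'') (V ''e'')" thin_body F \<mu>] by (simp add: thin_def)
  then show ?case using F[OF 0(1,2)] by simp
next
  case (Suc k)
  note A = Suc.prems(1) and a = Suc.prems(2)
  let ?C = "nb x \<inter> A"
  let ?next = "Seq (If found (remove ''y'') Skip)
       (incr ''t'')"
  have eq: "\<mu> ''e'' = \<mu>0 ''e''" "\<mu> ''x'' 0 = x" using agreeD[OF a] x by auto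
  have IH: "wpu thin F (update ''t'' 0 (Suc (\<mu>1 ''t'' 0)) \<mu>1) \<le> ennreal (removal \<eta> (nb x) f k A')"
    if "repr A' \<mu>1" "agree (pick_vars \<union> {''out'', ''occ''}) \<mu> \<mu>1" for A' \<mu>1
  proof (rule Suc.IH)
    show "repr A' (update ''t'' 0 (Suc (\<mu>1 ''t'' 0)) \<mu>1)"
      by (rule repr_agree[OF that(1) agree_update[OF agree_refl, of "''t''" "{''t''}"]]) auto
    have "agree thin_vars \<mu>0 \<mu>1" by (rule agree_compose[OF a that(2)]) auto
    then show "agree thin_vars \<mu>0 (update ''t'' 0 (Suc (\<mu>1 ''t'' 0)) \<mu>1)" by (rule agree_update) simp
    show "update ''t'' 0 (Suc (\<mu>1 ''t'' 0)) \<mu>1 ''t'' 0 + k = \<mu>0 ''e'' 0"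
      using Suc.prems(3) agreeD[OF that(2), of "''t''"] by simp
  qed
  have "bval (Less (V ''t'') (V ''e'')) \<mu>" using Suc.prems(3) eq by simp
  then have "wpu thin F \<mu> \<le> wpu thin_body (wpu thin F) \<mu>"
    using wpu_While[of "Less (V ''t'') (V ''e'')" thin_body F \<mu>] by (simp add: thin_def)
  also have "\<dots> \<le> wpu (pick (cond_edge ''x'' ''i'')) (wpu ?next (wpu thin F)) \<mu>"
    unfolding thin_body_def by (rule wpu_Seq)
  also have "\<dots> \<le> ennreal (removal \<eta> (nb x) f (Suc k) A)"
  proof (cases "?C = {}")
    case True
    have "wpu (pick (cond_edge ''x'' ''i'')) (wpu ?next (wpu thin F)) \<mu> \<le> ennreal (removal \<eta> (nb x) f k A)"
    proof (rule wpu_le_hoare[OF pick_neighbour(1)[OF A eq(2) x(2)]])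
      fix \<mu>1 assume 1: "picked ?C \<mu> \<mu>1"
      have A1: "repr A \<mu>1" by (rule repr_agree[OF A conjunct1[OF 1]]) simp
      have "wpu ?next (wpu thin F) \<mu>1 \<le>
          wpu (If found (remove ''y'') Skip)
            (wpu (incr ''t'') (wpu thin F)) \<mu>1"
        by (rule wpu_Seq)
      also have "\<dots> \<le> ennreal (removal \<eta> (nb x) f k A)"
      proof (rule wpu_If_le)
        have "agree (pick_vars \<union> {''out'', ''occ''}) \<mu> \<mu>1"
          by (rule agree_mono[OF conjunct1[OF 1]]) auto
        then show "wpu Skip (wpu (incr ''t'') (wpu thin F)) \<mu>1
          \<le> ennreal (removal \<eta> (nb x) f k A)"
          using IH[OF A1] by (simp add: wpu_Skip wpu_Write)
      qed (use 1 True in simp)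
      finally show "wpu ?next (wpu thin F) \<mu>1 \<le> ennreal (removal \<eta> (nb x) f k A)" .
    qed
    then show ?thesis using True by simp
  next
    case False
    have "wpu (pick (cond_edge ''x'' ''i'')) (wpu ?next (wpu thin F)) \<mu> \<le>
      ennreal (avg \<eta> ?C (\<lambda>y. removal \<eta> (nb x) f k (A - {y})))"
    proof (rule pick_neighbour(2)[OF A eq(2) x(2) False])
      fix \<mu>1 assume 1: "agree pick_vars \<mu> \<mu>1" "\<mu>1 ''m'' 0 = card ?C" "\<mu>1 ''y'' 0 \<in> ?C"
      let ?y = "\<mu>1 ''y'' 0"
      have A1: "repr A \<mu>1" by (rule repr_agree[OF A 1(1)]) simp
      have y: "?y \<in> A" using 1(3) by auto
      then have yn: "?y < n" using reprD(5)[OF A1] by auto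
      have "wpu ?next (wpu thin F) \<mu>1 \<le>
          wpu (If found (remove ''y'') Skip)
            (wpu (incr ''t'') (wpu thin F)) \<mu>1"
        by (rule wpu_Seq)
      also have "\<dots> \<le> ennreal (removal \<eta> (nb x) f k (A - {?y}))"
      proof (rule wpu_If_le)
        show "wpu (remove ''y'') (wpu (incr ''t'') (wpu thin F)) \<mu>1
          \<le> ennreal (removal \<eta> (nb x) f k (A - {?y}))"
        proof (rule wpu_le_hoare[OF hoare_remove[OF A1 refl yn bl_inter_subset[OF A1 y order_refl]]])
          fix \<mu>2 assume 2: "repr (A - {?y}) \<mu>2 \<and> agree {''out'', ''occ''} \<mu>1 \<mu>2"
          have "agree (pick_vars \<union> {''out'', ''occ''}) \<mu> \<mu>2"
            by (rule agree_compose[OF 1(1) conjunct2[OF 2]]) auto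
          then show "wpu (incr ''t'') (wpu thin F) \<mu>2
            \<le> ennreal (removal \<eta> (nb x) f k (A - {?y}))"
            using IH[OF conjunct1[OF 2]] by (simp add: wpu_Write)
        qed simp
      next
        have "card ?C \<noteq> 0" using False by simp
        then show "\<not> bval found \<mu>1 \<Longrightarrow>
          wpu Skip (wpu (incr ''t'') (wpu thin F)) \<mu>1
          \<le> ennreal (removal \<eta> (nb x) f k (A - {?y}))" using 1(2) by simp
      qed
      finally show "wpu ?next (wpu thin F) \<mu>1 \<le> ennreal (removal \<eta> (nb x) f k (A - {?y}))" .
    qed (rule removal_nonneg[OF \<eta>_nonneg f])
    then show ?thesis using False by simp
  qed
  finally show ?case .
qed

lemma repr_update:
  "repr A \<mu> \<Longrightarrow> a \<notin> data_vars \<union> {''out'', ''occ''} \<Longrightarrow> repr A (update a i k \<mu>)"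
  by (rule repr_agree[OF _ agree_update[OF agree_refl, of a "{a}"]]) auto

text \<open>Lets a property known for some represented set be transferred to a given one.\<close>

lemma repr_unique: "repr A \<mu> \<Longrightarrow> repr B \<mu> \<Longrightarrow> A = B"
proof -
  assume A: "repr A \<mu>" and B: "repr B \<mu>"
  have "v \<in> A \<longleftrightarrow> v \<in> B" if "v < n" for v
  proof -
    have "of_bool (v \<in> A) = (of_bool (v \<in> B) :: nat)"
      using reprD(8)[OF A that] reprD(8)[OF B that] by (rule subst)
    then show ?thesis by (simp only: of_bool_eq_iff)
  qed
  then show "A = B" using reprD(5)[OF A] reprD(5)[OF B] by blast
qed

lemma reset_intermediate:
  assumes A: "repr A \<mu>0" and w: "\<mu>0 ''w'' 0 = w" "w \<in> A" and x: "\<mu>0 ''x'' 0 = x" "x \<in> A"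
  shows "hoare (only \<mu>0) (remove ''w'') 2
      (\<lambda>\<mu>. repr (A - {w}) \<mu> \<and> agree {''out'', ''occ''} \<mu>0 \<mu>)"
    and "\<And>\<mu>1. repr (A - {w}) \<mu>1 \<and> agree {''out'', ''occ''} \<mu>0 \<mu>1 \<Longrightarrow>
      hoare (only \<mu>1) (remove ''x'') 2
        (\<lambda>\<mu>. repr (A - {w, x}) \<mu> \<and> agree {''out'', ''occ''} \<mu>0 \<mu>)"
proof -
  have lt: "w < n" "x < n" using w x reprD(5)[OF A] by auto
  show "hoare (only \<mu>0) (remove ''w'') 2
      (\<lambda>\<mu>. repr (A - {w}) \<mu> \<and> agree {''out'', ''occ''} \<mu>0 \<mu>)"
    by (rule hoare_remove[OF A w(1) lt(1) bl_inter_subset[OF A w(2) order_refl]]) simp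
  fix \<mu>1 assume 1: "repr (A - {w}) \<mu>1 \<and> agree {''out'', ''occ''} \<mu>0 \<mu>1"
  have x1: "\<mu>1 ''x'' 0 = x" using agreeD[OF conjunct2[OF 1], of "''x''"] x by simp
  have sub: "(A - {w}) \<inter> bl x \<subseteq> {x}" by (rule bl_inter_subset[OF A x(2)]) auto
  show "hoare (only \<mu>1) (remove ''x'') 2
      (\<lambda>\<mu>. repr (A - {w, x}) \<mu> \<and> agree {''out'', ''occ''} \<mu>0 \<mu>)"
  proof (rule hoare_weaken[OF hoare_remove[OF conjunct1[OF 1] x1 lt(2) sub]])
    fix \<mu> assume *: "repr (A - {w} - {x}) \<mu> \<and> agree {''out'', ''occ''} \<mu>1 \<mu>"
    have "A - {w} - {x} = A - {w, x}" by auto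
    then show "repr (A - {w, x}) \<mu> \<and> agree {''out'', ''occ''} \<mu>0 \<mu>"
      using * agree_trans[OF conjunct2[OF 1]] by auto
  qed auto
qed

lemma hoare_reset:
  assumes A: "repr A \<mu>0" and w: "\<mu>0 ''w'' 0 = w" "w \<in> A" and x: "\<mu>0 ''x'' 0 = x" "x \<in> A"
    and e: "\<mu>0 ''e'' 0 \<le> 32 * (n * n)"
  shows "hoare (only \<mu>0) reset (5 + T_thin n)
    (\<lambda>\<mu>. (\<exists>A'\<subseteq>A - {w, x}. repr A' \<mu>) \<and> agree thin_vars \<mu>0 \<mu>)" (is "hoare _ _ _ ?Q")
proof -
  have lt: "x < n" using x reprD(5)[OF A] by auto
  have "hoare (only \<mu>0) reset (2 + (2 + Suc (T_thin n))) ?Q"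
    unfolding reset_def
  proof (rule hoare_Seq_pt[OF reset_intermediate(1)[OF A w x]],
      rule hoare_Seq_pt[OF reset_intermediate(2)[OF A w x]], assumption)
    fix \<mu>2 assume 2: "repr (A - {w, x}) \<mu>2 \<and> agree {''out'', ''occ''} \<mu>0 \<mu>2"
    let ?\<mu>3 = "update ''t'' 0 0 \<mu>2"
    have A3: "repr (A - {w, x}) ?\<mu>3" using 2 by (intro repr_update) auto
    have eq: "?\<mu>3 ''x'' 0 = x" "?\<mu>3 ''e'' 0 = \<mu>0 ''e'' 0" using agreeD[OF conjunct2[OF 2]] x by auto
    have a: "agree thin_vars \<mu>0 ?\<mu>3"
      by (rule agree_update[OF agree_mono[OF conjunct2[OF 2]]]) auto
    have "hoare (only ?\<mu>3) thin (T_thin n) ?Q"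
      using e eq(2) agree_trans[OF a] by (intro hoare_weaken[OF hoare_thin[OF A3 eq(1) lt]]) auto
    then show "hoare (only \<mu>2) (Seq (assign ''t'' (Const 0)) thin) (Suc (T_thin n)) ?Q"
      by (intro hoare_Write_Seq_pt) simp
  qed
  then show ?thesis by (rule hoare_weaken) auto
qed

lemma wpu_reset:
  assumes A: "repr A \<mu>0" and w: "\<mu>0 ''w'' 0 = w" "w \<in> A" and x: "\<mu>0 ''x'' 0 = x" "x \<in> A"
    and f: "\<And>A. 0 \<le> f A"
    and F: "\<And>A' \<mu>. repr A' \<mu> \<Longrightarrow> agree thin_vars \<mu>0 \<mu> \<Longrightarrow> F \<mu> \<le> ennreal (f A')"
  shows "wpu reset F \<mu>0 \<le> ennreal (removal \<eta> (nb x) f (\<mu>0 ''e'' 0) (A - {w, x}))"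
proof -
  have lt: "x < n" using x reprD(5)[OF A] by auto
  show ?thesis unfolding reset_def
  proof (rule wpu_Seq_le[OF reset_intermediate(1)[OF A w x]],
      rule wpu_Seq_le[OF reset_intermediate(2)[OF A w x]], assumption)
    fix \<mu>2 assume 2: "repr (A - {w, x}) \<mu>2 \<and> agree {''out'', ''occ''} \<mu>0 \<mu>2"
    let ?\<mu>3 = "update ''t'' 0 0 \<mu>2"
    have A3: "repr (A - {w, x}) ?\<mu>3" using 2 by (intro repr_update) auto
    have a: "agree thin_vars \<mu>0 ?\<mu>3"
      by (rule agree_update[OF agree_mono[OF conjunct2[OF 2]]]) auto
    have "wpu thin F ?\<mu>3 \<le> ennreal (removal \<eta> (nb x) f (\<mu>0 ''e'' 0) (A - {w, x}))"
      by (rule wpu_thin[OF F f x(1) lt A3 a]) simp_all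
    then show "wpu (Seq (assign ''t'' (Const 0)) thin) F \<mu>2 \<le>
      ennreal (removal \<eta> (nb x) f (\<mu>0 ''e'' 0) (A - {w, x}))"
      by (intro wpu_Write_Seq) simp
  qed
qed

lemma mend_intermediate:
  assumes A: "repr A \<mu>0" and w: "\<mu>0 ''w'' 0 = w"
    and 1: "agree {''i'', ''j'', ''deg''} \<mu>0 \<mu>1 \<and> (\<forall>v<n. \<mu>1 ''deg'' v = card (nb v \<inter> A))"
    and 2: "agree pick_vars \<mu>1 \<mu>2"
  shows "repr A \<mu>1" "repr A \<mu>2" "agree mend_vars \<mu>0 \<mu>2" "repr A (update ''x'' 0 k \<mu>2)"
    "agree mend_vars \<mu>0 (update ''x'' 0 k \<mu>2)"
    "update ''x'' 0 k \<mu>2 ''w'' 0 = w" "update ''x'' 0 k \<mu>2 ''x'' 0 = k"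
    "update ''x'' 0 k \<mu>2 ''e'' 0 = \<mu>0 ''e'' 0"
proof -
  show A1: "repr A \<mu>1" by (rule repr_agree[OF A conjunct1[OF 1]]) simp
  show A2: "repr A \<mu>2" by (rule repr_agree[OF A1 2]) simp
  show a: "agree mend_vars \<mu>0 \<mu>2" by (rule agree_compose[OF conjunct1[OF 1] 2]) auto
  show "repr A (update ''x'' 0 k \<mu>2)" using A2 by (rule repr_update) simp
  show "agree mend_vars \<mu>0 (update ''x'' 0 k \<mu>2)" using a by (rule agree_update) simp
  show "update ''x'' 0 k \<mu>2 ''w'' 0 = w" "update ''x'' 0 k \<mu>2 ''x'' 0 = k"
    "update ''x'' 0 k \<mu>2 ''e'' 0 = \<mu>0 ''e'' 0" using agreeD[OF a] w by auto
qed

text \<open>If a star is found, the outcome is a subset of the star-free set \<open>A - {w}\<close>,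
  and deletions cannot create stars.\<close>

lemma hoare_mend:
  assumes A: "repr A \<mu>0" and w: "\<mu>0 ''w'' 0 = w" "w \<in> A" and b: "bad (A - {w}) = {}"
    and e: "\<mu>0 ''e'' 0 \<le> 32 * (n * n)"
  shows "hoare (only \<mu>0) mend (T_mend n)
    (\<lambda>\<mu>. (\<exists>A'. repr A' \<mu> \<and> bad A' = {}) \<and> agree mend_vars \<mu>0 \<mu>)" (is "hoare _ _ _ ?Q")
  unfolding mend_def T_mend_def
proof (rule hoare_Seq_pt[OF hoare_degrees[OF A]])
  fix \<mu>1 assume 1: "agree {''i'', ''j'', ''deg''} \<mu>0 \<mu>1 \<and> (\<forall>v<n. \<mu>1 ''deg'' v = card (nb v \<inter> A))"
  have A1: "repr A \<mu>1" by (rule mend_intermediate(1)[OF A w(1) 1 agree_refl])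
  show "hoare (only \<mu>1) (Seq (pick cond_bad) redo) (T_find n + Suc (Suc (5 + T_thin n) + 1)) ?Q"
  proof (rule hoare_Seq_pt[OF pick_bad(1)[OF A1]])
    show "\<mu>1 ''deg'' v = card (nb v \<inter> A)" if "v < n" for v using 1 that by blast
    fix \<mu>2 assume 2: "picked (bad A) \<mu>1 \<mu>2"
    note m0 = mend_intermediate(2,3)[OF A w(1) 1 conjunct1[OF 2]]
    note m = mend_intermediate(4-8)[OF A w(1) 1 conjunct1[OF 2], where k = "\<mu>2 ''y'' 0"]
    show "hoare (only \<mu>2) redo (Suc (Suc (5 + T_thin n) + 1)) ?Q"
      unfolding redo_def
    proof (rule hoare_If_pt)
      assume "bval found \<mu>2"
      then have "bad A \<noteq> {}" using 2 by auto
      then have y: "\<mu>2 ''y'' 0 \<in> A" using 2 bad_subset by blast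
      have "hoare (only (update ''x'' 0 (\<mu>2 ''y'' 0) \<mu>2)) reset (5 + T_thin n) ?Q"
      proof (rule hoare_weaken[OF hoare_reset[OF m(1,3) w(2) m(4) y]])
        fix \<mu> assume *: "(\<exists>A'\<subseteq>A - {w, \<mu>2 ''y'' 0}. repr A' \<mu>) \<and> agree thin_vars (update ''x'' 0 (\<mu>2 ''y'' 0) \<mu>2) \<mu>"
        then obtain A' where A': "A' \<subseteq> A - {w, \<mu>2 ''y'' 0}" "repr A' \<mu>" by blast
        have "bad A' = {}" by (rule bad_mono[OF _ _ b]) (use A' reprD(7)[OF A] in auto)
        moreover have "agree mend_vars \<mu>0 \<mu>" by (rule agree_compose[OF m(2) conjunct2[OF *]]) auto
        ultimately show "?Q \<mu>" using A' by blast
      qed (use m(5) e in auto)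
      then show "hoare (only \<mu>2) (Seq (assign ''x'' (V ''y'')) reset) (Suc (5 + T_thin n)) ?Q"
        by (intro hoare_Write_Seq_pt) simp
    next
      assume "\<not> bval found \<mu>2"
      moreover have "finite (bad A)" using bad_subset reprD(7)[OF A] finite_subset by blast
      ultimately have "bad A = {}" using 2 by simp
      then show "hoare (only \<mu>2) Skip 1 ?Q" using m0 by (intro hoare_Skip_pt) blast
    qed
  qed
qed

text \<open>Only the neighbours of \<open>w\<close> gain a neighbour, and \<open>w\<close> itself is
  new. Hence the restricted sum in \<open>repair\<close> covers every centre that the program can
  choose.\<close>

lemma bad_insert_touching:
  assumes "bad A = {}" "w \<notin> A" "x \<in> bad (insert w A)"
  shows "x = w \<or> (x, w) \<in> E"
proof (rule ccontr)
  assume *: "\<not> (x = w \<or> (x, w) \<in> E)"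
  then have "nb x \<inter> insert w A = nb x \<inter> A" by (auto simp: nb_def)
  then have "x \<in> bad A" using assms(3) * by (auto simp: bad_def)
  then show False using assms(1) by simp
qed

lemma wpu_mend:
  assumes A: "repr A \<mu>0" and w: "\<mu>0 ''w'' 0 = w" "w \<in> A" and b: "bad (A - {w}) = {}"
    and f: "\<And>A. 0 \<le> f A"
    and F: "\<And>A' \<mu>. repr A' \<mu> \<Longrightarrow> agree mend_vars \<mu>0 \<mu> \<Longrightarrow> F \<mu> \<le> ennreal (f A')"
  shows "wpu mend F \<mu>0 \<le> ennreal (repair \<eta> (\<mu>0 ''e'' 0) f w A)"
  unfolding mend_def
proof (rule wpu_Seq_le[OF hoare_degrees[OF A]])
  fix \<mu>1 assume 1: "agree {''i'', ''j'', ''deg''} \<mu>0 \<mu>1 \<and> (\<forall>v<n. \<mu>1 ''deg'' v = card (nb v \<inter> A))"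
  let ?e = "\<mu>0 ''e'' 0"
  have A1: "repr A \<mu>1" by (rule mend_intermediate(1)[OF A w(1) 1 agree_refl])
  have deg: "\<mu>1 ''deg'' v = card (nb v \<inter> A)" if "v < n" for v using 1 that by blast
  show "wpu (Seq (pick cond_bad) redo) F \<mu>1 \<le> ennreal (repair \<eta> ?e f w A)"
  proof (cases "bad A = {}")
    case True
    show ?thesis
    proof (rule wpu_Seq_le[OF pick_bad(1)[OF A1 deg]])
      fix \<mu>2 assume 2: "picked (bad A) \<mu>1 \<mu>2"
      note m = mend_intermediate[OF A w(1) 1 conjunct1[OF 2]]
      show "wpu redo F \<mu>2 \<le> ennreal (repair \<eta> ?e f w A)"
      unfolding redo_def
      proof (rule wpu_If_le)
        show "wpu Skip F \<mu>2 \<le> ennreal (repair \<eta> ?e f w A)"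
          using F[OF m(2,3)] True by (simp add: wpu_Skip repair_def)
      qed (use 2 True in simp)
    qed
  next
    case False
    let ?h = "\<lambda>x. removal \<eta> (nb x) f ?e (A - {w, x})"
    have fin: "finite (bad A)" using bad_subset reprD(7)[OF A] finite_subset by blast
    have h: "0 \<le> ?h x" for x using removal_nonneg[OF \<eta>_nonneg f] .
    have "wpu (Seq (pick cond_bad) redo) F \<mu>1 \<le> wpu (pick cond_bad) (wpu redo F) \<mu>1"
      by (rule wpu_Seq)
    also have "\<dots> \<le> ennreal (avg \<eta> (bad A) ?h)"
    proof (rule pick_bad(2)[OF A1 deg False h])
      fix \<mu>2 assume 2: "agree pick_vars \<mu>1 \<mu>2" "\<mu>2 ''m'' 0 = card (bad A)" "\<mu>2 ''y'' 0 \<in> bad A"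
      let ?y = "\<mu>2 ''y'' 0"
      note m = mend_intermediate(4-8)[OF A w(1) 1 2(1), where k = ?y]
      have y: "?y \<in> A" using 2(3) bad_subset by blast
      show "wpu redo F \<mu>2 \<le> ennreal (?h ?y)"
      unfolding redo_def
      proof (rule wpu_If_le)
        have "wpu reset F (update ''x'' 0 ?y \<mu>2) \<le> ennreal (removal \<eta> (nb ?y) f (update ''x'' 0 ?y \<mu>2 ''e'' 0) (A - {w, ?y}))"
        proof (rule wpu_reset[OF m(1,3) w(2) m(4) y f])
          fix A' \<mu> assume *: "repr A' \<mu>" "agree thin_vars (update ''x'' 0 ?y \<mu>2) \<mu>"
          have "agree mend_vars \<mu>0 \<mu>" by (rule agree_compose[OF m(2) *(2)]) auto
          then show "F \<mu> \<le> ennreal (f A')" using F *(1) by blast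
        qed
        then show "wpu (Seq (assign ''x'' (V ''y'')) reset) F \<mu>2 \<le> ennreal (?h ?y)"
          unfolding m(5) by (intro wpu_Write_Seq) simp
      next
        assume "\<not> bval found \<mu>2"
        then show "wpu Skip F \<mu>2 \<le> ennreal (?h ?y)" using 2(2) False fin by simp
      qed
    qed
    also have "\<dots> \<le> ennreal (repair \<eta> ?e f w A)"
    proof (rule ennreal_leI)
      have "insert w (A - {w}) = A" using w(2) by auto
      then have "x = w \<or> (x, w) \<in> E" if "x \<in> bad A" for x
        using bad_insert_touching[OF b, where w = w and x = x] that by simp
      then have eq: "{x. x \<in> bad A \<and> (x = w \<or> (x, w) \<in> E)} = bad A"
        by blast
      have "1 \<le> card (bad A)" using False fin by (simp add: Suc_le_eq card_gt_0_iff)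
      then have "(1 + \<eta>) / card (bad A) \<le> 2 / 1"
        using \<eta>_le_1 \<eta>_nonneg by (intro frac_le) auto
      then have "avg \<eta> (bad A) ?h \<le> 2 * (\<Sum>x\<in>bad A. ?h x)"
        unfolding avg_def using h by (intro mult_right_mono sum_nonneg) auto
      then show "avg \<eta> (bad A) ?h \<le> repair \<eta> ?e f w A"
        unfolding repair_def eq using False by (simp add: sum_distrib_left)
    qed
    finally show ?thesis .
  qed
qed

lemma step_intermediate:
  assumes A: "repr A \<mu>0" and 1: "agree pick_vars \<mu>0 \<mu>1" "\<mu>1 ''y'' 0 = w" "w \<in> free A"
  defines "\<mu>2 \<equiv> update ''occ'' (rep w) 1 (update ''out'' w 1 (update ''w'' 0 w \<mu>1))"
  shows "repr (insert w A) \<mu>2" "\<mu>2 ''w'' 0 = w" "agree step_vars \<mu>0 \<mu>2"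
    "\<mu>2 ''e'' 0 = \<mu>0 ''e'' 0" "\<mu>2 ''done'' = \<mu>0 ''done''" "\<mu>1 ''block'' w = rep w" "w \<notin> A"
    "insert w A - {w} = A"
proof -
  have w: "w < n" "A \<inter> bl w = {}" using 1(3) by (auto simp: free_def)
  have A1: "repr A \<mu>1" by (rule repr_agree[OF A 1(1)]) simp
  have "repr A (update ''w'' 0 w \<mu>1)" using A1 by (rule repr_update) simp
  then show "repr (insert w A) \<mu>2" unfolding \<mu>2_def using 1(3) by (rule repr_insert)
  show "\<mu>2 ''w'' 0 = w" by (simp add: \<mu>2_def)
  show "agree step_vars \<mu>0 \<mu>2" unfolding \<mu>2_def
    by (intro agree_update agree_mono[OF 1(1)]) auto
  show "\<mu>2 ''e'' 0 = \<mu>0 ''e'' 0" "\<mu>2 ''done'' = \<mu>0 ''done''"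
    using agreeD[OF 1(1)] by (simp_all add: \<mu>2_def)
  show "\<mu>1 ''block'' w = rep w" using reprD(9)[OF A1 w(1)] .
  show "w \<notin> A" using w in_bl by blast
  then show "insert w A - {w} = A" by auto
qed

text \<open>The clause \<open>A' = A\<close> for empty \<open>free A\<close> is needed to conclude
  that a set \<open>done\<close> flag certifies a complete transversal.\<close>

lemma hoare_step:
  assumes A: "repr A \<mu>0" and b: "bad A = {}" and e: "\<mu>0 ''e'' 0 \<le> 32 * (n * n)"
  shows "hoare (only \<mu>0) step (T_step n)
    (\<lambda>\<mu>. (\<exists>A'. repr A' \<mu> \<and> bad A' = {} \<and> (free A = {} \<longrightarrow> A' = A)) \<and> agree step_vars \<mu>0 \<mu> \<and>
       \<mu> ''done'' 0 = (if free A = {} then 1 else \<mu>0 ''done'' 0))" (is "hoare _ _ _ ?Q")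
  unfolding step_def T_step_def
proof (rule hoare_Seq_pt[OF pick_free(1)[OF A]])
  fix \<mu>1 assume 1: "picked (free A) \<mu>0 \<mu>1"
  let ?w = "\<mu>1 ''y'' 0"
  show "hoare (only \<mu>1) (If found
     extend
     (assign ''done'' (Const 1))) (Suc (Suc (Suc (Suc (T_mend n))) + 1)) ?Q"
  proof (rule hoare_If_pt)
    assume "bval found \<mu>1"
    then have ne: "free A \<noteq> {}" using 1 by auto
    then have w: "?w \<in> free A" using 1 by blast
    note s = step_intermediate[OF A conjunct1[OF 1] refl w]
    let ?\<mu>2 = "update ''occ'' (rep ?w) 1 (update ''out'' ?w 1 (update ''w'' 0 ?w \<mu>1))"
    have "hoare (only ?\<mu>2) mend (T_mend n) ?Q"
    proof (rule hoare_weaken[OF hoare_mend[OF s(1,2)]])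
      fix \<mu> assume *: "(\<exists>A'. repr A' \<mu> \<and> bad A' = {}) \<and> agree mend_vars ?\<mu>2 \<mu>"
      have "agree step_vars \<mu>0 \<mu>" by (rule agree_compose[OF s(3) conjunct2[OF *]]) auto
      moreover have "\<mu> ''done'' = \<mu>0 ''done''" using agreeD[OF conjunct2[OF *], of "''done''"] s(5) by simp
      ultimately show "?Q \<mu>" using * ne by auto
    qed (use s(4,8) b e in auto)
    then show "hoare (only \<mu>1) extend (Suc (Suc (Suc (T_mend n)))) ?Q"
      unfolding extend_def by (intro hoare_Write_Seq_pt) (simp add: s(6))
  next
    assume "\<not> bval found \<mu>1"
    moreover have "finite (free A)" using free_subset finite_subset by blast
    ultimately have f: "free A = {}" using 1 by simp
    have "repr A \<mu>1" by (rule repr_agree[OF A conjunct1[OF 1]]) simp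
    then have "repr A (update ''done'' 0 1 \<mu>1)" by (rule repr_update) simp
    moreover have "agree step_vars \<mu>0 (update ''done'' 0 1 \<mu>1)"
      by (rule agree_update[OF agree_mono[OF conjunct1[OF 1]]]) auto
    ultimately show "hoare (only \<mu>1) (assign ''done'' (Const 1)) 1 ?Q"
      using f b by (intro hoare_Write_pt) auto
  qed
qed

lemma wpu_step:
  assumes A: "repr A \<mu>0" and b: "bad A = {}" and ne: "free A \<noteq> {}" and f: "\<And>A. 0 \<le> f A"
    and F: "\<And>A' \<mu>. repr A' \<mu> \<Longrightarrow> agree step_vars \<mu>0 \<mu> \<Longrightarrow> \<mu> ''done'' = \<mu>0 ''done'' \<Longrightarrow> F \<mu> \<le> ennreal (f A')"
  shows "wpu step F \<mu>0 \<le> ennreal (avg \<eta> (free A) (\<lambda>w. repair \<eta> (\<mu>0 ''e'' 0) f w (insert w A)))"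
proof -
  let ?e = "\<mu>0 ''e'' 0"
  let ?next = "If found extend (assign ''done'' (Const 1))"
  have "wpu step F \<mu>0 \<le> wpu (pick cond_free) (wpu ?next F) \<mu>0"
    unfolding step_def by (rule wpu_Seq)
  also have "\<dots> \<le> ennreal (avg \<eta> (free A) (\<lambda>w. repair \<eta> ?e f w (insert w A)))"
  proof (rule pick_free(2)[OF A ne repair_nonneg[OF \<eta>_nonneg f]])
    fix \<mu>1 assume 1: "agree pick_vars \<mu>0 \<mu>1" "\<mu>1 ''m'' 0 = card (free A)" "\<mu>1 ''y'' 0 \<in> free A"
    let ?w = "\<mu>1 ''y'' 0"
    note s = step_intermediate[OF A 1(1) refl 1(3)]
    let ?\<mu>2 = "update ''occ'' (rep ?w) 1 (update ''out'' ?w 1 (update ''w'' 0 ?w \<mu>1))"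
    show "wpu ?next F \<mu>1 \<le> ennreal (repair \<eta> ?e f ?w (insert ?w A))"
    proof (rule wpu_If_le)
      have "wpu mend F ?\<mu>2 \<le> ennreal (repair \<eta> (?\<mu>2 ''e'' 0) f ?w (insert ?w A))"
      proof (rule wpu_mend[OF s(1,2) _ _ f])
        fix A' \<mu> assume *: "repr A' \<mu>" "agree mend_vars ?\<mu>2 \<mu>"
        have "agree step_vars \<mu>0 \<mu>" by (rule agree_compose[OF s(3) *(2)]) auto
        moreover have "\<mu> ''done'' = \<mu>0 ''done''" using agreeD[OF *(2), of "''done''"] s(5) by simp
        ultimately show "F \<mu> \<le> ennreal (f A')" using F *(1) by blast
      qed (use s(8) b in auto)
      then show "wpu extend F \<mu>1 \<le> ennreal (repair \<eta> ?e f ?w (insert ?w A))"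
        unfolding s(4) extend_def by (intro wpu_Write_Seq) (simp add: s(6))
    next
      have "card (free A) \<noteq> 0" using ne free_subset[of A] finite_subset by fastforce
      then show "\<not> bval found \<mu>1 \<Longrightarrow>
        wpu (assign ''done'' (Const 1)) F \<mu>1 \<le> ennreal (repair \<eta> ?e f ?w (insert ?w A))"
        using 1(2) by simp
    qed
  qed
  finally show ?thesis .
qed

abbreviation search_inv :: "state \<Rightarrow> bool" where
  "search_inv \<mu> \<equiv> \<exists>A. repr A \<mu> \<and> bad A = {} \<and> (\<mu> ''done'' 0 \<noteq> 0 \<longrightarrow> free A = {})"

lemma hoare_search:
  "hoare (\<lambda>\<mu>. search_inv \<mu> \<and> \<mu> ''e'' 0 \<le> 32 * (n * n)) search (T_search n) search_inv"
proof -
  let ?I = "\<lambda>\<mu>. search_inv \<mu> \<and> \<mu> ''e'' 0 \<le> 32 * (n * n)"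
  let ?b = "And (Less (V ''cnt'') (V ''N'')) running"
  let ?N = "8 * (n * n) + 1"
  have "hoare (\<lambda>\<mu>. ?I \<mu> \<and> bval ?b \<mu> \<and> ?N - \<mu> ''cnt'' 0 = k) search_body (T_step n + 1)
    (\<lambda>\<mu>. ?I \<mu> \<and> ?N - \<mu> ''cnt'' 0 < k)" for k
  proof (rule hoare_pointwise)
    fix \<mu>0 assume 0: "?I \<mu>0 \<and> bval ?b \<mu>0 \<and> ?N - \<mu>0 ''cnt'' 0 = k"
    then obtain A where A: "repr A \<mu>0" "bad A = {}" and e: "\<mu>0 ''e'' 0 \<le> 32 * (n * n)" by auto
    have d: "\<mu>0 ''done'' 0 = 0" "\<mu>0 ''cnt'' 0 < ?N" using 0 reprD(4)[OF A(1)] by auto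
    show "hoare (only \<mu>0) search_body (T_step n + 1) (\<lambda>\<mu>. ?I \<mu> \<and> ?N - \<mu> ''cnt'' 0 < k)"
      unfolding search_body_def
    proof (rule hoare_Seq_pt[OF hoare_step[OF A e]])
      fix \<mu>1 assume 1: "(\<exists>A'. repr A' \<mu>1 \<and> bad A' = {} \<and> (free A = {} \<longrightarrow> A' = A)) \<and>
        agree step_vars \<mu>0 \<mu>1 \<and> \<mu>1 ''done'' 0 = (if free A = {} then 1 else \<mu>0 ''done'' 0)"
      then obtain A' where A': "repr A' \<mu>1" "bad A' = {}" "free A = {} \<longrightarrow> A' = A" by blast
      let ?\<mu> = "update ''cnt'' 0 (Suc (\<mu>1 ''cnt'' 0)) \<mu>1"
      have "repr A' ?\<mu>" using A'(1) by (rule repr_update) simp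
      moreover have "\<mu>1 ''done'' 0 \<noteq> 0 \<longrightarrow> free A' = {}"
        using A'(3) d(1) conjunct2[OF conjunct2[OF 1]] by (cases "free A = {}") simp_all
      ultimately have "search_inv ?\<mu>" using A'(2) by auto
      moreover have "\<mu>1 ''cnt'' = \<mu>0 ''cnt''" "\<mu>1 ''e'' = \<mu>0 ''e''"
        using agreeD[OF conjunct1[OF conjunct2[OF 1]]] by simp_all
      then have "?\<mu> ''e'' 0 \<le> 32 * (n * n)" "?N - ?\<mu> ''cnt'' 0 < k"
        using conjunct2[OF conjunct2[OF 0]] e d(2) by simp_all
      ultimately show "hoare (only \<mu>1) (incr ''cnt'') 1
        (\<lambda>\<mu>. ?I \<mu> \<and> ?N - \<mu> ''cnt'' 0 < k)"
        by (intro hoare_Write_pt) (simp only: aval.simps Suc_eq_plus1[symmetric] simp_thms)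
    qed
  qed
  note loop = hoare_While[where v = "\<lambda>\<mu>. ?N - \<mu> ''cnt'' 0", OF this, of ?N]
  show ?thesis unfolding search_def T_search_def
    by (rule hoare_weaken[OF loop]) auto
qed

lemma wpu_search:
  "repr A \<mu> \<Longrightarrow> bad A = {} \<Longrightarrow> \<mu> ''done'' 0 = 0 \<Longrightarrow> \<mu> ''e'' 0 \<le> 32 * (n * n) \<Longrightarrow>
    \<mu> ''cnt'' 0 + k = 8 * (n * n) + 1 \<Longrightarrow>
    wpu search unfinished \<mu> \<le> ennreal (failure \<eta> (\<mu> ''e'' 0) k A)"
proof (induction k arbitrary: A \<mu>)
  case 0
  have "wpu search unfinished \<mu> \<le> 1" by (rule wpu_le_1) simp
  then show ?case by simp
next
  case (Suc k)
  note A = Suc.prems(1,2) and d = Suc.prems(3) and e = Suc.prems(4)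
  let ?b = "And (Less (V ''cnt'') (V ''N'')) running"
  let ?inc = "incr ''cnt''"
  let ?G = "wpu ?inc (wpu search unfinished)"
  have "bval ?b \<mu>" using Suc.prems(5) reprD(4)[OF A(1)] d by simp
  then have "wpu search unfinished \<mu> \<le> wpu search_body (wpu search unfinished) \<mu>"
    using wpu_While[of ?b search_body unfinished \<mu>] by (simp add: search_def)
  also have "\<dots> \<le> wpu step ?G \<mu>" unfolding search_body_def by (rule wpu_Seq)
  also have "\<dots> \<le> ennreal (failure \<eta> (\<mu> ''e'' 0) (Suc k) A)"
  proof (cases "free A = {}")
    case True
    \<comment> \<open>With nothing free the step raises \<open>done\<close>, so the search stops as
      finished.\<close>
    have "wpu step ?G \<mu> \<le> 0"
    proof (rule wpu_le_hoare[OF hoare_step[OF A e]])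
      fix \<mu>1 assume "(\<exists>A'. repr A' \<mu>1 \<and> bad A' = {} \<and> (free A = {} \<longrightarrow> A' = A)) \<and>
        agree step_vars \<mu> \<mu>1 \<and> \<mu>1 ''done'' 0 = (if free A = {} then 1 else \<mu> ''done'' 0)"
      then have "\<mu>1 ''done'' 0 = 1" using True by simp
      then show "?G \<mu>1 \<le> 0"
        using wpu_While[of ?b search_body unfinished "update ''cnt'' 0 (Suc (\<mu>1 ''cnt'' 0)) \<mu>1"]
        by (simp add: wpu_Write search_def)
    qed
    then show ?thesis using True by simp
  next
    case False
    \<comment> \<open>The induction hypothesis needs a star-free set, while the bound for a step
      quantifies over all represented sets. Replacing the value by 0 elsewhere is harmless, because
      such states are unreachable.\<close>
    let ?G' = "\<lambda>\<mu>'. if \<exists>A'. repr A' \<mu>' \<and> bad A' = {} then ?G \<mu>' else 0"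
    have "wpu step ?G \<mu> \<le> wpu step ?G' \<mu>"
      by (rule wpu_mono_hoare[OF hoare_step[OF A e]]) auto
    also have "\<dots> \<le> ennreal (avg \<eta> (free A) (\<lambda>w. repair \<eta> (\<mu> ''e'' 0) (failure \<eta> (\<mu> ''e'' 0) k) w (insert w A)))"
    proof (rule wpu_step[OF A False failure_nonneg[OF \<eta>_nonneg]])
      fix A' \<mu>' assume *: "repr A' \<mu>'" "agree step_vars \<mu> \<mu>'" "\<mu>' ''done'' = \<mu> ''done''"
      show "?G' \<mu>' \<le> ennreal (failure \<eta> (\<mu> ''e'' 0) k A')"
      proof (cases "bad A' = {}")
        case True
        let ?\<mu> = "update ''cnt'' 0 (Suc (\<mu>' ''cnt'' 0)) \<mu>'"
        have eq: "\<mu>' ''cnt'' = \<mu> ''cnt''" "\<mu>' ''e'' = \<mu> ''e''" using agreeD[OF *(2)] by auto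
        have "repr A' ?\<mu>" using *(1) by (rule repr_update) simp
        then have "wpu search unfinished ?\<mu> \<le> ennreal (failure \<eta> (?\<mu> ''e'' 0) k A')"
          using True d e eq *(3) Suc.prems(5) by (intro Suc.IH) auto
        then show ?thesis using eq by (simp add: wpu_Write)
      next
        case False
        then have "\<not> (\<exists>A'. repr A' \<mu>' \<and> bad A' = {})" using repr_unique[OF *(1)] by blast
        then show ?thesis by (subst if_not_P) auto
      qed
    qed
    finally show ?thesis using False by simp
  qed
  finally show ?case .
qed

lemma hoare_clear:
  assumes "data \<mu>0"
  shows "hoare (only \<mu>0) clear (2 + n * 4)
    (\<lambda>\<mu>. repr {} \<mu> \<and> agree {''i'', ''out'', ''occ''} \<mu>0 \<mu>)"
proof -
  let ?X = "{''i'', ''out'', ''occ''}"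
  let ?J = "\<lambda>k \<mu>. agree ?X \<mu>0 \<mu> \<and> (\<forall>v<k. \<mu> ''out'' v = 0 \<and> \<mu> ''occ'' v = 0)"
  have d: "data \<mu>" if "agree ?X \<mu>0 \<mu>" for \<mu>
    by (rule data_agree[OF assms that]) simp
  have "hoare (only \<mu>0) clear (2 + n * (2 + 2)) (?J n)"
    unfolding clear_def
  proof (rule hoare_For[where J = ?J])
    fix k assume "k < n"
    have "hoare (\<lambda>\<mu>. ?J k \<mu> \<and> \<mu> ''i'' 0 = k)
      (Seq (Write ''out'' (V ''i'') (Const 0)) (Write ''occ'' (V ''i'') (Const 0))) (Suc 1)
      (\<lambda>\<mu>. ?J (Suc k) \<mu> \<and> \<mu> ''i'' 0 = k)"
      by (rule hoare_pointwise, rule hoare_Write_Seq_pt, rule hoare_Write_pt)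
        (simp add: agree_update less_Suc_eq)
    then show "hoare (\<lambda>\<mu>. ?J k \<mu> \<and> \<mu> ''i'' 0 = k)
      (Seq (Write ''out'' (V ''i'') (Const 0)) (Write ''occ'' (V ''i'') (Const 0))) 2
      (\<lambda>\<mu>. ?J (Suc k) \<mu> \<and> \<mu> ''i'' 0 = k)" by (rule hoare_weaken) auto
  next
    fix k \<mu> assume "?J k \<mu>"
    then show "\<mu> ''n'' 0 = n" using d by (auto simp: data_def)
  qed (auto simp: agree_update)
  then show ?thesis
  proof (rule hoare_weaken)
    fix \<mu> assume *: "?J n \<mu>"
    then show "repr {} \<mu> \<and> agree ?X \<mu>0 \<mu>"
      using d rep_lt by (simp add: repr_def)
  qed auto
qed

text \<open>After a failed trial only the input data matter, since the next trial clears
  \<open>out\<close> and \<open>occ\<close>.\<close>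

abbreviation trial_inv :: "state \<Rightarrow> bool" where
  "trial_inv \<mu> \<equiv> data \<mu> \<and> (\<mu> ''done'' 0 = 0 \<or> search_inv \<mu>)"

lemma bad_empty: "bad {} = {}" by (simp add: bad_def)

lemma trial_intermediate:
  assumes "data \<mu>0" "\<mu>0 ''done'' 0 = 0" "agree sample_vars \<mu>0 \<mu>1" "\<mu>1 ''r'' 0 = r"
    and 2: "repr {} \<mu>2 \<and> agree {''i'', ''out'', ''occ''} (update ''e'' 0 r \<mu>1) \<mu>2"
  defines "\<mu>3 \<equiv> update ''cnt'' 0 0 \<mu>2"
  shows "repr {} \<mu>3" "\<mu>3 ''done'' 0 = 0" "\<mu>3 ''e'' 0 = r" "\<mu>3 ''cnt'' 0 = 0"
proof -
  show "repr {} \<mu>3" unfolding \<mu>3_def using conjunct1[OF 2] by (rule repr_update) simp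
  show "\<mu>3 ''done'' 0 = 0" "\<mu>3 ''e'' 0 = r" "\<mu>3 ''cnt'' 0 = 0"
    using assms(2) agreeD[OF assms(3)] agreeD[OF conjunct2[OF 2]] by (simp_all add: \<mu>3_def)
qed

lemma data_sampled:
  assumes "data \<mu>0" "agree sample_vars \<mu>0 \<mu>1"
  shows "data (update ''e'' 0 r \<mu>1)"
proof (rule data_agree[OF assms(1)])
  show "agree {''r'', ''q'', ''z'', ''e''} \<mu>0 (update ''e'' 0 r \<mu>1)"
    by (rule agree_update[OF agree_mono[OF assms(2)]]) auto
qed simp

lemma data_M: "data \<mu> \<Longrightarrow> \<mu> ''M'' 0 = 16 * (n * n)"
  by (simp add: data_def)

lemma hoare_trial:
  "hoare (\<lambda>\<mu>. trial_inv \<mu> \<and> bval running \<mu>) trial (T_trial n) trial_inv"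
proof (rule hoare_pointwise)
  fix \<mu>0 assume "trial_inv \<mu>0 \<and> bval running \<mu>0"
  then have d: "data \<mu>0" "\<mu>0 ''done'' 0 = 0" by auto
  show "hoare (only \<mu>0) trial (T_trial n) trial_inv"
    unfolding trial_def T_trial_def
  proof (rule hoare_Seq_pt[OF hoare_sample[of \<mu>0 "16 * (n * n)", OF data_M[OF d(1)]]], rule hoare_Write_Seq_pt)
    fix \<mu>1 assume 1: "agree sample_vars \<mu>0 \<mu>1 \<and> \<mu>1 ''r'' 0 \<le> 2 * (16 * (n * n))"
    let ?\<mu> = "update ''e'' 0 (\<mu>1 ''r'' 0) \<mu>1"
    have "hoare (only ?\<mu>) attempt
      (2 + n * 4 + Suc (T_search n)) trial_inv"
      unfolding attempt_def
    proof (rule hoare_Seq_pt[OF hoare_clear[OF data_sampled[OF d(1) conjunct1[OF 1]]]],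
        rule hoare_Write_Seq_pt)
      fix \<mu>2 assume 2: "repr {} \<mu>2 \<and> agree {''i'', ''out'', ''occ''} ?\<mu> \<mu>2"
      note t = trial_intermediate[OF d conjunct1[OF 1] refl 2]
      have "hoare (only (update ''cnt'' 0 0 \<mu>2)) search (T_search n) trial_inv"
      proof (rule hoare_weaken[OF hoare_search])
        fix \<mu> assume "\<mu> = update ''cnt'' 0 0 \<mu>2"
        then show "search_inv \<mu> \<and> \<mu> ''e'' 0 \<le> 32 * (n * n)"
          using t bad_empty 1 by auto
      qed (auto simp: repr_def)
      then show "hoare (\<lambda>\<mu>. \<mu> = update ''cnt'' (aval (Const 0) \<mu>2) (aval (Const 0) \<mu>2) \<mu>2) search
        (T_search n) trial_inv" by simp
    qed
    then show "hoare (\<lambda>\<mu>. \<mu> = update ''e'' (aval (Const 0) \<mu>1) (aval (V ''r'') \<mu>1) \<mu>1)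
      attempt (2 + n * 4 + Suc (T_search n)) trial_inv"
      by simp
  qed
qed

text \<open>Only the good guess is credited: at most \<open>32 * n * n + 1\<close> values are
  equally likely, and the good one succeeds with probability at least \<open>1 / 2\<close>.\<close>

lemma wpu_trial:
  assumes d: "data \<mu>0" "\<mu>0 ''done'' 0 = 0"
    and e: "e \<le> n" "failure \<eta> e (8 * (n * n) + 1) {} \<le> 1 / 2"
  shows "wpu trial unfinished \<mu>0 \<le> ennreal (1 - 1 / (64 * (n * n) + 2))"
proof -
  \<comment> \<open>For poor guesses \<open>failure\<close> may exceed 1, so it is capped by the
    trivial bound.\<close>
  let ?h = "\<lambda>j. min 1 (failure \<eta> j (8 * (n * n) + 1) {})"
  let ?rest = "Seq (assign ''e'' (V ''r'')) attempt"
  let ?Q = "2 ^ bits (16 * (n * n)) :: nat"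
  have "wpu trial unfinished \<mu>0 \<le> wpu sample (wpu ?rest unfinished) \<mu>0"
    unfolding trial_def by (rule wpu_Seq)
  also have "\<dots> \<le> wpu sample (\<lambda>\<mu>. if \<mu> ''r'' 0 \<le> 32 * (n * n) then wpu ?rest unfinished \<mu> else 0) \<mu>0"
    by (rule wpu_mono_hoare[OF hoare_sample[of \<mu>0 "16 * (n * n)", OF data_M[OF d(1)]]]) auto
  also have "\<dots> \<le> ennreal ((\<Sum>j<2 ^ bits (16 * (n * n)). ?h j) / 2 ^ bits (16 * (n * n)))"
  proof (rule wpu_sample[of \<mu>0 "16 * (n * n)", OF data_M[OF d(1)]])
    fix \<mu>1 assume 1: "agree sample_vars \<mu>0 \<mu>1"
    let ?\<mu> = "update ''e'' 0 (\<mu>1 ''r'' 0) \<mu>1"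
    have "wpu ?rest unfinished \<mu>1 \<le> ennreal (failure \<eta> (\<mu>1 ''r'' 0) (8 * (n * n) + 1) {})"
      if r: "\<mu>1 ''r'' 0 \<le> 32 * (n * n)"
    proof (rule wpu_Write_Seq)
      have "wpu attempt unfinished ?\<mu> \<le>
        ennreal (failure \<eta> (\<mu>1 ''r'' 0) (8 * (n * n) + 1) {})"
        unfolding attempt_def
      proof (rule wpu_Seq_le[OF hoare_clear[OF data_sampled[OF d(1) 1]]], rule wpu_Write_Seq)
        fix \<mu>2 assume 2: "repr {} \<mu>2 \<and> agree {''i'', ''out'', ''occ''} ?\<mu> \<mu>2"
        note t = trial_intermediate[OF d 1 refl 2]
        have "wpu search unfinished (update ''cnt'' 0 0 \<mu>2) \<le>
          ennreal (failure \<eta> (update ''cnt'' 0 0 \<mu>2 ''e'' 0) (8 * (n * n) + 1) {})"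
          by (rule wpu_search[OF t(1) bad_empty t(2)]) (use t(3,4) r in auto)
        then show "wpu search unfinished (update ''cnt'' (aval (Const 0) \<mu>2) (aval (Const 0) \<mu>2) \<mu>2) \<le>
          ennreal (failure \<eta> (\<mu>1 ''r'' 0) (8 * (n * n) + 1) {})" unfolding t(3) by simp
      qed
      then show "wpu attempt unfinished
        (update ''e'' (aval (Const 0) \<mu>1) (aval (V ''r'') \<mu>1) \<mu>1) \<le>
        ennreal (failure \<eta> (\<mu>1 ''r'' 0) (8 * (n * n) + 1) {})" by simp
    qed
    moreover have "wpu ?rest unfinished \<mu>1 \<le> ennreal 1"
      using wpu_le_1[of unfinished ?rest \<mu>1] by simp
    ultimately show "(if \<mu>1 ''r'' 0 \<le> 32 * (n * n) then wpu ?rest unfinished \<mu>1 else 0) \<le>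
      ennreal (?h (\<mu>1 ''r'' 0))" by (simp add: min_def)
  next
    fix j
    show "0 \<le> ?h j"
      by (rule min.boundedI[OF zero_le_one failure_nonneg[OF \<eta>_nonneg]])
  qed
  also have "\<dots> \<le> ennreal (1 - 1 / (64 * (n * n) + 2))"
  proof (rule ennreal_leI)
    have Q: "?Q \<le> 32 * (n * n) + 1" using bits_le[of "16 * (n * n)"] by simp
    have "e < ?Q"
    proof (cases "n = 0")
      case False
      then have "n < 16 * (n * n)" by (cases n) auto
      also have "\<dots> \<le> ?Q" by (rule bits_ge)
      finally show ?thesis using e(1) by simp
    qed (use e(1) in simp)
    then have "(\<Sum>j<?Q. ?h j) = ?h e + (\<Sum>j\<in>{..<?Q} - {e}. ?h j)"
      by (intro sum.remove) auto
    also have "\<dots> \<le> 1 / 2 + (\<Sum>j\<in>{..<?Q} - {e}. 1)"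
      using e(2) by (intro add_mono sum_mono) auto
    also have "\<dots> = real ?Q - 1 / 2" using \<open>e < ?Q\<close> by (simp add: of_nat_diff)
    finally have "(\<Sum>j<?Q. ?h j) / ?Q \<le> (real ?Q - 1 / 2) / ?Q"
      by (intro divide_right_mono) auto
    also have "\<dots> = 1 - 1 / (2 * real ?Q)" by (simp add: field_simps)
    also have "\<dots> \<le> 1 - 1 / real (64 * (n * n) + 2)"
    proof -
      have "real (2 * ?Q) \<le> real (64 * (n * n) + 2)" using Q by (intro of_nat_mono) simp
      then have "1 / real (64 * (n * n) + 2) \<le> 1 / (2 * real ?Q)" by (intro frac_le) auto
      then show ?thesis by linarith
    qed
    finally show "(\<Sum>j<2 ^ bits (16 * (n * n)). ?h j) / 2 ^ bits (16 * (n * n)) \<le>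
      1 - 1 / (64 * (n * n) + 2)" by simp
  qed
  finally show ?thesis .
qed

lemma hoare_init:
  "hoare (only (encoding n E P s)) init (T_init n) (\<lambda>\<mu>. data \<mu> \<and> \<mu> ''done'' 0 = 0)"
proof -
  let ?\<mu>0 = "encoding n E P s"
  let ?Q = "\<lambda>\<mu>. data \<mu> \<and> \<mu> ''done'' 0 = 0"
  let ?tail = "Seq (assign ''M'' (twice (twice (twice (twice (Read ''mul'' (V ''n'')))))))
       (assign ''N'' (Plus (twice (twice (twice (Read ''mul'' (V ''n''))))) (Const 1)))"
  let ?X = "{''i'', ''mul''}"
  let ?J = "\<lambda>k \<mu>. agree ?X ?\<mu>0 \<mu> \<and> (\<forall>i\<le>k. \<mu> ''mul'' i = i * n)"
  have n: "\<mu> ''n'' 0 = n" if "agree ?X ?\<mu>0 \<mu>" for \<mu>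
    using agreeD[OF that, of "''n''"] by (simp add: encoding_def)
  have m: "hoare (only ?\<mu>0) multiples (2 + n * (1 + 2)) (?J n)"
    unfolding multiples_def
  proof (rule hoare_For[where J = ?J])
    fix \<mu> assume "\<mu> = ?\<mu>0"
    then show "?J 0 \<mu>" by (simp add: encoding_def)
  next
    fix k assume "k < n"
    show "hoare (\<lambda>\<mu>. ?J k \<mu> \<and> \<mu> ''i'' 0 = k)
      (Write ''mul'' (Plus (V ''i'') (Const 1)) (Plus (Read ''mul'' (V ''i'')) (V ''n''))) 1
      (\<lambda>\<mu>. ?J (Suc k) \<mu> \<and> \<mu> ''i'' 0 = k)"
      by (rule hoare_Write) (auto simp: agree_update le_Suc_eq n)
  qed (auto simp: agree_update n)
  have "hoare (only ?\<mu>0) init (2 + n * (1 + 2) + Suc 1) ?Q"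
    unfolding init_def
  proof (rule hoare_Seq_pt[OF m])
    fix \<mu>1 assume 1: "?J n \<mu>1"
    note a = agreeD[OF conjunct1[OF 1]]
    have adj: "?\<mu>0 ''adj'' (i * n + j) = of_bool ((i, j) \<in> E)" if "i < n" "j < n" for i j
    proof -
      have "i * n + j < n * n"
      proof -
        have "i * n + j < Suc i * n" using that by simp
        also have "\<dots> \<le> n * n" using that by (intro mult_le_mono1) simp
        finally show ?thesis .
      qed
      moreover have "(i * n + j) div n = i" "(i * n + j) mod n = j" using that by auto
      ultimately show ?thesis by (simp add: encoding_def)
    qed
    have "?\<mu>0 ''block'' v = rep v" if "v < n" for v
      using that by (simp add: encoding_def rep_def bl_def)
    moreover have "\<mu>1 ''s'' 0 = s" "\<mu>1 ''done'' 0 = 0" using a by (simp_all add: encoding_def)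
    ultimately show "hoare (only \<mu>1) ?tail (Suc 1) ?Q"
      by (intro hoare_Write_Seq_pt hoare_Write_pt)
        (use 1 n[OF conjunct1[OF 1]] a adj in \<open>simp add: data_def twice_def\<close>)
  qed
  then show ?thesis by (rule hoare_weaken) (auto simp: T_init_def)
qed

section \<open>From the restart loop to the theorem\<close>

lemma search_inv_result:
  assumes inv: "search_inv \<mu>" and d: "\<mu> ''done'' 0 \<noteq> 0"
  shows "transversal P (result_of n \<mu>) \<and> \<not> contains_star E (result_of n \<mu>) s"
proof -
  obtain A where A: "repr A \<mu>" "bad A = {}" "free A = {}" using inv d by blast
  have res: "result_of n \<mu> = A"
    using reprD(5,8)[OF A(1)] by (auto simp: result_of_def of_bool_def split: if_splits)
  have "\<exists>!v. v \<in> A \<inter> B" if B: "B \<in> P" for B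
  proof -
    obtain u where u: "u \<in> B" using B partition by (metis all_not_in_conv partition_on_def)
    then have un: "u < n" using B Union_P by auto
    then have ne: "A \<inter> B \<noteq> {}" using A(3) bl_eq[OF B u] by (auto simp: free_def)
    have "v = w" if "v \<in> A \<inter> B" "w \<in> A \<inter> B" for v w
      using that bl_eq[OF B] reprD(6)[OF A(1)] by (metis IntE inj_onD)
    then show ?thesis using ne by blast
  qed
  then have "transversal P A" using reprD(5)[OF A(1)] by (simp add: transversal_def Union_P)
  moreover have "\<not> contains_star E A s"
  proof
    assume "contains_star E A s"
    then obtain v S where v: "v \<in> A" "S \<subseteq> A - {v}" "card S = s" "\<forall>u\<in>S. (v, u) \<in> E"
      unfolding contains_star_def by blast
    then have "S \<subseteq> nb v \<inter> A" by (auto simp: nb_def)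
    then have "card S \<le> card (nb v \<inter> A)" by (intro card_mono) simp
    then have "v \<in> bad A" using v by (simp add: bad_def)
    then show False using A(2) by simp
  qed
  ultimately show ?thesis using res by simp
qed

lemma las_vegas_algorithm:
  assumes e: "e \<le> n" "failure \<eta> e (8 * (n * n) + 1) {} \<le> 1 / 2"
  shows "las_vegas algorithm (encoding n E P s)
    (\<lambda>\<mu>. transversal P (result_of n \<mu>) \<and> \<not> contains_star E (result_of n \<mu>) s)
    (of_nat (T_init n + (T_trial n + 2) * (64 * (n * n) + 2)))"
proof -
  let ?\<delta> = "1 / real (64 * (n * n) + 2)"
  let ?b = "running"
  let ?x = "(encoding n E P s, 0 :: nat)"
  interpret succeeding_loop trial_inv ?b trial "T_trial n" ?\<delta>
  proof
    show "hoare (\<lambda>\<mu>. trial_inv \<mu> \<and> bval ?b \<mu>) trial (T_trial n) trial_inv" by (rule hoare_trial)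
    have "real 1 \<le> real (64 * (n * n) + 2)" by (rule of_nat_mono) simp
    then have "1 \<le> real (64 * (n * n) + 2)" by (simp only: of_nat_1)
    then show "0 < ?\<delta>" "?\<delta> \<le> 1" by (auto simp only: divide_le_eq_1 zero_less_divide_1_iff)
    fix \<mu> assume "trial_inv \<mu>" "bval ?b \<mu>"
    then have "data \<mu>" "\<mu> ''done'' 0 = 0" by auto
    from wpu_trial[OF this e] show "wpu trial unfinished \<mu> \<le> ennreal (1 - ?\<delta>)" by simp
  qed
  note i = hoareD[OF hoare_init, of ?x, simplified fst_conv snd_conv, OF refl]
  have I: "trial_inv (fst y)" if "y \<in> set_spmf (run init ?x)" for y using i(2)[OF that] by blast
  have run: "run algorithm ?x = bind_spmf (run init ?x) (run (While ?b trial))"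
    by (simp add: algorithm_def)
  show ?thesis unfolding las_vegas_def
  proof (intro conjI ballI)
    show "lossless_spmf (run algorithm ?x)"
      unfolding run using i(1) loop_lossless I by simp
  next
    fix y assume "y \<in> set_spmf (run algorithm ?x)"
    then obtain z where z: "z \<in> set_spmf (run init ?x)" "y \<in> set_spmf (run (While ?b trial) z)"
      unfolding run by (auto simp: set_bind_spmf)
    have "trial_inv (fst y) \<and> \<not> bval ?b (fst y)" by (rule loop_post[OF I[OF z(1)] z(2)])
    then have "search_inv (fst y)" "fst y ''done'' 0 \<noteq> 0" by auto
    then show "transversal P (result_of n (fst y))" "\<not> contains_star E (result_of n (fst y)) s"
      using search_inv_result by blast+
  next
    have "expected_time algorithm (encoding n E P s) =
      (\<integral>\<^sup>+ z. \<integral>\<^sup>+ y. of_nat (snd y) \<partial>measure_spmf (run (While ?b trial) z) \<partial>measure_spmf (run init ?x))"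
      unfolding expected_time_def run by (simp add: nn_integral_bind_spmf)
    also have "\<dots> \<le> ennreal (T_init n + (T_trial n + 2) * (64 * (n * n) + 2))"
    proof (rule nn_integral_spmf_le_const)
      fix z assume z: "z \<in> set_spmf (run init ?x)"
      have "(\<integral>\<^sup>+ y. of_nat (snd y) \<partial>measure_spmf (run (While ?b trial) z)) \<le>
        ennreal (real (snd z) + real (T_trial n + 2) / ?\<delta>)"
        by (rule loop_expected_time[OF I[OF z]])
      also have "\<dots> \<le> ennreal (T_init n + (T_trial n + 2) * (64 * (n * n) + 2))"
      proof (rule ennreal_leI)
        have "real (T_trial n + 2) / ?\<delta> = real ((T_trial n + 2) * (64 * (n * n) + 2))"
          by (simp only: divide_divide_eq_right div_by_1 of_nat_mult)
        moreover have "real (snd z) \<le> real (T_init n)" using i(3)[OF z] by simp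
        ultimately show "real (snd z) + real (T_trial n + 2) / ?\<delta> \<le>
          real (T_init n + (T_trial n + 2) * (64 * (n * n) + 2))" by (simp only: of_nat_add)
      qed
      finally show "(\<integral>\<^sup>+ y. of_nat (snd y) \<partial>measure_spmf (run (While ?b trial) z)) \<le>
        ennreal (T_init n + (T_trial n + 2) * (64 * (n * n) + 2))" .
    qed
    finally show "expected_time algorithm (encoding n E P s) \<le>
      of_nat (T_init n + (T_trial n + 2) * (64 * (n * n) + 2))"
      by (simp only: ennreal_of_nat_eq_real_of_nat)
  qed
qed

end

text \<open>Exact equality with a polynomial is within reach because all time bounds are built from
  sums and products only.\<close>

definition polynomial :: "(nat \<Rightarrow> nat) \<Rightarrow> bool" where
  "polynomial T \<longleftrightarrow> (\<exists>p. \<forall>n. T n = poly p n)"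

lemma polynomial_intros:
  "polynomial (\<lambda>n. k)" "polynomial (\<lambda>n. n)"
  "polynomial T \<Longrightarrow> polynomial U \<Longrightarrow> polynomial (\<lambda>n. T n + U n)"
  "polynomial T \<Longrightarrow> polynomial U \<Longrightarrow> polynomial (\<lambda>n. T n * U n)"
proof -
  show "polynomial (\<lambda>n. k)" unfolding polynomial_def by (rule exI[of _ "[:k:]"]) simp
  show "polynomial (\<lambda>n. n)" unfolding polynomial_def by (rule exI[of _ "[:0, 1:]"]) simp
  show "polynomial (\<lambda>n. T n + U n)" if "polynomial T" "polynomial U"
    using that unfolding polynomial_def by (metis poly_add)
  show "polynomial (\<lambda>n. T n * U n)" if "polynomial T" "polynomial U"
    using that unfolding polynomial_def by (metis poly_mult)
qed

lemma polynomial_total: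
  "polynomial (\<lambda>n. T_init n + (T_trial n + 2) * (64 * (n * n) + 2))"
  unfolding T_init_def T_trial_def T_search_def T_step_def T_mend_def T_thin_def T_degrees_def
    T_find_def T_pick_def T_sample_def Suc_eq_plus1
  by (intro polynomial_intros)

theorem theorem6p2:
  shows "\<exists>(c :: real) (prog :: com) (p :: nat poly).
    \<forall>(n :: nat) (E :: (nat \<times> nat) set) (P :: nat set set) (\<Delta> :: nat) (b :: nat) (s :: nat).
      simple_graph {..<n} E \<and> max_degree {..<n} E = \<Delta> \<and>
      partition_on {..<n} P \<and> (\<forall>B\<in>P. card B = b) \<and> s \<ge> 2 \<and>
      real b \<ge> real \<Delta> / real s * (1 + c * sqrt (ln (real s) / real s))
      \<longrightarrow>
      (\<exists>A. transversal P A \<and> \<not> contains_star E A s) \<and>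
      las_vegas prog (encoding n E P s)
        (\<lambda>\<sigma>. transversal P (result_of n \<sigma>) \<and> \<not> contains_star E (result_of n \<sigma>) s)
        (of_nat (poly p n))"
proof -
  obtain p where p: "\<And>n. T_init n + (T_trial n + 2) * (64 * (n * n) + 2) = poly p n"
    using polynomial_total unfolding polynomial_def by blast
  show ?thesis
  proof (rule exI[of _ "24 * exp 24"], rule exI[of _ algorithm], rule exI[of _ p],
      intro allI impI, elim conjE)
    fix n :: nat and E :: "(nat \<times> nat) set" and P :: "nat set set" and \<Delta> b s :: nat
    assume *: "simple_graph {..<n} E" "max_degree {..<n} E = \<Delta>" "partition_on {..<n} P"
      "\<forall>B\<in>P. card B = b" "2 \<le> s"
      "real \<Delta> / real s * (1 + 24 * exp 24 * sqrt (ln (real s) / real s)) \<le> real b"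
    interpret blocked_graph n E P b s
      by unfold_locales (use * in auto)
    obtain e where e: "e \<le> n" "failure \<eta> e (8 * (n * n) + 1) {} \<le> 1 / 2"
      using good_parameter_exists[OF *(5) \<eta>_def refl] *(2,6) by blast
    let ?good = "\<lambda>\<sigma>. transversal P (result_of n \<sigma>) \<and> \<not> contains_star E (result_of n \<sigma>) s"
    have lv: "las_vegas algorithm (encoding n E P s) ?good (of_nat (poly p n))"
      using las_vegas_algorithm[OF e] unfolding p .
    \<comment> \<open>Existence needs no separate argument: a terminating run has a possible result,
      and every possible result is correct.\<close>
    then have "lossless_spmf (run algorithm (encoding n E P s, 0))" by (simp only: las_vegas_def)
    then have "set_spmf (run algorithm (encoding n E P s, 0)) \<noteq> {}" by (rule lossless_set_nonempty)
    then show "(\<exists>A. transversal P A \<and> \<not> contains_star E A s) \<and>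
      las_vegas algorithm (encoding n E P s) ?good (of_nat (poly p n))"
      using lv unfolding las_vegas_def by blast
  qed
qed

end
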